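(* Assume that there are constants $C>0$ and $\gamma\in(0,1)$ such that for all $(\alpha,\beta,i,j,k,l)\in\Omega$, $$0\le\sigma^{\alpha\beta}_{ij,kl}(|\mathbf g|,\cos\theta)\le\frac{C}{|\mathbf g|^2}\Big(\Psi^{\alpha\beta}_{ij,kl}+(\Psi^{\alpha\beta}_{ij,kl})^{\gamma/2}\Big),\quad\Psi^{\alpha\beta}_{ij,kl}=|\mathbf g|\sqrt{|\mathbf g|^2-2\widetilde\Delta I^{\alpha\beta}_{kl,ij}},$$ whenever $|\mathbf g|^2>2\widetilde\Delta I^{\alpha\beta}_{kl,ij}$. Then the operator $K=(K_{1,1},\dots,K_{1,r_1},\dots,K_{s,1},\dots,K_{s,r_s})$ is a self-adjoint compact operator on $(L^2(d\boldsymbol\xi))^r$.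
   Context: Setup. Fix integers $s\ge1$, $r_1,\dots,r_s\ge1$, $r=\sum_\alpha r_\alpha$; masses $m_\alpha>0$; internal energies $I_1^\alpha,\dots,I_{r_\alpha}^\alpha\ge0$ and positive weights $\varphi_1^\alpha,\dots,\varphi_{r_\alpha}^\alpha>0$ for $\alpha\in\{1,\dots,s\}$. Let $\Omega=\{(\alpha,\beta,i,j,k,l):\alpha,\beta\in\{1,\dots,s\},\ i,k\in\{1,\dots,r_\alpha\},\ j,l\in\{1,\dots,r_\beta\}\}$. For velocities $\boldsymbol\xi,\boldsymbol\xi_*,\boldsymbol\xi',\boldsymbol\xi_*'\in\mathbb R^3$ put $\mathbf g=\boldsymbol\xi-\boldsymbol\xi_*$, $\mathbf g'=\boldsymbol\xi'-\boldsymbol\xi_*'$, $\cos\theta=\mathbf g\cdot\mathbf g'/(|\mathbf g||\mathbf g'|)$, $\Delta I^{\alpha\beta}_{kl,ij}=I_k^\alpha+I_l^\beta-I_i^\alpha-I_j^\beta$ and $\widetilde\Delta I^{\alpha\beta}_{kl,ij}=\frac{m_\alpha+m_\beta}{m_\alpha m_\beta}\Delta I^{\alpha\beta}_{kl,ij}$. Scattering cross sections are measurable functions $\widetilde\sigma_{\alpha\beta}:\mathbb R_+\times[-1,1]\times\{1,..,r_\alpha\}^2\times\{1,..,r_\beta\}^2\to\mathbb R_+$, written $\sigma^{\alpha\beta}_{ij,kl}=\sigma^{\alpha\beta}_{ij,kl}(|\mathbf g|,\cos\theta)=\widetilde\sigma_{\alpha\beta}(|\mathbf g|,\cos\theta,i,j,k,l)$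 and $\sigma^{\alpha\beta}_{kl,ij}=\widetilde\sigma_{\alpha\beta}(|\mathbf g'|,\cos\theta,k,l,i,j)$, positive a.e., satisfying (for pairs obeying the conservation laws below) the microreversibility $\varphi_i^\alpha\varphi_j^\beta|\mathbf g|^2\sigma^{\alpha\beta}_{ij,kl}(|\mathbf g|,\cos\theta)=\varphi_k^\alpha\varphi_l^\beta|\mathbf g'|^2\sigma^{\alpha\beta}_{kl,ij}(|\mathbf g'|,\cos\theta)$, and the symmetries $\sigma^{\alpha\beta}_{kl,ij}=\sigma^{\beta\alpha}_{lk,ji}$, $\sigma^{\alpha\alpha}_{ij,kl}(|\mathbf g|,-\cos\theta)=\sigma^{\alpha\alpha}_{ij,kl}(|\mathbf g|,\cos\theta)$, $\sigma^{\alpha\alpha}_{ij,kl}=\sigma^{\alpha\alpha}_{ji,kl}=\sigma^{\alpha\alpha}_{ji,lk}$. The transition probabilities (distributions in the velocities) are $$W_{\alpha\beta}(\boldsymbol\xi,\boldsymbol\xi_*,I_i^\alpha,I_j^\beta|\boldsymbol\xi',\boldsymbol\xi_*',I_k^\alpha,I_l^\beta)=(m_\alpha+m_\beta)^2m_\alpha m_\beta\,\varphi_k^\alpha\varphi_l^\beta\,\sigma^{\alpha\beta}_{kl,ij}\frac{|\mathbf g'|}{|\mathbf g|}\,\delta_3(m_\alpha\boldsymbol\xi+m_\beta\boldsymbol\xi_*-m_\alpha\boldsymbol\xi'-m_\beta\boldsymbol\xi_*')\,\delta_1\!\Big(\tfrac12(m_\alpha|\boldsymbol\xi|^2+m_\beta|\boldsymbol\xi_*|^2-m_\alpha|\boldsymbol\xi'|^2-m_\beta|\boldsymbol\xi_*'|^2)-\Delta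 I^{\alpha\beta}_{kl,ij}\Big),$$ with $\delta_3,\delta_1$ the Dirac delta on $\mathbb R^3$, $\mathbb R$. Maxwellian: for fixed $n_\alpha>0$, $M_{\alpha,i}(\boldsymbol\xi)=\frac{n_\alpha\varphi_i^\alpha m_\alpha^{3/2}}{(2\pi)^{3/2}q_\alpha}e^{-m_\alpha|\boldsymbol\xi|^2/2-I_i^\alpha}$ with $q_\alpha=\sum_{i=1}^{r_\alpha}\varphi_i^\alpha e^{-I_i^\alpha}$; abbreviations $M_{\beta,j*}=M_{\beta,j}(\boldsymbol\xi_* )$, $M'_{\alpha,k}=M_{\alpha,k}(\boldsymbol\xi')$, $M'_{\beta,l*}=M_{\beta,l}(\boldsymbol\xi_*')$, and likewise $h_{\beta,j*}=h_{\beta,j}(\boldsymbol\xi_* )$, $h'_{\alpha,k}=h_{\alpha,k}(\boldsymbol\xi')$, $h'_{\beta,l*}=h_{\beta,l}(\boldsymbol\xi_*')$. The operator $K$ has components $$K_{\alpha,i}(h)(\boldsymbol\xi)=\sum_{\beta=1}^s\sum_{k=1}^{r_\alpha}\sum_{j,l=1}^{r_\beta}\int_{(\mathbb R^3)^3}\Big(\frac{h'_{\alpha,k}}{(M'_{\alpha,k})^{1/2}}+\frac{h'_{\beta,l*}}{(M'_{\beta,l*})^{1/2}}-\frac{h_{\beta,j*}}{M_{\beta,j*}^{1/2}}\Big)\Big(\frac{M_{\beta,j*}M'_{\alpha,k}M'_{\beta,l*}}{\varphi_i^\alpha\varphi_j^\beta\varphi_k^\alpha\varphi_l^\beta}\Big)^{1/2}W_{\alpha\beta}(\boldsymbol\xi,\boldsymbol\xi_*,I_i^\alpha,I_j^\beta|\boldsymbol\xi',\boldsymbol\xi_*',I_k^\alpha,I_l^\beta)\,d\boldsymbol\xi_*d\boldsymbol\xi'd\boldsymbol\xi_*',$$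 acting on $h=(h_{\alpha,i})\in(L^2(d\boldsymbol\xi))^r$ (components indexed by $\alpha\in\{1,..,s\}$, $i\in\{1,..,r_\alpha\}$), with inner product $(F,G)=\sum_\alpha\sum_{i=1}^{r_\alpha}\int_{\mathbb R^3}F_{\alpha,i}G_{\alpha,i}\,d\boldsymbol\xi$. *)

theory Defs
  imports "HOL-Analysis.Analysis"
begin

type_synonym vel = "real^3"

text \<open>Species alpha range over {..<s}, internal energy levels i over {..<r alpha}.
  A family h = (h_{alpha,i}) is a function  nat => nat => vel => real.
  The cross section sig alpha beta x c i j k l stands for
  tilde-sigma_{alpha beta}(x, c, i, j, k, l).\<close>

definition DeltaI :: "(nat \<Rightarrow> nat \<Rightarrow> real) \<Rightarrow> nat \<Rightarrow> nat \<Rightarrow> nat \<Rightarrow> nat \<Rightarrow> nat \<Rightarrow> nat \<Rightarrow> real"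
  where "DeltaI I \<alpha> \<beta> k l i j = I \<alpha> k + I \<beta> l - I \<alpha> i - I \<beta> j"

definition DeltaIt :: "(nat \<Rightarrow> real) \<Rightarrow> (nat \<Rightarrow> nat \<Rightarrow> real) \<Rightarrow> nat \<Rightarrow> nat \<Rightarrow> nat \<Rightarrow> nat \<Rightarrow> nat \<Rightarrow> nat \<Rightarrow> real"
  where "DeltaIt m I \<alpha> \<beta> k l i j = (m \<alpha> + m \<beta>) / (m \<alpha> * m \<beta>) * DeltaI I \<alpha> \<beta> k l i j"

definition qpart :: "(nat \<Rightarrow> nat) \<Rightarrow> (nat \<Rightarrow> nat \<Rightarrow> real) \<Rightarrow> (nat \<Rightarrow> nat \<Rightarrow> real) \<Rightarrow> nat \<Rightarrow> real"
  where "qpart r I \<phi> \<alpha> = (\<Sum>i<r \<alpha>. \<phi> \<alpha> i * exp (- I \<alpha> i))"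

definition Maxw :: "(nat \<Rightarrow> nat) \<Rightarrow> (nat \<Rightarrow> real) \<Rightarrow> (nat \<Rightarrow> nat \<Rightarrow> real) \<Rightarrow> (nat \<Rightarrow> nat \<Rightarrow> real)
    \<Rightarrow> (nat \<Rightarrow> real) \<Rightarrow> nat \<Rightarrow> nat \<Rightarrow> vel \<Rightarrow> real"
  where "Maxw r m I \<phi> n \<alpha> i \<xi> =
    n \<alpha> * \<phi> \<alpha> i * m \<alpha> powr (3/2) / ((2 * pi) powr (3/2) * qpart r I \<phi> \<alpha>)
      * exp (- m \<alpha> * (norm \<xi>)\<^sup>2 / 2 - I \<alpha> i)"

text \<open>Integral over the unit sphere S^2 with respect to surface measure d omega,
  written via the identity  int_{S^2} f d omega = 3 * int_{|x| <= 1} f(x/|x|) dx.\<close>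
definition sphere_int :: "(vel \<Rightarrow> real) \<Rightarrow> real"
  where "sphere_int f = 3 * (LINT x : ball 0 1 | lborel. f ((1 / norm x) *\<^sub>R x))"

text \<open>Integrand of K_{alpha,i}(h)(xi) after the Dirac deltas in W_{alpha beta} have been
  integrated out: integrating F(xi',xi'_* ) W d xi' d xi'_* over (R^3)^2 equals
  phi_k phi_l * int_{S^2} F(xi',xi'_* ) sigma_{kl,ij}(|g'|,cos theta) |g'|^2/|g| d omega,
  where |g'| = sqrt(|g|^2 - 2 DeltaIt_{kl,ij}) (zero if |g|^2 <= 2 DeltaIt_{kl,ij}),
  xi' = G + m_beta/(m_alpha+m_beta) g', xi'_* = G - m_alpha/(m_alpha+m_beta) g',
  G the centre-of-mass velocity, g' = |g'| omega.\<close>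
definition K_integrand ::
  "(nat \<Rightarrow> nat) \<Rightarrow> (nat \<Rightarrow> real) \<Rightarrow> (nat \<Rightarrow> nat \<Rightarrow> real) \<Rightarrow> (nat \<Rightarrow> nat \<Rightarrow> real) \<Rightarrow> (nat \<Rightarrow> real)
   \<Rightarrow> (nat \<Rightarrow> nat \<Rightarrow> real \<Rightarrow> real \<Rightarrow> nat \<Rightarrow> nat \<Rightarrow> nat \<Rightarrow> nat \<Rightarrow> real)
   \<Rightarrow> (nat \<Rightarrow> nat \<Rightarrow> vel \<Rightarrow> real)
   \<Rightarrow> nat \<Rightarrow> nat \<Rightarrow> nat \<Rightarrow> nat \<Rightarrow> nat \<Rightarrow> nat \<Rightarrow> vel \<Rightarrow> vel \<Rightarrow> vel \<Rightarrow> real"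
  where "K_integrand r m I \<phi> n sig h \<alpha> \<beta> i j k l \<xi> \<xi>s \<omega> =
    (let M = Maxw r m I \<phi> n;
         g = \<xi> - \<xi>s;
         gn = norm g;
         D = DeltaIt m I \<alpha> \<beta> k l i j
     in if gn\<^sup>2 > 2 * D then
       (let R = sqrt (gn\<^sup>2 - 2 * D);
            G = (1 / (m \<alpha> + m \<beta>)) *\<^sub>R (m \<alpha> *\<^sub>R \<xi> + m \<beta> *\<^sub>R \<xi>s);
            \<xi>' = G + (m \<beta> / (m \<alpha> + m \<beta>) * R) *\<^sub>R \<omega>;
            \<xi>s' = G - (m \<alpha> / (m \<alpha> + m \<beta>) * R) *\<^sub>R \<omega>;
            c = (g \<bullet> \<omega>) / gn
        in (h \<alpha> k \<xi>' / sqrt (M \<alpha> k \<xi>') + h \<beta> l \<xi>s' / sqrt (M \<beta> l \<xi>s')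
              - h \<beta> j \<xi>s / sqrt (M \<beta> j \<xi>s))
           * sqrt (M \<beta> j \<xi>s * M \<alpha> k \<xi>' * M \<beta> l \<xi>s'
                   / (\<phi> \<alpha> i * \<phi> \<beta> j * \<phi> \<alpha> k * \<phi> \<beta> l))
           * (\<phi> \<alpha> k * \<phi> \<beta> l * sig \<alpha> \<beta> R c k l i j * R\<^sup>2 / gn))
     else 0)"

definition Kop ::
  "nat \<Rightarrow> (nat \<Rightarrow> nat) \<Rightarrow> (nat \<Rightarrow> real) \<Rightarrow> (nat \<Rightarrow> nat \<Rightarrow> real) \<Rightarrow> (nat \<Rightarrow> nat \<Rightarrow> real) \<Rightarrow> (nat \<Rightarrow> real)
   \<Rightarrow> (nat \<Rightarrow> nat \<Rightarrow> real \<Rightarrow> real \<Rightarrow> nat \<Rightarrow> nat \<Rightarrow> nat \<Rightarrow> nat \<Rightarrow> real)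
   \<Rightarrow> (nat \<Rightarrow> nat \<Rightarrow> vel \<Rightarrow> real) \<Rightarrow> nat \<Rightarrow> nat \<Rightarrow> vel \<Rightarrow> real"
  where "Kop s r m I \<phi> n sig h \<alpha> i \<xi> =
    (\<Sum>\<beta><s. \<Sum>k<r \<alpha>. \<Sum>j<r \<beta>. \<Sum>l<r \<beta>.
       LINT \<xi>s | lborel. sphere_int (K_integrand r m I \<phi> n sig h \<alpha> \<beta> i j k l \<xi> \<xi>s))"

definition inL2 :: "nat \<Rightarrow> (nat \<Rightarrow> nat) \<Rightarrow> (nat \<Rightarrow> nat \<Rightarrow> vel \<Rightarrow> real) \<Rightarrow> bool"
  where "inL2 s r h \<longleftrightarrow> (\<forall>\<alpha><s. \<forall>i<r \<alpha>.
     h \<alpha> i \<in> borel_measurable lborel \<and> integrable lborel (\<lambda>\<xi>. (h \<alpha> i \<xi>)\<^sup>2))"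

definition L2inner :: "nat \<Rightarrow> (nat \<Rightarrow> nat) \<Rightarrow> (nat \<Rightarrow> nat \<Rightarrow> vel \<Rightarrow> real) \<Rightarrow> (nat \<Rightarrow> nat \<Rightarrow> vel \<Rightarrow> real) \<Rightarrow> real"
  where "L2inner s r F G = (\<Sum>\<alpha><s. \<Sum>i<r \<alpha>. LINT \<xi> | lborel. F \<alpha> i \<xi> * G \<alpha> i \<xi>)"

definition L2norm :: "nat \<Rightarrow> (nat \<Rightarrow> nat) \<Rightarrow> (nat \<Rightarrow> nat \<Rightarrow> vel \<Rightarrow> real) \<Rightarrow> real"
  where "L2norm s r F = sqrt (L2inner s r F F)"

definition L2eq :: "nat \<Rightarrow> (nat \<Rightarrow> nat) \<Rightarrow> (nat \<Rightarrow> nat \<Rightarrow> vel \<Rightarrow> real) \<Rightarrow> (nat \<Rightarrow> nat \<Rightarrow> vel \<Rightarrow> real) \<Rightarrow> bool"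
  where "L2eq s r F G \<longleftrightarrow> (\<forall>\<alpha><s. \<forall>i<r \<alpha>. AE \<xi> in lborel. F \<alpha> i \<xi> = G \<alpha> i \<xi>)"

definition selfadjoint_compact_L2 :: "nat \<Rightarrow> (nat \<Rightarrow> nat)
    \<Rightarrow> ((nat \<Rightarrow> nat \<Rightarrow> vel \<Rightarrow> real) \<Rightarrow> (nat \<Rightarrow> nat \<Rightarrow> vel \<Rightarrow> real)) \<Rightarrow> bool"
  where "selfadjoint_compact_L2 s r T \<longleftrightarrow>
    (\<forall>h. inL2 s r h \<longrightarrow> inL2 s r (T h))
    \<and> (\<forall>h h'. inL2 s r h \<longrightarrow> inL2 s r h' \<longrightarrow> L2eq s r h h' \<longrightarrow> L2eq s r (T h) (T h'))
    \<and> (\<forall>h g. inL2 s r h \<longrightarrow> inL2 s r g \<longrightarrow> L2inner s r (T h) g = L2inner s r h (T g))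
    \<and> (\<forall>(u :: nat \<Rightarrow> nat \<Rightarrow> nat \<Rightarrow> vel \<Rightarrow> real) (B::real). (\<forall>p. inL2 s r (u p) \<and> L2norm s r (u p) \<le> B) \<longrightarrow>
         (\<exists>sub v. strict_mono sub \<and> inL2 s r v \<and>
            (\<lambda>p. L2norm s r (\<lambda>\<alpha> i \<xi>. T (u (sub p)) \<alpha> i \<xi> - v \<alpha> i \<xi>)) \<longlonglongrightarrow> 0))"

end

theory Submission
  imports Defs "HOL-Library.Diagonal_Subsequence"
begin

text \<open>With \<open>t = |g|\<^sup>2\<close> as radial variable, polar coordinates turn the energy balance of a collision into a
  translation of \<open>t\<close>; hence reversing a collision, and exchanging its two partners, transform the
  collision measure explicitly. This gives self-adjointness by reindexing, and it makes the column
  bounds of the kernels of \<open>K\<close> row bounds of other kernels of the same type, so that each of the three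
  terms of \<open>K\<close> is bounded on \<open>L\<^sup>2\<close> by Schur's test.

  For compactness the kernels are not computed. Up to an operator of small Schur norm, the term with
  \<open>h\<close> evaluated at \<open>x - c (g + \<kappa> R(g) \<omega>)\<close> may be cut off to bounded \<open>x\<close>, to \<open>|g|\<close> bounded above and away from
  \<open>0\<close>, and to Jacobian \<open>J = 1 + \<kappa> \<omega>\<cdot>g/R\<close> away from \<open>0\<close>. There, for fixed \<open>\<omega>\<close>, the change of variables
  \<open>g \<mapsto> g + \<kappa> R(g) \<omega>\<close> (at most two-to-one) bounds the value at each point \<open>x\<close> by the \<open>L\<^sup>2\<close> norm of \<open>h\<close>, so the
  cut-off operator maps weakly convergent sequences to pointwise convergent dominated ones.\<close>

subsection \<open>Polar coordinates\<close>

text \<open>The difficulty is the growth of the collision kernel, of order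
  \<open>(1 + |g|)^2 / |g|\<close> under the assumed bound: a Gaussian in the second velocity alone
  cannot make its integral bounded uniformly in \<open>x\<close>. The missing decay comes from the
  other Gaussian in each weight. For the terms with \<open>h'\<close> and \<open>h'_*\<close> it is
  evaluated on the sphere of possible outcomes, and the average of a Gaussian over a sphere of
  radius \<rho> is at most of order \<open>\<rho>^-2\<close>, uniformly in its centre. For the term
  with \<open>h_*\<close> both Gaussians are in outgoing velocities, and conservation of energy
  turns them into Gaussians in \<open>x\<close> and \<open>y\<close>. In all cases
  \<open>(1 + |g|)^2\<close> is cancelled, and what remains is a Gaussian in \<open>y\<close> times
  the Newton kernel \<open>1 / |x - y|\<close>, whose integral is bounded uniformly in
  \<open>x\<close>, with small contributions from short and from long distances. A bound by the
  square norm of \<open>h\<close> is possible at a single \<open>x\<close> because, for fixed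
  \<omega>, the argument of \<open>h\<close> still moves through three dimensions with
  \<open>g\<close>; the integration over \<omega> is a mere average. The map degenerates where its
  Jacobian vanishes, and those pairs \<open>(g, \<omega>)\<close> form a null set.\<close>

lemma nn_integral_affine:
  fixes f :: "'a::euclidean_space \<Rightarrow> ennreal"
  assumes [measurable]: "f \<in> borel_measurable borel" and c: "c \<noteq> 0"
  shows "(\<integral>\<^sup>+x. f x \<partial>lborel) = ennreal (\<bar>c\<bar> ^ DIM('a)) * (\<integral>\<^sup>+x. f (t + c *\<^sub>R x) \<partial>lborel)"
  by (subst lborel_affine[OF c, of t])
     (simp add: nn_integral_density nn_integral_distr nn_integral_cmult)

lemma nn_integral_translate:
  fixes f :: "'a::euclidean_space \<Rightarrow> ennreal"
  assumes [measurable]: "f \<in> borel_measurable borel"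
  shows "(\<integral>\<^sup>+x. f (t + x) \<partial>lborel) = (\<integral>\<^sup>+x. f x \<partial>lborel)"
  using nn_integral_affine[of f 1 t] by simp

lemma nn_integral_reflect:
  fixes f :: "'a::euclidean_space \<Rightarrow> ennreal"
  assumes [measurable]: "f \<in> borel_measurable borel"
  shows "(\<integral>\<^sup>+x. f (t - x) \<partial>lborel) = (\<integral>\<^sup>+x. f x \<partial>lborel)"
  using nn_integral_affine[of f "-1" t] by simp

lemma measurable_sgn_vec [measurable]:
  "(sgn :: 'a::euclidean_space \<Rightarrow> 'a) \<in> borel_measurable borel"
proof -
  have "(sgn :: 'a \<Rightarrow> 'a) = (\<lambda>x. inverse (norm x) *\<^sub>R x)"
    by (simp add: fun_eq_iff sgn_div_norm)
  then show ?thesis by simp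
qed

lemma ball_borel [measurable]: "ball a e \<in> sets (borel :: 'a::metric_space measure)"
  by simp

text \<open>Surface measure of the unit sphere, of total mass \<open>4 * pi\<close>, as a cone
  measure: the ball carries \<open>r^2 dr\<close> along each ray, and the factor 3 normalises its
  integral over \<open>[0, 1]\<close>. As a measure on all of \<open>vel\<close> it fits Fubini's
  theorem; that it lives on unit vectors is only an almost-everywhere statement,
  \<open>AE_usph\<close>.\<close>

definition usph :: "vel measure" where
  "usph = distr (density lborel (\<lambda>x. ennreal (3 * indicator (ball 0 1) x))) borel sgn"

lemma sets_usph [simp, measurable_cong]: "sets usph = sets borel"
  and space_usph [simp]: "space usph = UNIV"
  by (simp_all add: usph_def)

lemma nn_integral_usph:
  assumes [measurable]: "f \<in> borel_measurable borel"
  shows "(\<integral>\<^sup>+\<omega>. f \<omega> \<partial>usph) = (\<integral>\<^sup>+x. ennreal (3 * indicator (ball 0 1) x) * f (sgn x) \<partial>lborel)"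
  by (simp add: usph_def nn_integral_distr nn_integral_density)

lemma emeasure_usph:
  assumes [measurable]: "B \<in> sets borel"
  shows "emeasure usph B = 3 * emeasure lborel (ball 0 1 \<inter> sgn -` B)"
proof -
  have [measurable]: "sgn -` B \<in> sets (borel :: vel measure)"
    using measurable_sets[OF measurable_sgn_vec assms] by simp
  have "emeasure usph B = (\<integral>\<^sup>+x. indicator B x \<partial>usph)" by simp
  also have "\<dots> = (\<integral>\<^sup>+x. 3 * indicator (ball 0 1 \<inter> sgn -` B) x \<partial>lborel)"
    by (subst nn_integral_usph) (auto intro!: nn_integral_cong simp: indicator_def)
  also have "\<dots> = 3 * emeasure lborel (ball 0 1 \<inter> sgn -` B)"
    by (subst nn_integral_cmult_indicator) auto
  finally show ?thesis .
qed

interpretation usph: finite_measure usph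
proof
  show "emeasure usph (space usph) \<noteq> \<infinity>"
    using emeasure_lborel_ball_finite[of "0::vel" 1] by (simp add: emeasure_usph ennreal_mult_eq_top_iff)
qed

lemma AE_usph: "AE \<omega> in usph. norm \<omega> = 1"
proof -
  have "AE x in lborel. (x::vel) \<noteq> 0"
    by (rule AE_lborel_singleton)
  then have "AE x in (density lborel (\<lambda>x. ennreal (3 * indicator (ball 0 1) x))). norm (sgn x :: vel) = 1"
    by (subst AE_density) (auto simp: norm_sgn)
  then show ?thesis
    unfolding usph_def by (subst AE_distr_iff) auto
qed

lemma sphere_int_eq:
  assumes [measurable]: "f \<in> borel_measurable borel"
  shows "sphere_int f = (\<integral>\<omega>. f \<omega> \<partial>usph)"
proof -
  have "sphere_int f = 3 * (\<integral>x. indicator (ball 0 1) x *\<^sub>R f (sgn x) \<partial>lborel)"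
    by (simp add: sphere_int_def set_lebesgue_integral_def sgn_div_norm divide_inverse)
  also have "\<dots> = (\<integral>x. (3 * indicator (ball 0 1) x) *\<^sub>R f (sgn x) \<partial>lborel)"
    by (simp flip: integral_mult_right_zero add: mult.assoc)
  also have "\<dots> = (\<integral>\<omega>. f \<omega> \<partial>usph)"
    unfolding usph_def
    by (subst integral_distr, simp, simp, subst integral_density) auto
  finally show ?thesis .
qed

lemma nn_integral_usph_uminus:
  assumes [measurable]: "f \<in> borel_measurable borel"
  shows "(\<integral>\<^sup>+\<omega>. f (- \<omega>) \<partial>usph) = (\<integral>\<^sup>+\<omega>. f \<omega> \<partial>usph)"
proof -
  have "(\<integral>\<^sup>+\<omega>. f \<omega> \<partial>usph) = (\<integral>\<^sup>+x. ennreal (3 * indicator (ball 0 1) x) * f (sgn x) \<partial>lborel)"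
    by (simp add: nn_integral_usph)
  also have "\<dots> = (\<integral>\<^sup>+x. ennreal (3 * indicator (ball 0 1) (0 - x :: vel)) * f (sgn (0 - x)) \<partial>lborel)"
    by (rule nn_integral_reflect[symmetric]) measurable
  also have "\<dots> = (\<integral>\<^sup>+\<omega>. f (- \<omega>) \<partial>usph)"
    by (subst nn_integral_usph) (auto intro!: nn_integral_cong simp: indicator_def sgn_minus)
  finally show ?thesis by simp
qed

text \<open>The law of the squared radius: in the variable \<open>t = |x|\<^sup>2\<close> the volume element of space is
  \<open>\<surd>t/2 dt d\<omega>\<close>, so that the energy balance \<open>|g'|\<^sup>2 = |g|\<^sup>2 - 2\<Delta>\<close> becomes a translation.\<close>

definition radm :: "real measure" where
  "radm = density lborel (\<lambda>t. ennreal (sqrt t / 2) * indicator {0<..} t)"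

lemma sets_radm [simp, measurable_cong]: "sets radm = sets borel"
  and space_radm [simp]: "space radm = UNIV"
  by (simp_all add: radm_def)

lemma nn_integral_radm:
  assumes [measurable]: "f \<in> borel_measurable borel"
  shows "(\<integral>\<^sup>+t. f t \<partial>radm) = (\<integral>\<^sup>+t. ennreal (sqrt t / 2) * indicator {0<..} t * f t \<partial>lborel)"
  by (simp add: radm_def nn_integral_density)

lemma emeasure_radm_lessThan: 
  assumes "0 \<le> a"
  shows "emeasure radm {..<a} = ennreal (sqrt a ^ 3 / 3)"
proof -
  have D: "((\<lambda>t. sqrt t ^ 3 / 3) has_vector_derivative (sqrt t / 2)) (at t)" if "t \<in> {0<..<a}" for t
  proof -
    have t: "t > 0" using that by simp
    have "((\<lambda>t. sqrt t ^ 3 / 3) has_real_derivative (3 * (sqrt t)^2 * (inverse (sqrt t) / 2) / 3)) (at t)"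
      using t by (auto intro!: derivative_eq_intros)
    also have "3 * (sqrt t)^2 * (inverse (sqrt t) / 2) / 3 = sqrt t / 2"
      using t by (simp add: field_simps)
    finally show ?thesis by (simp add: has_real_derivative_iff_has_vector_derivative)
  qed
  have "((\<lambda>t. sqrt t / 2) has_integral (sqrt a ^ 3 / 3 - sqrt 0 ^ 3 / 3)) {0..a}"
    by (rule fundamental_theorem_of_calculus_interior[OF assms])
       (auto intro!: continuous_intros D)
  then have "integral\<^sup>N lborel (\<lambda>x. ennreal (sqrt x / 2) * indicator {0..a} x) = ennreal (sqrt a ^ 3 / 3)"
    by (intro nn_integral_has_integral_lebesgue') auto
  also have "integral\<^sup>N lborel (\<lambda>x. ennreal (sqrt x / 2) * indicator {0..a} x)
     = (\<integral>\<^sup>+t. ennreal (sqrt t / 2) * indicator {0<..} t * indicator {..<a} t \<partial>lborel)"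
    by (rule nn_integral_cong_AE, rule AE_mp[OF AE_lborel_singleton[of 0]],
        rule AE_mp[OF AE_lborel_singleton[of a]]) (auto simp: indicator_def)
  also have "\<dots> = emeasure radm {..<a}"
    by (subst nn_integral_radm[symmetric]) auto
  finally show ?thesis by simp
qed

interpretation radm: sigma_finite_measure radm
proof
  show "\<exists>A. countable A \<and> A \<subseteq> sets radm \<and> \<Union> A = space radm \<and> (\<forall>a\<in>A. emeasure radm a \<noteq> \<infinity>)"
  proof (intro exI[of _ "range (\<lambda>n::nat. {..<real n})"] conjI)
    show "\<Union> (range (\<lambda>n::nat. {..<real n})) = space radm"
      using reals_Archimedean2 by auto
  qed (auto simp: emeasure_radm_lessThan)
qed

lemma lessThan_Int: "{..<a} \<inter> {..<b} = {..<min a (b::real)}"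
  by auto

text \<open>Product measures are determined on rectangles. With the set \<open>B\<close> of
  directions fixed, both sides are measures in the squared radius, and it suffices to compare them
  on half-lines \<open>{..<a}\<close>, which generate the Borel sets. There, scaling the ball of
  radius \<open>sqrt a\<close> to the unit ball leaves the cone over \<open>B\<close> unchanged and
  produces \<open>a^(3/2)\<close>, which is what \<open>radm\<close> gives up to the factor 3 built
  into \<open>usph\<close>.\<close>

lemma polar_measure:
  "radm \<Otimes>\<^sub>M usph = distr lborel (borel \<Otimes>\<^sub>M borel) (\<lambda>x. ((norm x)\<^sup>2, sgn x))"
proof (rule pair_measure_eqI)
  show "sigma_finite_measure radm" "sigma_finite_measure usph" by unfold_locales
  show "sets (radm \<Otimes>\<^sub>M usph) = sets (distr lborel (borel \<Otimes>\<^sub>M borel) (\<lambda>x::vel. ((norm x)\<^sup>2, sgn x)))"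
    by (simp cong: sets_pair_measure_cong)
  fix A B assume A': "A \<in> sets radm" and B': "B \<in> sets usph"
  have A[measurable]: "A \<in> sets borel" and B[measurable]: "B \<in> sets borel" using A' B' by auto
  have sB[measurable]: "sgn -` B \<in> sets (borel :: vel measure)"
    using measurable_sets[OF measurable_sgn_vec B] by simp
  define L where "L = density radm (\<lambda>_. emeasure usph B)"
  define N where "N = distr (density lborel (indicator (sgn -` B :: vel set))) borel (\<lambda>x. (norm x)\<^sup>2)"
  have N: "emeasure N X = emeasure lborel {x. (norm x)\<^sup>2 \<in> X \<and> sgn x \<in> B}" if [measurable]: "X \<in> sets borel" for X
  proof -
    have [measurable]: "(\<lambda>x::vel. (norm x)\<^sup>2) -` X \<in> sets borel"
      using measurable_sets[of "\<lambda>x::vel. (norm x)\<^sup>2" borel borel X] that by simp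
    have "emeasure N X = emeasure lborel (sgn -` B \<inter> (\<lambda>x. (norm x)\<^sup>2) -` X)"
      unfolding N_def
      by (subst emeasure_distr, measurable, subst emeasure_density)
        (auto simp: indicator_inter_arith[symmetric])
    also have "sgn -` B \<inter> (\<lambda>x. (norm x)\<^sup>2) -` X = {x. (norm x)\<^sup>2 \<in> X \<and> sgn x \<in> B}" by auto
    finally show ?thesis .
  qed
  have L: "emeasure L X = emeasure usph B * emeasure radm X" if [measurable]: "X \<in> sets borel" for X
    unfolding L_def by (simp add: emeasure_density nn_integral_cmult)
  have eq: "emeasure L {..<a} = emeasure N {..<a}" for a
  proof (cases "a > 0")
    case False
    then have "{x::vel. (norm x)\<^sup>2 < a \<and> sgn x \<in> B} = {}"
      by (auto simp: not_less intro: order_trans[OF _ zero_le_power2])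
    then have "emeasure N {..<a} = 0"
      using N[OF lessThan_borel, of a] by (simp only: lessThan_iff emeasure_empty)
    moreover have "emeasure radm {..<a} = 0"
    proof -
      have "emeasure radm {..<a} \<le> emeasure radm {..<0}" using False by (intro emeasure_mono) auto
      then show ?thesis by (simp add: emeasure_radm_lessThan)
    qed
    ultimately show ?thesis using L[of "{..<a}"] by simp
  next
    case True
    define s where "s = sqrt a"
    have s: "s > 0" "a = s\<^sup>2" using True by (auto simp: s_def)
    have "{x::vel. (norm x)\<^sup>2 < a \<and> sgn x \<in> B} \<in> sets borel" by measurable
    then have "emeasure lborel {x::vel. (norm x)\<^sup>2 < a \<and> sgn x \<in> B}
      = (\<integral>\<^sup>+x. indicator {x::vel. (norm x)\<^sup>2 < a \<and> sgn x \<in> B} x \<partial>lborel)"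
      by simp
    also have "\<dots> = ennreal (\<bar>s\<bar> ^ DIM(vel)) * 
        (\<integral>\<^sup>+x. indicator {x::vel. (norm x)\<^sup>2 < a \<and> sgn x \<in> B} (0 + s *\<^sub>R x) \<partial>lborel)"
      using s by (intro nn_integral_affine) auto
    also have "(\<lambda>x. indicator {x::vel. (norm x)\<^sup>2 < a \<and> sgn x \<in> B} (0 + s *\<^sub>R x) :: ennreal)
       = indicator (ball 0 1 \<inter> sgn -` B)"
    proof -
      have "(s * norm x)\<^sup>2 < s\<^sup>2 \<longleftrightarrow> norm x < 1" for x :: vel
        using s by (simp add: power_mult_distrib power_less_one_iff abs_square_less_1)
      then show ?thesis
        using s by (auto simp: fun_eq_iff indicator_def sgn_scaleR)
    qed
    also have "(\<integral>\<^sup>+x. indicator (ball 0 1 \<inter> sgn -` B) x \<partial>lborel) = emeasure lborel (ball 0 1 \<inter> (sgn -` B :: vel set))"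
      by (subst nn_integral_indicator) auto
    finally have "emeasure N {..<a} = ennreal (s^3) * emeasure lborel (ball 0 1 \<inter> (sgn -` B :: vel set))"
      using s by (simp add: N)
    moreover have "emeasure L {..<a} = ennreal (s^3/3) * 3 * emeasure lborel (ball 0 1 \<inter> (sgn -` B :: vel set))"
      using True by (simp add: L emeasure_radm_lessThan emeasure_usph mult_ac flip: s_def)
    moreover have "ennreal (s^3/3) * 3 = ennreal (s^3)"
      using s by (subst ennreal_numeral[symmetric], subst ennreal_mult[symmetric]) auto
    ultimately show ?thesis by simp
  qed
  have "L = N"
  proof (rule measure_eqI_generator_eq[where E="range lessThan" and \<Omega>=UNIV and A="\<lambda>n::nat. {..<real n}"])
    show "Int_stable (range (lessThan :: real \<Rightarrow> _))"
      by (auto simp: Int_stable_def lessThan_Int)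
    show "sets L = sigma_sets UNIV (range lessThan)" "sets N = sigma_sets UNIV (range lessThan)"
      by (simp_all add: L_def N_def borel_Iio)
    show "(\<Union>i::nat. {..<real i}) = UNIV" using reals_Archimedean2 by auto
    show "emeasure L {..<real i} \<noteq> \<infinity>" for i
      by (simp add: L emeasure_radm_lessThan ennreal_mult_eq_top_iff)
  qed (auto simp: eq)
  have "emeasure radm A * emeasure usph B = emeasure N A"
    unfolding \<open>L = N\<close>[symmetric] by (simp add: L mult.commute)
  also have "\<dots> = emeasure (distr lborel (borel \<Otimes>\<^sub>M borel) (\<lambda>x. ((norm x)\<^sup>2, sgn x))) (A \<times> B)"
    by (subst emeasure_distr) (auto simp: N intro!: arg_cong[where f="emeasure lborel"])
  finally show "emeasure radm A * emeasure usph B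
    = emeasure (distr lborel (borel \<Otimes>\<^sub>M borel) (\<lambda>x. ((norm x)\<^sup>2, sgn x))) (A \<times> B)" .
qed

lemma nn_integral_polar:
  assumes [measurable]: "case_prod f \<in> borel_measurable (borel \<Otimes>\<^sub>M borel)"
  shows "(\<integral>\<^sup>+x. f ((norm x)\<^sup>2) (sgn x) \<partial>lborel) = (\<integral>\<^sup>+t. \<integral>\<^sup>+\<omega>. f t \<omega> \<partial>usph \<partial>radm)"
proof -
  have [measurable]: "case_prod f \<in> borel_measurable (radm \<Otimes>\<^sub>M usph)"
    using assms by simp
  have "(\<integral>\<^sup>+t. \<integral>\<^sup>+\<omega>. f t \<omega> \<partial>usph \<partial>radm) = (\<integral>\<^sup>+p. case_prod f p \<partial>(radm \<Otimes>\<^sub>M usph))"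
    by (subst usph.nn_integral_fst[symmetric]) auto
  also have "\<dots> = (\<integral>\<^sup>+x. f ((norm x)\<^sup>2) (sgn x) \<partial>lborel)"
    unfolding polar_measure by (subst nn_integral_distr) auto
  finally show ?thesis by simp
qed

lemma nn_integral_polar_scaleR:
  fixes f :: "vel \<Rightarrow> ennreal"
  assumes [measurable]: "f \<in> borel_measurable borel"
  shows "(\<integral>\<^sup>+x. f x \<partial>lborel) = (\<integral>\<^sup>+t. \<integral>\<^sup>+\<omega>. f (sqrt t *\<^sub>R \<omega>) \<partial>usph \<partial>radm)"
proof -
  have "norm x *\<^sub>R sgn x = x" for x :: vel by (cases "x = 0") (auto simp: sgn_div_norm)
  then show ?thesis
    using nn_integral_polar[of "\<lambda>t \<omega>. f (sqrt t *\<^sub>R \<omega>)"] by simp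
qed

section \<open>Square-integrable functions: arithmetic and the Cauchy-Schwarz inequality\<close>

definition sqint :: "'a measure \<Rightarrow> ('a \<Rightarrow> real) \<Rightarrow> bool" where
  "sqint M f \<longleftrightarrow> f \<in> borel_measurable M \<and> integrable M (\<lambda>x. (f x)\<^sup>2)"

abbreviation sqn :: "'a measure \<Rightarrow> ('a \<Rightarrow> real) \<Rightarrow> real" where
  "sqn M f \<equiv> (\<integral>x. (f x)\<^sup>2 \<partial>M)"

lemma sqintD:
  assumes "sqint M f"
  shows sqint_measurable: "f \<in> borel_measurable M" and sqint_integrable: "integrable M (\<lambda>x. (f x)\<^sup>2)"
  using assms by (auto simp: sqint_def)

lemma sqint_iff_nn: 
  "sqint M f \<longleftrightarrow> f \<in> borel_measurable M \<and> (\<integral>\<^sup>+x. ennreal ((f x)\<^sup>2) \<partial>M) < \<infinity>"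
  unfolding sqint_def integrable_iff_bounded by auto

lemma nn_integral_sqint:
  assumes "sqint M f" shows "(\<integral>\<^sup>+x. ennreal ((f x)\<^sup>2) \<partial>M) = ennreal (sqn M f)"
  using assms by (intro nn_integral_eq_integral) (auto simp: sqint_def)

lemma sqint_bound:
  assumes f: "sqint M f" and [measurable]: "g \<in> borel_measurable M"
    and le: "\<And>x. x \<in> space M \<Longrightarrow> \<bar>g x\<bar> \<le> c * \<bar>f x\<bar>"
  shows "sqint M g"
  unfolding sqint_def
proof
  have "integrable M (\<lambda>x. c\<^sup>2 * (f x)\<^sup>2)" using f by (auto simp: sqint_def)
  moreover have "(g x)\<^sup>2 \<le> c\<^sup>2 * (f x)\<^sup>2" if "x \<in> space M" for x
    using power_mono[OF le[OF that] abs_ge_zero, of 2] by (simp add: power_mult_distrib)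
  ultimately show "integrable M (\<lambda>x. (g x)\<^sup>2)"
    using Bochner_Integration.integrable_bound[of M "\<lambda>x. c\<^sup>2 * (f x)\<^sup>2" "\<lambda>x. (g x)\<^sup>2"]
    by auto
qed fact

lemma sqint_cmult: "sqint M f \<Longrightarrow> sqint M (\<lambda>x. c * f x)"
  by (auto simp: sqint_def power_mult_distrib)

lemma sqint_add:
  assumes f: "sqint M f" and g: "sqint M g"
  shows "sqint M (\<lambda>x. f x + g x)"
    and "(sqn M (\<lambda>x. f x + g x)) \<le> 2 * (sqn M f) + 2 * (sqn M g)"
proof -
  have [measurable]: "f \<in> borel_measurable M" "g \<in> borel_measurable M"
    using f g by (auto simp: sqint_def)
  have le: "(f x + g x)\<^sup>2 \<le> 2 * (f x)\<^sup>2 + 2 * (g x)\<^sup>2" for x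
    using zero_le_power2[of "f x - g x"] by (simp add: power2_eq_square algebra_simps)
  have i: "integrable M (\<lambda>x. 2 * (f x)\<^sup>2 + 2 * (g x)\<^sup>2)"
    using f g by (auto simp: sqint_def)
  then have j: "integrable M (\<lambda>x. (f x + g x)\<^sup>2)"
    by (rule Bochner_Integration.integrable_bound) (use le in auto)
  then show "sqint M (\<lambda>x. f x + g x)" by (simp add: sqint_def)
  have "(sqn M (\<lambda>x. f x + g x)) \<le> (\<integral>x. 2 * (f x)\<^sup>2 + 2 * (g x)\<^sup>2 \<partial>M)"
    by (rule integral_mono[OF j i le])
  then show "(sqn M (\<lambda>x. f x + g x)) \<le> 2 * (sqn M f) + 2 * (sqn M g)"
    using f g by (simp add: sqint_def)
qed

lemma sqint_diff:
  assumes f: "sqint M f" and g: "sqint M g"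
  shows "sqint M (\<lambda>x. f x - g x)"
    and "(sqn M (\<lambda>x. f x - g x)) \<le> 2 * (sqn M f) + 2 * (sqn M g)"
  using sqint_add[OF f sqint_cmult[OF g, of "-1"]] by simp_all

lemma sqint_zero: "sqint M (\<lambda>x. 0)" by (simp add: sqint_def)

lemma sqint_sum: "(\<And>i. i \<in> I \<Longrightarrow> sqint M (f i)) \<Longrightarrow> sqint M (\<lambda>x. \<Sum>i\<in>I. f i x)"
  by (induction I rule: infinite_finite_induct) (auto intro: sqint_add sqint_zero)

lemma sqint_mult:
  assumes f: "sqint M f" and g: "sqint M g"
  shows integrable_sqint_mult: "integrable M (\<lambda>x. f x * g x)"
    and abs_integral_mult_le: "\<bar>\<integral>x. f x * g x \<partial>M\<bar> \<le> sqrt ((sqn M f) * (sqn M g))"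
proof -
  have [measurable]: "f \<in> borel_measurable M" "g \<in> borel_measurable M"
    using f g by (auto simp: sqint_def)
  have le: "\<bar>f x * g x\<bar> \<le> (f x)\<^sup>2 + (g x)\<^sup>2" for x
    using sum_squares_bound[of "\<bar>f x\<bar>" "\<bar>g x\<bar>"] mult_nonneg_nonneg[OF abs_ge_zero[of "f x"] abs_ge_zero[of "g x"]]
    unfolding abs_mult power2_abs by linarith
  have "integrable M (\<lambda>x. (f x)\<^sup>2 + (g x)\<^sup>2)"
    using f g by (auto simp: sqint_def)
  then show i: "integrable M (\<lambda>x. f x * g x)"
    by (rule Bochner_Integration.integrable_bound) (use le in auto)
  have "ennreal ((\<integral>x. \<bar>f x * g x\<bar> \<partial>M)\<^sup>2) = (\<integral>\<^sup>+x. ennreal \<bar>f x\<bar> * ennreal \<bar>g x\<bar> \<partial>M)\<^sup>2"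
    using i by (simp add: ennreal_mult[symmetric] abs_mult[symmetric] ennreal_power nn_integral_eq_integral)
  also have "\<dots> \<le> (\<integral>\<^sup>+x. (ennreal \<bar>f x\<bar>)\<^sup>2 \<partial>M) * (\<integral>\<^sup>+x. (ennreal \<bar>g x\<bar>)\<^sup>2 \<partial>M)"
    by (rule Cauchy_Schwarz_nn_integral) auto
  also have "\<dots> = ennreal ((sqn M f) * (sqn M g))"
    by (simp add: ennreal_power nn_integral_sqint[OF f] nn_integral_sqint[OF g] ennreal_mult)
  finally have "(\<integral>x. \<bar>f x * g x\<bar> \<partial>M)\<^sup>2 \<le> (sqn M f) * (sqn M g)"
    by (subst (asm) ennreal_le_iff) auto
  moreover have "\<bar>\<integral>x. f x * g x \<partial>M\<bar> \<le> (\<integral>x. \<bar>f x * g x\<bar> \<partial>M)"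
    by (rule integral_abs_bound)
  ultimately show "\<bar>\<integral>x. f x * g x \<partial>M\<bar> \<le> sqrt ((sqn M f) * (sqn M g))"
    by (smt (verit) real_le_rsqrt)
qed

lemma sqint_cong_AE:
  assumes "AE x in M. f x = g x" "f \<in> borel_measurable M" "g \<in> borel_measurable M"
  shows "sqint M f \<longleftrightarrow> sqint M g"
proof -
  have "AE x in M. (f x)\<^sup>2 = (g x)\<^sup>2" using assms(1) by eventually_elim simp
  then have "integrable M (\<lambda>x. (f x)\<^sup>2) \<longleftrightarrow> integrable M (\<lambda>x. (g x)\<^sup>2)"
    using assms by (intro integrable_cong_AE) auto
  then show ?thesis using assms by (simp add: sqint_def)
qed

subsection \<open>Completeness and weak sequential compactness of the square-integrable functions\<close>

text \<open>Compactness is proved through this property rather than through limits: it passes to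
  finite sums without naming the limit of any summand, and completeness is invoked only for whole
  components of the operator.\<close>

definition l2cauchy :: "'a measure \<Rightarrow> (nat \<Rightarrow> 'a \<Rightarrow> real) \<Rightarrow> bool" where
  "l2cauchy M u \<longleftrightarrow> (\<forall>e>0. \<exists>P. \<forall>p\<ge>P. \<forall>q\<ge>P. (sqn M (\<lambda>x. u p x - u q x)) < e)"

lemma l2cauchy_add:
  assumes u: "\<And>p. sqint M (u p)" "l2cauchy M u" and v: "\<And>p. sqint M (v p)" "l2cauchy M v"
  shows "l2cauchy M (\<lambda>p x. u p x + v p x)"
  unfolding l2cauchy_def
proof (intro allI impI)
  fix e :: real assume e: "e > 0"
  have e4: "e / 4 > 0" using e by simp
  obtain P where P: "\<And>p q. p \<ge> P \<Longrightarrow> q \<ge> P \<Longrightarrow> (sqn M (\<lambda>x. u p x - u q x)) < e / 4"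
    using u(2) e4 unfolding l2cauchy_def by blast
  obtain Q where Q: "\<And>p q. p \<ge> Q \<Longrightarrow> q \<ge> Q \<Longrightarrow> (sqn M (\<lambda>x. v p x - v q x)) < e / 4"
    using v(2) e4 unfolding l2cauchy_def by blast
  show "\<exists>P. \<forall>p\<ge>P. \<forall>q\<ge>P. (sqn M (\<lambda>x. u p x + v p x - (u q x + v q x))) < e"
  proof (intro exI[of _ "max P Q"] allI impI)
    fix p q assume pq: "max P Q \<le> p" "max P Q \<le> q"
    have "(sqn M (\<lambda>x. (u p x - u q x) + (v p x - v q x)))
      \<le> 2 * (sqn M (\<lambda>x. u p x - u q x)) + 2 * (sqn M (\<lambda>x. v p x - v q x))"
      by (intro sqint_add sqint_diff u v)
    also have "\<dots> < e" using P[of p q] Q[of p q] pq by simp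
    finally show "(sqn M (\<lambda>x. u p x + v p x - (u q x + v q x))) < e"
      by (simp add: algebra_simps)
  qed
qed

lemma l2cauchy_cmult:
  assumes "l2cauchy M u"
  shows "l2cauchy M (\<lambda>p x. c * u p x)"
  unfolding l2cauchy_def
proof (intro allI impI)
  fix e :: real assume e: "e > 0"
  have "e / (c\<^sup>2 + 1) > 0" using e by (simp add: add_nonneg_pos)
  then obtain P where P: "\<And>p q. p \<ge> P \<Longrightarrow> q \<ge> P \<Longrightarrow> (sqn M (\<lambda>x. u p x - u q x)) < e / (c\<^sup>2 + 1)"
    using assms unfolding l2cauchy_def by blast
  have "(sqn M (\<lambda>x. c * u p x - c * u q x)) < e" if "p \<ge> P" "q \<ge> P" for p q
  proof -
    have "(sqn M (\<lambda>x. c * u p x - c * u q x)) = c\<^sup>2 * (sqn M (\<lambda>x. u p x - u q x))"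
      by (simp add: right_diff_distrib[symmetric] power_mult_distrib)
    also have "\<dots> \<le> (c\<^sup>2 + 1) * (sqn M (\<lambda>x. u p x - u q x))"
      by (intro mult_right_mono) auto
    also have "\<dots> < e" using P[OF that] pos_less_divide_eq[of "c\<^sup>2 + 1" _ e]
      by (simp add: add_nonneg_pos mult.commute)
    finally show ?thesis .
  qed
  then show "\<exists>P. \<forall>p\<ge>P. \<forall>q\<ge>P. (sqn M (\<lambda>x. c * u p x - c * u q x)) < e" by blast
qed

lemma l2cauchy_sum:
  assumes "\<And>i p. i \<in> I \<Longrightarrow> sqint M (u i p)" "\<And>i. i \<in> I \<Longrightarrow> l2cauchy M (u i)"
  shows "l2cauchy M (\<lambda>p x. \<Sum>i\<in>I. u i p x)"
  using assms
proof (induction I rule: infinite_finite_induct)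
  case (insert i I)
  have "l2cauchy M (\<lambda>p x. u i p x + (\<Sum>i\<in>I. u i p x))"
    by (intro l2cauchy_add insert sqint_sum) (auto intro: insert)
  then show ?case using insert by simp
qed (auto simp: l2cauchy_def)

lemma l2cauchy_cong_AE:
  assumes "\<And>p. AE x in M. u p x = v p x" "\<And>p. u p \<in> borel_measurable M" "\<And>p. v p \<in> borel_measurable M"
  shows "l2cauchy M u \<longleftrightarrow> l2cauchy M v"
proof -
  have "(sqn M (\<lambda>x. u p x - u q x)) = (sqn M (\<lambda>x. v p x - v q x))" for p q
  proof (rule integral_cong_AE)
    show "AE x in M. (u p x - u q x)\<^sup>2 = (v p x - v q x)\<^sup>2"
      using assms(1)[of p] assms(1)[of q] by eventually_elim simp
  qed (use assms in auto)
  then show ?thesis by (simp add: l2cauchy_def)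
qed

text \<open>Riesz-Fischer: a subsequence with rapidly decreasing gaps converges almost everywhere,
  and Fatou's lemma upgrades the pointwise limit to a limit in square norm.\<close>

lemma l2_complete:
  assumes u: "\<And>p. sqint M (u p)" and C: "l2cauchy M u"
  obtains v where "sqint M v" "(\<lambda>p. \<integral>x. (u p x - v x)\<^sup>2 \<partial>M) \<longlonglongrightarrow> 0"
proof -
  have [measurable]: "u p \<in> borel_measurable M" for p using u by (auto simp: sqint_def)
  have d: "integrable M (\<lambda>x. (u p x - u q x)\<^sup>2)" for p q 
    using sqint_diff(1)[OF u u] by (auto simp: sqint_def)
  have "\<exists>P. \<forall>k. \<forall>p\<ge>P k. \<forall>q\<ge>P k. (sqn M (\<lambda>x. u p x - u q x)) < (1/4)^k"
  proof (rule choice, rule allI)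
    fix k :: nat
    have "(0::real) < (1/4)^k" by simp
    then show "\<exists>P. \<forall>p\<ge>P. \<forall>q\<ge>P. (sqn M (\<lambda>x. u p x - u q x)) < (1/4)^k"
      using C unfolding l2cauchy_def by blast
  qed
  then obtain P where P: "\<And>k p q. p \<ge> P k \<Longrightarrow> q \<ge> P k \<Longrightarrow> (sqn M (\<lambda>x. u p x - u q x)) < (1/4)^k"
    by blast
  \<comment> \<open>The partial sums of \<open>P\<close> increase and dominate it, so two
    consecutive terms of the subsequence \<open>s\<close> both lie beyond
    \<open>P k\<close>.\<close>
  define s where "s k = (\<Sum>i\<le>k. P i)" for k
  have s: "s k \<ge> P k" for k unfolding s_def by (rule member_le_sum) auto
  have s_mono: "s (Suc k) \<ge> P k" for k using s[of k] by (simp add: s_def)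
  \<comment> \<open>The weight \<open>2^k\<close> is a compromise: against the gaps
    \<open>(1/4)^k\<close> the integrals of \<open>D k\<close> remain summable, while
    \<open>D k x < 1\<close> still forces the increments at \<open>x\<close> below
    \<open>(1/2)^(k/2)\<close>, a summable bound.\<close>
  define D where "D k x = 2^k * (u (s (Suc k)) x - u (s k) x)\<^sup>2" for k x
  have D: "(\<integral>\<^sup>+x. ennreal (D k x) \<partial>M) \<le> ennreal ((1/2)^k)" for k
  proof -
    have "(\<integral>\<^sup>+x. ennreal (D k x) \<partial>M) = ennreal (2^k * (\<integral>x. (u (s (Suc k)) x - u (s k) x)\<^sup>2 \<partial>M))"
      unfolding D_def using d by (subst nn_integral_eq_integral) auto
    also have "\<dots> \<le> ennreal (2^k * (1/4)^k)"
      using P[OF s_mono s, of k] by (intro ennreal_leI mult_left_mono) auto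
    also have "(2::real)^k * (1/4)^k = (1/2)^k" by (simp flip: power_mult_distrib)
    finally show ?thesis .
  qed
  have "(\<integral>\<^sup>+x. (\<Sum>k. ennreal (D k x)) \<partial>M) = (\<Sum>k. \<integral>\<^sup>+x. ennreal (D k x) \<partial>M)"
    unfolding D_def by (rule nn_integral_suminf) measurable
  also have "\<dots> \<le> (\<Sum>k. ennreal ((1/2)^k))" by (intro suminf_le D) auto
  also have "\<dots> < \<infinity>"
    by (subst suminf_ennreal2) (auto simp: summable_geometric)
  finally have "AE x in M. (\<Sum>k. ennreal (D k x)) \<noteq> \<infinity>"
    by (intro nn_integral_PInf_AE) (auto simp: D_def)
  then have conv: "AE x in M. convergent (\<lambda>k. u (s k) x)"
  proof eventually_elim
    case (elim x)
    then have "summable (\<lambda>k. D k x)"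
      by (intro summable_suminf_not_top) (auto simp: D_def)
    then have "(\<lambda>k. D k x) \<longlonglongrightarrow> 0" by (rule summable_LIMSEQ_zero)
    then obtain K where K: "\<And>k. k \<ge> K \<Longrightarrow> \<bar>D k x\<bar> < 1"
      using LIMSEQ_D[of _ 0 1] by force
    have "norm (u (s (Suc k)) x - u (s k) x) \<le> (sqrt (1/2)) ^ k" if "k \<ge> K" for k
    proof -
      have "(u (s (Suc k)) x - u (s k) x)\<^sup>2 \<le> (1/2)^k"
        using K[OF that] by (simp add: D_def abs_mult field_simps)
      then have "\<bar>u (s (Suc k)) x - u (s k) x\<bar> \<le> sqrt ((1/2)^k)" 
        by (intro real_le_rsqrt) simp
      then show ?thesis by (simp add: real_sqrt_power)
    qed
    then have "\<exists>K. \<forall>k\<ge>K. norm (u (s (Suc k)) x - u (s k) x) \<le> sqrt (1/2) ^ k" by blast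
    moreover have "summable (\<lambda>k. sqrt (1/2) ^ k)"
      by (rule summable_geometric) (simp add: real_sqrt_divide)
    ultimately have "summable (\<lambda>k. u (s (Suc k)) x - u (s k) x)"
      by (rule summable_comparison_test)
    then have "convergent (\<lambda>k. u (s k) x - u (s 0) x)"
      by (simp add: summable_iff_convergent sum_lessThan_telescope[of "\<lambda>k. u (s k) x"])
    then have "convergent (\<lambda>k. (u (s k) x - u (s 0) x) + u (s 0) x)"
      by (intro convergent_add convergent_const)
    then show ?case by simp
  qed
  define v where "v x = lim (\<lambda>k. u (s k) x)" for x
  have [measurable]: "v \<in> borel_measurable M" unfolding v_def by measurable
  have lim: "AE x in M. (\<lambda>k. u (s k) x) \<longlonglongrightarrow> v x"
    using conv by eventually_elim (simp add: v_def convergent_LIMSEQ_iff)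
  have fat: "(\<integral>\<^sup>+x. ennreal ((u p x - v x)\<^sup>2) \<partial>M) \<le> ennreal ((1/4)^k)" if "p \<ge> P k" for p k
  proof -
    have "(\<integral>\<^sup>+x. ennreal ((u p x - v x)\<^sup>2) \<partial>M) = (\<integral>\<^sup>+x. liminf (\<lambda>i. ennreal ((u p x - u (s i) x)\<^sup>2)) \<partial>M)"
    proof (rule nn_integral_cong_AE)
      show "AE x in M. ennreal ((u p x - v x)\<^sup>2) = liminf (\<lambda>i. ennreal ((u p x - u (s i) x)\<^sup>2))"
        using lim
      proof eventually_elim
        case (elim x)
        have "(\<lambda>i. ennreal ((u p x - u (s i) x)\<^sup>2)) \<longlonglongrightarrow> ennreal ((u p x - v x)\<^sup>2)"
          by (intro tendsto_intros elim)
        from lim_imp_Liminf[OF _ this] show ?case by simp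
      qed
    qed
    also have "\<dots> \<le> liminf (\<lambda>i. \<integral>\<^sup>+x. ennreal ((u p x - u (s i) x)\<^sup>2) \<partial>M)"
      by (rule nn_integral_liminf) measurable
    also have "\<dots> \<le> ennreal ((1/4)^k)"
    proof (rule Liminf_le)
      show "\<forall>\<^sub>F i in sequentially. (\<integral>\<^sup>+x. ennreal ((u p x - u (s i) x)\<^sup>2) \<partial>M) \<le> ennreal ((1/4)^k)"
      proof (rule eventually_sequentiallyI[of k])
        fix i assume "k \<le> i"
        have "P k \<le> s k" by (rule s)
        also have "s k \<le> s i" unfolding s_def using \<open>k \<le> i\<close> by (intro sum_mono2) auto
        finally have "P k \<le> s i" .
        have "(\<integral>\<^sup>+x. ennreal ((u p x - u (s i) x)\<^sup>2) \<partial>M) = ennreal (sqn M (\<lambda>x. u p x - u (s i) x))"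
          using d by (intro nn_integral_eq_integral) auto
        then show "(\<integral>\<^sup>+x. ennreal ((u p x - u (s i) x)\<^sup>2) \<partial>M) \<le> ennreal ((1/4)^k)"
          using P[OF \<open>p \<ge> P k\<close> \<open>P k \<le> s i\<close>] by (simp add: ennreal_leI)
      qed
    qed simp
    finally show ?thesis .
  qed
  have dv: "sqint M (\<lambda>x. u p x - v x)" if "p \<ge> P 0" for p
    unfolding sqint_iff_nn using fat[OF that] by (auto intro: le_less_trans)
  have "sqint M (\<lambda>x. u (P 0) x - (u (P 0) x - v x))"
    by (intro sqint_diff u dv) simp
  then have v: "sqint M v" by simp
  show ?thesis
  proof (rule that[OF v])
    show "(\<lambda>p. \<integral>x. (u p x - v x)\<^sup>2 \<partial>M) \<longlonglongrightarrow> 0"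
    proof (rule LIMSEQ_I)
      fix r :: real assume "r > 0"
      then obtain k where k: "(1/4::real)^k < r" using real_arch_pow_inv[of r "1/4"] by auto
      have "norm ((sqn M (\<lambda>x. u p x - v x)) - 0) < r" if "p \<ge> P k" for p
      proof -
        have "ennreal (sqn M (\<lambda>x. u p x - v x)) \<le> ennreal ((1/4)^k)"
          using fat[OF that] nn_integral_sqint[OF sqint_diff(1)[OF u v]] by simp
        then show ?thesis using k by (subst (asm) ennreal_le_iff) auto
      qed
      then show "\<exists>no. \<forall>n\<ge>no. norm ((sqn M (\<lambda>x. u n x - v x)) - 0) < r" by blast
    qed
  qed
qed

lemma sqint_indicator:
  assumes [measurable]: "A \<in> sets M" and "emeasure M A < \<infinity>"
  shows "sqint M (indicator A)"
proof -
  have "(\<lambda>x. (indicator A x :: real)\<^sup>2) = indicator A" by (auto simp: indicator_def)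
  then show ?thesis using assms by (simp add: sqint_def)
qed

text \<open>Since the sequence \<open>u\<close> is bounded in norm, the pairings with
  \<open>f k\<close> tend to those with \<open>g\<close> uniformly in \<open>p\<close>, and a
  uniform limit of Cauchy sequences is Cauchy. The admissible test functions thus form a closed
  set.\<close>

lemma convergent_pairing_closed:
  assumes u: "\<And>p. sqint M (u p)" and B: "\<And>p. (sqn M (u p)) \<le> B"
    and f: "\<And>k. sqint M (f k)" "sqint M g" and lim: "(\<lambda>k. \<integral>x. (f k x - g x)\<^sup>2 \<partial>M) \<longlonglongrightarrow> 0"
    and conv: "\<And>k. convergent (\<lambda>p. \<integral>x. u p x * f k x \<partial>M)"
  shows "convergent (\<lambda>p. \<integral>x. u p x * g x \<partial>M)"
proof (rule real_Cauchy_convergent, rule CauchyI)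
  fix e :: real assume e: "e > 0"
  have B0: "B \<ge> 0" using B[of 0] by (rule order_trans[rotated]) simp
  have "(\<lambda>k. sqrt (B * (sqn M (\<lambda>x. f k x - g x)))) \<longlonglongrightarrow> sqrt (B * 0)"
    by (intro tendsto_intros lim)
  then have "\<forall>\<^sub>F k in sequentially. sqrt (B * (sqn M (\<lambda>x. f k x - g x))) < e / 3"
    using e by (intro order_tendstoD(2)) auto
  then obtain k where k: "sqrt (B * (sqn M (\<lambda>x. f k x - g x))) < e / 3"
    using eventually_happens by force
  have d: "\<bar>(\<integral>x. u p x * f k x \<partial>M) - (\<integral>x. u p x * g x \<partial>M)\<bar> < e / 3" for p
  proof -
    have "(\<integral>x. u p x * f k x \<partial>M) - (\<integral>x. u p x * g x \<partial>M) = (\<integral>x. u p x * (f k x - g x) \<partial>M)"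
      by (simp add: right_diff_distrib integrable_sqint_mult[OF u f(1)] integrable_sqint_mult[OF u f(2)])
    also have "\<bar>\<dots>\<bar> \<le> sqrt ((sqn M (u p)) * (sqn M (\<lambda>x. f k x - g x)))"
      by (intro abs_integral_mult_le u sqint_diff f)
    also have "\<dots> \<le> sqrt (B * (sqn M (\<lambda>x. f k x - g x)))"
      by (intro real_sqrt_le_mono mult_right_mono B) simp
    finally show ?thesis using k by simp
  qed
  have "Cauchy (\<lambda>p. \<integral>x. u p x * f k x \<partial>M)" using conv by (rule convergent_Cauchy)
  moreover have "e / 3 > 0" using e by simp
  ultimately obtain N where N: "\<And>p q. p \<ge> N \<Longrightarrow> q \<ge> N \<Longrightarrow>
      norm ((\<integral>x. u p x * f k x \<partial>M) - (\<integral>x. u q x * f k x \<partial>M)) < e / 3"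
    using CauchyD by blast
  have "norm ((\<integral>x. u p x * g x \<partial>M) - (\<integral>x. u q x * g x \<partial>M)) < e" if "p \<ge> N" "q \<ge> N" for p q
    using N[OF that] d[of p] d[of q] unfolding real_norm_def by linarith
  then show "\<exists>N. \<forall>m\<ge>N. \<forall>n\<ge>N. norm ((\<integral>x. u m x * g x \<partial>M) - (\<integral>x. u n x * g x \<partial>M)) < e" by blast
qed

text \<open>Bounded weakly Cauchy sequences. No weak limit is part of the notion, so none has to be
  represented by a function.\<close>

definition wcauchy :: "(nat \<Rightarrow> 'a::euclidean_space \<Rightarrow> real) \<Rightarrow> bool" where
  "wcauchy u \<longleftrightarrow> (\<forall>p. sqint lborel (u p)) \<and> (\<exists>B. \<forall>p. (sqn lborel (u p)) \<le> B)
     \<and> (\<forall>f. sqint lborel f \<longrightarrow> convergent (\<lambda>p. \<integral>x. u p x * f x \<partial>lborel))"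

lemma convergent_sum_real:
  fixes f :: "'i \<Rightarrow> nat \<Rightarrow> real"
  assumes "\<And>i. i \<in> I \<Longrightarrow> convergent (f i)"
  shows "convergent (\<lambda>p. \<Sum>i\<in>I. f i p)"
  using assms by (induction I rule: infinite_finite_induct) (auto intro: convergent_add convergent_const)

text \<open>The test functions are enlarged in two stages. Indicators of
  \<open>A \<inter> ball\<close>, the ball keeping the measure finite, pass from the \<pi>-system
  \<open>E\<close> to all Borel sets: complements are differences from \<open>UNIV\<close>,
  countable disjoint unions are limits in square norm. Simple functions of bounded support are
  finite combinations of these and are dense.\<close>

lemma wcauchy_from_sets:
  fixes u :: "nat \<Rightarrow> 'a::euclidean_space \<Rightarrow> real"
  assumes u: "\<And>p. sqint lborel (u p)" and B: "\<And>p. (sqn lborel (u p)) \<le> B"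
    and E: "Int_stable E" "sets borel = sigma_sets UNIV E" "UNIV \<in> E"
    and conv: "\<And>A N. A \<in> E \<Longrightarrow> convergent (\<lambda>p. \<integral>x. u p x * indicator (A \<inter> ball 0 (real N)) x \<partial>lborel)"
  shows "wcauchy u"
proof -
  have fin: "emeasure lborel (A \<inter> ball (0::'a) r) < \<infinity>" if [measurable]: "A \<in> sets borel" for A r
    using emeasure_mono[of "A \<inter> ball 0 r" "ball 0 r" "lborel :: 'a measure"] emeasure_lborel_ball_finite[of "0::'a" r]
    by (auto intro: le_less_trans)
  have ind: "sqint lborel (indicator (A \<inter> ball 0 r) :: 'a \<Rightarrow> real)" if "A \<in> sets borel" for A r
    using that fin[OF that] by (intro sqint_indicator) auto
  have cA: "\<forall>N. convergent (\<lambda>p. \<integral>x. u p x * indicator (A \<inter> ball 0 (real N)) x \<partial>lborel)"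
    if A: "A \<in> sets borel" for A :: "'a set"
  proof -
    have "A \<in> sigma_sets UNIV E" using A E(2) by simp
    from E(1) subset_UNIV[of E, unfolded Pow_UNIV[symmetric]] this show ?thesis
    proof (induction rule: sigma_sets_induct_disjoint)
      case (basic A)
      then show ?case using conv by blast
    next
      case empty
      then show ?case by (simp add: convergent_const)
    next
      case (compl A)
      have A[measurable]: "A \<in> sets borel" using compl(1) E(2) by simp
      show ?case
      proof
        fix N :: nat
        have "convergent (\<lambda>p. (\<integral>x. u p x * indicator (UNIV \<inter> ball 0 (real N)) x \<partial>lborel)
            - (\<integral>x. u p x * indicator (A \<inter> ball 0 (real N)) x \<partial>lborel))"
          by (intro convergent_diff conv E(3) compl(2)[rule_format])
        also have "(\<lambda>p. (\<integral>x. u p x * indicator (UNIV \<inter> ball 0 (real N)) x \<partial>lborel)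
            - (\<integral>x. u p x * indicator (A \<inter> ball 0 (real N)) x \<partial>lborel))
          = (\<lambda>p. \<integral>x. u p x * indicator ((UNIV - A) \<inter> ball 0 (real N)) x \<partial>lborel)"
        proof
          fix p
          have "(\<integral>x. u p x * indicator (UNIV \<inter> ball 0 (real N)) x \<partial>lborel)
            - (\<integral>x. u p x * indicator (A \<inter> ball 0 (real N)) x \<partial>lborel)
            = (\<integral>x. u p x * indicator (UNIV \<inter> ball 0 (real N)) x - u p x * indicator (A \<inter> ball 0 (real N)) x \<partial>lborel)"
            by (intro Bochner_Integration.integral_diff[symmetric] integrable_sqint_mult u ind) auto
          also have "\<dots> = (\<integral>x. u p x * indicator ((UNIV - A) \<inter> ball 0 (real N)) x \<partial>lborel)"
            by (intro Bochner_Integration.integral_cong) (auto simp: indicator_def)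
          finally show "(\<integral>x. u p x * indicator (UNIV \<inter> ball 0 (real N)) x \<partial>lborel)
            - (\<integral>x. u p x * indicator (A \<inter> ball 0 (real N)) x \<partial>lborel) = \<dots>" .
        qed
        finally show "convergent (\<lambda>p. \<integral>x. u p x * indicator ((UNIV - A) \<inter> ball 0 (real N)) x \<partial>lborel)" .
      qed
    next
      case (union A)
      have A[measurable]: "A i \<in> sets borel" for i using union(2) E(2) by auto
      show ?case
      proof
        fix N :: nat
        define b where "b = ball (0::'a) (real N)"
        have [measurable]: "b \<in> sets borel" by (simp add: b_def)
        define f where "f k x = (\<Sum>i<k. indicator (A i \<inter> b) x :: real)" for k x
        have f_eq: "f k x = indicator ((\<Union>i<k. A i) \<inter> b) x" for k x
        proof -
          have "disjoint_family_on (\<lambda>i. A i \<inter> b) {..<k}"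
            using union(1) by (auto simp: disjoint_family_on_def)
          then show ?thesis
            unfolding f_def by (subst indicator_UN_disjoint[symmetric]) (auto simp: Int_UN_distrib2)
        qed
        have lim: "(\<lambda>k. \<integral>x. (f k x - indicator ((\<Union>i. A i) \<inter> b) x)\<^sup>2 \<partial>lborel) \<longlonglongrightarrow> (\<integral>x. 0 \<partial>(lborel :: 'a measure))"
        proof (rule integral_dominated_convergence[where w="indicator b"])
          show "integrable lborel (indicator b :: 'a \<Rightarrow> real)"
            using fin[of UNIV] by (simp add: b_def)
          show "AE x in lborel. (\<lambda>k. (f k x - indicator ((\<Union>i. A i) \<inter> b) x)\<^sup>2) \<longlonglongrightarrow> 0"
          proof (rule AE_I2)
            fix x :: 'a
            show "(\<lambda>k. (f k x - indicator ((\<Union>i. A i) \<inter> b) x)\<^sup>2) \<longlonglongrightarrow> 0"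
            proof (cases "\<exists>i. x \<in> A i")
              case True
              then obtain i where "x \<in> A i" by blast
              then have "\<forall>\<^sub>F k in sequentially. (f k x - indicator ((\<Union>i. A i) \<inter> b) x)\<^sup>2 = 0"
                unfolding f_eq by (intro eventually_sequentiallyI[of "Suc i"]) (auto simp: indicator_def)
              then show ?thesis by (rule tendsto_eventually)
            qed (auto simp: f_eq)
          qed
          show "AE x in lborel. norm ((f k x - indicator ((\<Union>i. A i) \<inter> b) x)\<^sup>2) \<le> indicator b x" for k
            unfolding f_eq by (auto simp: indicator_def)
        qed (auto simp: f_eq)
        have "convergent (\<lambda>p. \<integral>x. u p x * indicator ((\<Union>i. A i) \<inter> b) x \<partial>lborel)"
        proof (rule convergent_pairing_closed[OF u B])
          show "sqint lborel (f k)" for k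
            unfolding f_def b_def by (intro sqint_sum ind) auto
          show "sqint lborel (indicator ((\<Union>i. A i) \<inter> b) :: 'a \<Rightarrow> real)"
            unfolding b_def by (intro ind) auto
          show "(\<lambda>k. \<integral>x. (f k x - indicator ((\<Union>i. A i) \<inter> b) x)\<^sup>2 \<partial>lborel) \<longlonglongrightarrow> 0"
            using lim by simp
          have "(\<integral>x. u p x * f k x \<partial>lborel) = (\<Sum>i<k. \<integral>x. u p x * indicator (A i \<inter> b) x \<partial>lborel)" for p k
            unfolding f_def sum_distrib_left b_def
            by (intro Bochner_Integration.integral_sum integrable_sqint_mult u ind) auto
          moreover have "convergent (\<lambda>p. \<Sum>i<k. \<integral>x. u p x * indicator (A i \<inter> b) x \<partial>lborel)" for k
            unfolding b_def using union(3) by (intro convergent_sum_real) auto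
          ultimately show "convergent (\<lambda>p. \<integral>x. u p x * f k x \<partial>lborel)" for k by simp
        qed
        then show "convergent (\<lambda>p. \<integral>x. u p x * indicator (\<Union> (range A) \<inter> ball 0 (real N)) x \<partial>lborel)"
          by (simp add: b_def)
      qed
    qed
  qed
  have "convergent (\<lambda>p. \<integral>x. u p x * g x \<partial>lborel)" if g: "sqint lborel g" for g
  proof -
    have [measurable]: "g \<in> borel_measurable borel" using sqint_measurable[OF g] by simp
    obtain s where s: "\<And>i. simple_function (borel :: 'a measure) (s i)" "\<And>x. (\<lambda>i. s i x) \<longlonglongrightarrow> g x"
      "\<And>i x. dist (s i x) 0 \<le> 2 * dist (g x) 0"
      using borel_measurable_implies_sequence_metric[of g borel 0] by auto
    define f where "f k x = s k x * indicator (ball 0 (real k)) x" for k x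
    have [measurable]: "s k \<in> borel_measurable borel" for k
      using s(1) by (rule borel_measurable_simple_function)
    have f_le: "\<bar>f k x\<bar> \<le> 2 * \<bar>g x\<bar>" for k x
      using s(3)[of k x] by (auto simp: f_def indicator_def dist_real_def)
    have f: "sqint lborel (f k)" for k
      by (rule sqint_bound[OF g, of _ 2]) (use f_le in \<open>auto simp: f_def[abs_def]\<close>)
    \<comment> \<open>The approximants are at most \<open>2 * |g|\<close> in absolute value, so
      their distance from \<open>g\<close> is at most \<open>3 * |g|\<close>; hence the 9.\<close>
    have lim: "(\<lambda>k. \<integral>x. (f k x - g x)\<^sup>2 \<partial>lborel) \<longlonglongrightarrow> (\<integral>x. 0 \<partial>(lborel :: 'a measure))"
    proof (rule integral_dominated_convergence[where w="\<lambda>x. 9 * (g x)\<^sup>2"])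
      show "integrable lborel (\<lambda>x. 9 * (g x)\<^sup>2)" using sqint_integrable[OF g] by simp
      show "AE x in lborel. (\<lambda>k. (f k x - g x)\<^sup>2) \<longlonglongrightarrow> 0"
      proof (rule AE_I2)
        fix x :: 'a
        have "\<forall>\<^sub>F k in sequentially. f k x = s k x"
        proof -
          obtain N :: nat where "norm x < real N" using reals_Archimedean2 by blast
          then show ?thesis
            by (intro eventually_sequentiallyI[of N]) (auto simp: f_def indicator_def)
        qed
        then have "(\<lambda>k. f k x) \<longlonglongrightarrow> g x" using s(2)[of x] by (simp add: tendsto_cong)
        from tendsto_power[OF tendsto_diff[OF this tendsto_const[of "g x"]], of 2]
        show "(\<lambda>k. (f k x - g x)\<^sup>2) \<longlonglongrightarrow> 0" by simp
      qed
      show "AE x in lborel. norm ((f k x - g x)\<^sup>2) \<le> 9 * (g x)\<^sup>2" for k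
      proof (rule AE_I2)
        fix x
        have "\<bar>f k x - g x\<bar> \<le> 3 * \<bar>g x\<bar>" using f_le[of k x] by linarith
        then have "\<bar>f k x - g x\<bar>\<^sup>2 \<le> (3 * \<bar>g x\<bar>)\<^sup>2" by (intro power_mono) auto
        then show "norm ((f k x - g x)\<^sup>2) \<le> 9 * (g x)\<^sup>2" by (simp add: power_mult_distrib)
      qed
    qed (auto simp: f_def)
    show ?thesis
    proof (rule convergent_pairing_closed[OF u B f g])
      show "(\<lambda>k. \<integral>x. (f k x - g x)\<^sup>2 \<partial>lborel) \<longlonglongrightarrow> 0" using lim by simp
      fix k
      define S where "S y = s k -` {y}" for y
      have S[measurable]: "S y \<in> sets borel" for y
        using measurable_sets[of "s k" borel borel "{y}"] by (simp add: S_def)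
      have finS: "finite (range (s k))" using simple_functionD(1)[OF s(1)[of k]] by simp
      have f_eq: "f k x = (\<Sum>y\<in>range (s k). y * indicator (S y \<inter> ball 0 (real k)) x)" for x
      proof -
        have "(\<Sum>y\<in>range (s k). y * indicator (S y \<inter> ball 0 (real k)) x)
           = (\<Sum>y\<in>range (s k). if s k x = y then y * indicator (ball 0 (real k)) x else 0)"
          by (intro sum.cong) (auto simp: S_def indicator_def)
        also have "\<dots> = f k x" using finS by (simp add: f_def)
        finally show ?thesis by simp
      qed
      have "(\<integral>x. u p x * f k x \<partial>lborel)
        = (\<Sum>y\<in>range (s k). y * (\<integral>x. u p x * indicator (S y \<inter> ball 0 (real k)) x \<partial>lborel))" for p
      proof -
        have "(\<integral>x. u p x * f k x \<partial>lborel)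
          = (\<integral>x. (\<Sum>y\<in>range (s k). y * (u p x * indicator (S y \<inter> ball 0 (real k)) x)) \<partial>lborel)"
          unfolding f_eq by (simp add: sum_distrib_left mult.left_commute)
        also have "\<dots> = (\<Sum>y\<in>range (s k). \<integral>x. y * (u p x * indicator (S y \<inter> ball 0 (real k)) x) \<partial>lborel)"
          by (intro Bochner_Integration.integral_sum integrable_mult_right integrable_sqint_mult u ind S)
        finally show ?thesis by simp
      qed
      moreover have "convergent (\<lambda>p. \<Sum>y\<in>range (s k). y * (\<integral>x. u p x * indicator (S y \<inter> ball 0 (real k)) x \<partial>lborel))"
        using cA[OF S] by (intro convergent_sum_real convergent_mult convergent_const) auto
      ultimately show "convergent (\<lambda>p. \<integral>x. u p x * f k x \<partial>lborel)" by simp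
    qed
  qed
  then show ?thesis using u B by (auto simp: wcauchy_def)
qed

lemma convergent_subseq_tail:
  fixes f :: "nat \<Rightarrow> real"
  assumes "convergent (\<lambda>p. f (p + k))" shows "convergent f"
  using assms by (simp add: convergent_ignore_initial_segment)

text \<open>Only countably many real sequences have to be made convergent: one for each index
  \<open>c\<close>, each member of a countable \<pi>-system and each integer radius. All are bounded
  by Cauchy-Schwarz, so a diagonal argument gives a single subsequence that serves every index at
  once, as a vector of components requires.\<close>

lemma weak_compactness:
  fixes u :: "'i::countable \<Rightarrow> nat \<Rightarrow> 'a::euclidean_space \<Rightarrow> real"
  assumes u: "\<And>c p. sqint lborel (u c p)" and B: "\<And>c p. (sqn lborel (u c p)) \<le> B"
  obtains \<rho> where "strict_mono (\<rho> :: nat \<Rightarrow> nat)" "\<And>c. wcauchy (\<lambda>p. u c (\<rho> p))"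
proof -
  obtain Bas :: "'a set set" where Bas: "countable Bas" "topological_basis Bas"
    using ex_countable_basis by blast
  \<comment> \<open>Finite intersections turn a countable basis into a \<pi>-system and keep it
    countable; the empty intersection supplies \<open>UNIV\<close>.\<close>
  define E where "E = Inter ` {F. finite F \<and> F \<subseteq> Bas}"
  have cE: "countable E" unfolding E_def
    by (intro countable_image countable_Collect_finite_subset Bas)
  have UE: "UNIV \<in> E" unfolding E_def by (rule image_eqI[of _ _ "{}"]) auto
  have openE: "open A" if "A \<in> E" for A
    using that topological_basis_open[OF Bas(2)] unfolding E_def by (auto intro!: open_Inter)
  have IE: "Int_stable E"
  proof (rule Int_stableI)
    fix a b assume "a \<in> E" "b \<in> E"
    then obtain F G where "finite F" "F \<subseteq> Bas" "finite G" "G \<subseteq> Bas" "a = \<Inter>F" "b = \<Inter>G"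
      unfolding E_def by auto
    then show "a \<inter> b \<in> E" unfolding E_def by (intro image_eqI[of _ _ "F \<union> G"]) auto
  qed
  have BE: "Bas \<subseteq> E"
  proof
    fix b assume "b \<in> Bas"
    then show "b \<in> E" unfolding E_def by (intro image_eqI[of _ _ "{b}"]) auto
  qed
  have SE: "sets borel = sigma_sets UNIV E"
  proof
    have "sets borel = sigma_sets UNIV Bas"
      by (subst borel_eq_countable_basis[OF Bas]) (simp add: sets_measure_of)
    also have "\<dots> \<subseteq> sigma_sets UNIV E" using BE by (rule sigma_sets_mono')
    finally show "sets borel \<subseteq> sigma_sets UNIV E" .
    show "sigma_sets UNIV E \<subseteq> sets borel"
      using openE by (intro sets.sigma_sets_subset'[of _ borel, simplified]) auto
  qed
  define A where "A = from_nat_into E"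
  have A_in: "A j \<in> E" for j unfolding A_def using UE by (intro from_nat_into) auto
  have A_surj: "\<exists>j. A j = a" if "a \<in> E" for a
    unfolding A_def using from_nat_into_surj[OF cE that] by auto
  have A_borel: "A j \<in> sets borel" for j using A_in openE by auto
  define X where "X n p = (case from_nat n of (c, j, N) \<Rightarrow>
     \<integral>x. u c p x * indicator (A j \<inter> ball 0 (real (N::nat))) x \<partial>lborel)" for n p
  have "\<exists>C. \<forall>p. \<bar>X n p\<bar> \<le> C" for n
  proof -
    obtain c j N where n: "from_nat n = (c::'i, j::nat, N::nat)" by (metis prod_cases3)
    have fin: "emeasure lborel (A j \<inter> ball (0::'a) N) < \<infinity>"
      using emeasure_mono[of "A j \<inter> ball 0 N" "ball 0 N" "lborel :: 'a measure"] emeasure_lborel_ball_finite[of "0::'a" N]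
      by (auto intro: le_less_trans)
    define f :: "'a \<Rightarrow> real" where "f = indicator (A j \<inter> ball 0 N)"
    have f: "sqint lborel f" unfolding f_def using A_borel fin by (intro sqint_indicator) auto
    have "\<bar>X n p\<bar> \<le> sqrt (B * (sqn lborel f))" for p
    proof -
      have "\<bar>X n p\<bar> \<le> sqrt ((sqn lborel (u c p)) * (sqn lborel f))"
        unfolding X_def n f_def[symmetric] prod.case by (intro abs_integral_mult_le u f)
      also have "\<dots> \<le> sqrt (B * (sqn lborel f))"
        by (intro real_sqrt_le_mono mult_right_mono B) simp
      finally show ?thesis .
    qed
    then show ?thesis by blast
  qed
  then obtain C where C: "\<And>n p. \<bar>X n p\<bar> \<le> C n" by metis
  interpret D: subseqs "\<lambda>n s. convergent (\<lambda>p. X n (s p))"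
  proof
    fix n and s :: "nat \<Rightarrow> nat" assume "strict_mono s"
    have "X n (s p) \<in> {- C n..C n}" for p using C[of n "s p"] by (simp add: abs_le_iff)
    with compact_Icc[of "- C n" "C n"]
    obtain l r where "strict_mono r" "((\<lambda>p. X n (s p)) \<circ> r) \<longlonglongrightarrow> l"
      unfolding compact_def by metis
    then show "\<exists>r'. strict_mono r' \<and> convergent (\<lambda>p. X n ((s \<circ> r') p))"
      by (intro exI[of _ r]) (auto simp: convergent_def o_def)
  qed
  have conv: "convergent (\<lambda>p. X n (D.diagseq p))" for n
  proof -
    \<comment> \<open>The diagonal sequence refines the \<open>n\<close>-th extraction only from
      index \<open>Suc n\<close> on, so convergence is obtained for a tail first.\<close>
    have "convergent (\<lambda>p. X n ((D.diagseq \<circ> ((+) (Suc n))) p))"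
    proof (rule D.diagseq_holds)
      fix r s :: "nat \<Rightarrow> nat" and n
      assume "strict_mono r" "convergent (\<lambda>p. X n (s p))"
      then show "convergent (\<lambda>p. X n ((s \<circ> r) p))"
        using convergent_subseq_convergent[of "\<lambda>p. X n (s p)" r] by (simp add: o_def)
    qed
    then have "convergent (\<lambda>p. X n (D.diagseq (p + Suc n)))" by (simp add: o_def add.commute)
    then show ?thesis by (rule convergent_subseq_tail)
  qed
  show ?thesis
  proof (rule that[OF D.subseq_diagseq])
    fix c
    show "wcauchy (\<lambda>p. u c (D.diagseq p))"
    proof (rule wcauchy_from_sets[OF u B IE SE UE])
      fix a N assume "a \<in> E"
      then obtain j where j: "A j = a" using A_surj by blast
      show "convergent (\<lambda>p. \<integral>x. u c (D.diagseq p) x * indicator (a \<inter> ball 0 (real N)) x \<partial>lborel)"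
        using conv[of "to_nat (c, j, N)"] by (simp add: X_def j)
    qed
  qed
qed

subsection \<open>Operators of Schur type\<close>

text \<open>An integral operator parametrised by points rather than by a density:
  \<open>\<eta>\<close> says where \<open>f\<close> is evaluated and \<open>b\<close> with what
  weight. The usual kernel at \<open>x\<close> would be the image under \<open>\<eta>\<close> of the
  measure with density \<open>b\<close> on \<open>Y\<close>.\<close>

definition Top :: "'y measure \<Rightarrow> ('a \<times> 'y \<Rightarrow> 'a) \<Rightarrow> ('a \<times> 'y \<Rightarrow> real) \<Rightarrow> ('a \<Rightarrow> real) \<Rightarrow> 'a \<Rightarrow> real" where
  "Top Y \<eta> b f x = (\<integral>y. f (\<eta> (x, y)) * b (x, y) \<partial>Y)"

text \<open>Hypotheses of Schur's test, with row bound \<open>A1\<close>. Without an explicit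
  density the column bound \<open>A2\<close> reads: the image under \<open>\<eta>\<close> of the
  measure with density \<open>b\<close> on the product is at most \<open>A2\<close> times Lebesgue
  measure.\<close>

locale schur =
  fixes Y :: "'y measure" and \<eta> :: "'a::euclidean_space \<times> 'y \<Rightarrow> 'a" and b :: "'a \<times> 'y \<Rightarrow> real" and A1 A2 :: real
  assumes Y: "sigma_finite_measure Y"
    and eta_meas [measurable]: "\<eta> \<in> borel \<Otimes>\<^sub>M Y \<rightarrow>\<^sub>M borel"
    and b_meas [measurable]: "b \<in> borel_measurable (borel \<Otimes>\<^sub>M Y)"
    and b_nonneg: "\<And>p. 0 \<le> b p"
    and A_nonneg: "0 \<le> A1" "0 \<le> A2"
    and row: "\<And>x. (\<integral>\<^sup>+y. ennreal (b (x, y)) \<partial>Y) \<le> ennreal A1"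
    and col: "\<And>f. f \<in> borel_measurable borel \<Longrightarrow>
      (\<integral>\<^sup>+x. \<integral>\<^sup>+y. f (\<eta> (x, y)) * ennreal (b (x, y)) \<partial>Y \<partial>lborel) \<le> ennreal A2 * (\<integral>\<^sup>+x. f x \<partial>lborel)"
begin

sublocale Y: sigma_finite_measure Y by (rule Y)

abbreviation "T \<equiv> Top Y \<eta> b"
abbreviation "absT f x \<equiv> \<integral>\<^sup>+y. ennreal \<bar>f (\<eta> (x, y)) * b (x, y)\<bar> \<partial>Y"

lemma eta_meas' [measurable]: "\<eta> \<in> lborel \<Otimes>\<^sub>M Y \<rightarrow>\<^sub>M borel"
  and b_meas' [measurable]: "b \<in> borel_measurable (lborel \<Otimes>\<^sub>M Y)"
  by measurable

lemma eta_meas_Y [measurable]: "(\<lambda>y. \<eta> (x, y)) \<in> Y \<rightarrow>\<^sub>M borel"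
  and b_meas_Y [measurable]: "(\<lambda>y. b (x, y)) \<in> borel_measurable Y"
  by measurable

lemma absint_meas:
  assumes [measurable]: "f \<in> borel_measurable borel"
  shows "absT f \<in> borel_measurable borel"
  by measurable

lemma T_meas:
  assumes [measurable]: "f \<in> borel_measurable borel"
  shows "T f \<in> borel_measurable borel"
  unfolding Top_def by measurable

text \<open>Write \<open>b\<close> as a product of two square roots and apply Cauchy-Schwarz in
  \<open>y\<close>; the row bound takes one factor and, after integration in \<open>x\<close>, the
  column bound takes the other. The estimate is for absolute values, so that it also yields
  integrability for almost every \<open>x\<close>.\<close>

lemma schur_bound:
  assumes f: "sqint lborel f"
  shows "(\<integral>\<^sup>+x. (absT f x)\<^sup>2 \<partial>lborel)
    \<le> ennreal (A1 * A2 * (sqn lborel f))"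
proof -
  have [measurable]: "f \<in> borel_measurable borel" using sqint_measurable[OF f] by simp
  have pt: "(absT f x)\<^sup>2
     \<le> ennreal A1 * (\<integral>\<^sup>+y. ennreal ((f (\<eta> (x, y)))\<^sup>2) * ennreal (b (x, y)) \<partial>Y)" for x
  proof -
    have "absT f x
      = (\<integral>\<^sup>+y. ennreal (\<bar>f (\<eta> (x, y))\<bar> * sqrt (b (x, y))) * ennreal (sqrt (b (x, y))) \<partial>Y)"
      using b_nonneg by (intro nn_integral_cong) (simp add: ennreal_mult[symmetric] abs_mult mult.assoc)
    also have "\<dots>\<^sup>2 \<le> (\<integral>\<^sup>+y. (ennreal (\<bar>f (\<eta> (x, y))\<bar> * sqrt (b (x, y))))\<^sup>2 \<partial>Y) * (\<integral>\<^sup>+y. (ennreal (sqrt (b (x, y))))\<^sup>2 \<partial>Y)"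
      by (rule Cauchy_Schwarz_nn_integral) measurable
    also have "(\<integral>\<^sup>+y. (ennreal (sqrt (b (x, y))))\<^sup>2 \<partial>Y) = (\<integral>\<^sup>+y. ennreal (b (x, y)) \<partial>Y)"
      using b_nonneg by (intro nn_integral_cong) (simp add: ennreal_power)
    also have "(\<integral>\<^sup>+y. (ennreal (\<bar>f (\<eta> (x, y))\<bar> * sqrt (b (x, y))))\<^sup>2 \<partial>Y)
      = (\<integral>\<^sup>+y. ennreal ((f (\<eta> (x, y)))\<^sup>2) * ennreal (b (x, y)) \<partial>Y)"
      using b_nonneg by (intro nn_integral_cong) (simp add: ennreal_power power_mult_distrib ennreal_mult[symmetric])
    also have "(\<integral>\<^sup>+y. ennreal ((f (\<eta> (x, y)))\<^sup>2) * ennreal (b (x, y)) \<partial>Y) * (\<integral>\<^sup>+y. ennreal (b (x, y)) \<partial>Y)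
      \<le> (\<integral>\<^sup>+y. ennreal ((f (\<eta> (x, y)))\<^sup>2) * ennreal (b (x, y)) \<partial>Y) * ennreal A1"
      by (intro mult_left_mono row) simp
    finally show ?thesis by (simp add: mult.commute)
  qed
  have "(\<integral>\<^sup>+x. (absT f x)\<^sup>2 \<partial>lborel)
    \<le> (\<integral>\<^sup>+x. ennreal A1 * (\<integral>\<^sup>+y. ennreal ((f (\<eta> (x, y)))\<^sup>2) * ennreal (b (x, y)) \<partial>Y) \<partial>lborel)"
    by (intro nn_integral_mono pt)
  also have "\<dots> = ennreal A1 * (\<integral>\<^sup>+x. \<integral>\<^sup>+y. ennreal ((f (\<eta> (x, y)))\<^sup>2) * ennreal (b (x, y)) \<partial>Y \<partial>lborel)"
    by (intro nn_integral_cmult) measurable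
  also have "\<dots> \<le> ennreal A1 * (ennreal A2 * (\<integral>\<^sup>+x. ennreal ((f x)\<^sup>2) \<partial>lborel))"
    by (intro mult_left_mono col[of "\<lambda>x. ennreal ((f x)\<^sup>2)"]) auto
  also have "\<dots> = ennreal (A1 * A2 * (sqn lborel f))"
    using A_nonneg by (simp add: nn_integral_sqint[OF f] ennreal_mult[symmetric] mult.assoc)
  finally show ?thesis .
qed

lemma AE_integrable:
  assumes f: "sqint lborel f"
  shows "AE x in lborel. integrable Y (\<lambda>y. f (\<eta> (x, y)) * b (x, y))"
proof -
  have [measurable]: "f \<in> borel_measurable borel" using sqint_measurable[OF f] by simp
  note absint_meas[measurable]
  have "AE x in lborel. (absT f x)\<^sup>2 \<noteq> \<infinity>"
    using schur_bound[OF f] by (intro nn_integral_PInf_AE) (auto simp: top_unique)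
  then show ?thesis
  proof eventually_elim
    case (elim x)
    then show ?case
      by (intro integrableI_bounded) (auto simp: power_eq_top_ennreal less_top)
  qed
qed

lemma abs_T_le: "ennreal \<bar>T f x\<bar> \<le> absT f x"
proof (cases "integrable Y (\<lambda>y. f (\<eta> (x, y)) * b (x, y))")
  case True
  then show ?thesis using integral_norm_bound_ennreal[OF True] by (simp add: Top_def)
qed (simp add: Top_def not_integrable_integral_eq)

lemma sqint_T:
  assumes f: "sqint lborel f"
  shows "sqint lborel (T f)"
    and "(sqn lborel (T f)) \<le> A1 * A2 * (sqn lborel f)"
proof -
  have fm: "f \<in> borel_measurable borel" using sqint_measurable[OF f] by simp
  have "(\<integral>\<^sup>+x. ennreal ((T f x)\<^sup>2) \<partial>lborel)
    \<le> (\<integral>\<^sup>+x. (absT f x)\<^sup>2 \<partial>lborel)"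
  proof (rule nn_integral_mono)
    fix x
    have "ennreal ((T f x)\<^sup>2) = (ennreal \<bar>T f x\<bar>)\<^sup>2" by (simp add: ennreal_power)
    also have "\<dots> \<le> (absT f x)\<^sup>2"
      by (intro power_mono abs_T_le) simp
    finally show "ennreal ((T f x)\<^sup>2) \<le> \<dots>" .
  qed
  also note schur_bound[OF f]
  finally have le: "(\<integral>\<^sup>+x. ennreal ((T f x)\<^sup>2) \<partial>lborel) \<le> ennreal (A1 * A2 * (sqn lborel f))" .
  then show s: "sqint lborel (T f)"
    using T_meas[OF fm] unfolding sqint_iff_nn by (auto intro: le_less_trans)
  have "0 \<le> A1 * A2 * (sqn lborel f)" using A_nonneg by simp
  then show "(sqn lborel (T f)) \<le> A1 * A2 * (sqn lborel f)"
    using le unfolding nn_integral_sqint[OF s] by (simp add: ennreal_le_iff)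
qed

lemma T_diff:
  assumes f: "sqint lborel f" and g: "sqint lborel g"
  shows "AE x in lborel. T (\<lambda>x. f x - g x) x = T f x - T g x"
  using AE_integrable[OF f] AE_integrable[OF g]
  by eventually_elim (simp add: Top_def left_diff_distrib)

text \<open>For a given \<open>x\<close> the points \<open>\<eta> (x, y)\<close> might lie in the
  exceptional null set with positive weight; that almost no \<open>x\<close> is affected follows
  from the norm bound applied to \<open>f - g\<close>.\<close>

lemma T_cong_AE:
  assumes f: "sqint lborel f" and g: "sqint lborel g" and "AE x in lborel. f x = g x"
  shows "AE x in lborel. T f x = T g x"
proof -
  note d = sqint_diff(1)[OF f g]
  have "(sqn lborel (\<lambda>x. f x - g x)) = (\<integral>x. 0 \<partial>(lborel :: 'a measure))"
    using assms(3) f g by (intro integral_cong_AE) (auto simp: sqint_def)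
  then have "(sqn lborel (\<lambda>x. T (\<lambda>x. f x - g x) x)) = 0"
    using sqint_T(2)[OF d] by (intro antisym) auto
  then have "AE x in lborel. (T (\<lambda>x. f x - g x) x)\<^sup>2 = 0"
    using sqint_integrable[OF sqint_T(1)[OF d]] by (subst (asm) integral_nonneg_eq_0_iff_AE) auto
  with T_diff[OF f g] show ?thesis by eventually_elim simp
qed

text \<open>Schur's bound for absolute values makes the pairing an absolutely convergent integral
  over the product, so that Fubini's theorem applies to signed functions.\<close>

lemma integrable_pairing:
  assumes f: "sqint lborel f" and g: "sqint lborel g"
  shows "integrable (lborel \<Otimes>\<^sub>M Y) (\<lambda>(x, y). g x * (f (\<eta> (x, y)) * b (x, y)))"
proof -
  have [measurable]: "f \<in> borel_measurable borel" "g \<in> borel_measurable borel"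
    using sqint_measurable[OF f] sqint_measurable[OF g] by simp_all
  note absint_meas[measurable]
  let ?F = "absT f"
  have "(\<integral>\<^sup>+p. ennreal (norm (case p of (x, y) \<Rightarrow> g x * (f (\<eta> (x, y)) * b (x, y)))) \<partial>(lborel \<Otimes>\<^sub>M Y))
    = (\<integral>\<^sup>+x. \<integral>\<^sup>+y. ennreal \<bar>g x\<bar> * ennreal \<bar>f (\<eta> (x, y)) * b (x, y)\<bar> \<partial>Y \<partial>lborel)"
    by (subst Y.nn_integral_fst[symmetric]) (auto simp: abs_mult ennreal_mult[symmetric])
  also have "\<dots> = (\<integral>\<^sup>+x. ennreal \<bar>g x\<bar> * ?F x \<partial>lborel)"
    by (intro nn_integral_cong nn_integral_cmult) measurable
  finally have eq: "(\<integral>\<^sup>+p. ennreal (norm (case p of (x, y) \<Rightarrow> g x * (f (\<eta> (x, y)) * b (x, y)))) \<partial>(lborel \<Otimes>\<^sub>M Y))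
     = (\<integral>\<^sup>+x. ennreal \<bar>g x\<bar> * ?F x \<partial>lborel)" .
  have "(\<integral>\<^sup>+x. ennreal \<bar>g x\<bar> * ?F x \<partial>lborel)\<^sup>2 \<le> (\<integral>\<^sup>+x. (ennreal \<bar>g x\<bar>)\<^sup>2 \<partial>lborel) * (\<integral>\<^sup>+x. (?F x)\<^sup>2 \<partial>lborel)"
    by (rule Cauchy_Schwarz_nn_integral) measurable
  also have "\<dots> \<le> ennreal (sqn lborel g) * ennreal (A1 * A2 * (sqn lborel f))"
    by (intro mult_mono schur_bound f) (simp_all add: ennreal_power nn_integral_sqint[OF g])
  also have "\<dots> < \<infinity>" by (simp add: ennreal_mult_less_top)
  finally have "(\<integral>\<^sup>+x. ennreal \<bar>g x\<bar> * ?F x \<partial>lborel) < \<infinity>"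
    by (simp add: power_less_top_ennreal)
  then show ?thesis
    unfolding integrable_iff_bounded eq by simp
qed

lemma pairing_eq:
  assumes f: "sqint lborel f" and g: "sqint lborel g"
  shows "(\<integral>x. T f x * g x \<partial>lborel) = (\<integral>p. (case p of (x, y) \<Rightarrow> g x * (f (\<eta> (x, y)) * b (x, y))) \<partial>(lborel \<Otimes>\<^sub>M Y))"
proof -
  interpret pair_sigma_finite "lborel :: 'a measure" Y by unfold_locales
  have "(\<integral>p. (case p of (x, y) \<Rightarrow> g x * (f (\<eta> (x, y)) * b (x, y))) \<partial>(lborel \<Otimes>\<^sub>M Y))
    = (\<integral>x. \<integral>y. g x * (f (\<eta> (x, y)) * b (x, y)) \<partial>Y \<partial>lborel)"
    using integral_fst'[OF integrable_pairing[OF f g]] by simp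
  then show ?thesis by (simp add: Top_def mult.commute)
qed

end

text \<open>The equation \<open>eq\<close> says that two measures on pairs of points coincide after
  transposition. It speaks of nonnegative \<open>F\<close>; signed integrands are recovered from
  their positive and negative parts.\<close>

lemma schur_adjoint:
  assumes "schur Y \<eta> b A1 A2" "schur Z \<zeta> d B1 B2"
    and eq: "\<And>F. F \<in> borel_measurable (borel \<Otimes>\<^sub>M borel) \<Longrightarrow>
      (\<integral>\<^sup>+x. \<integral>\<^sup>+y. F (x, \<eta> (x, y)) * ennreal (b (x, y)) \<partial>Y \<partial>lborel)
      = (\<integral>\<^sup>+x. \<integral>\<^sup>+z. F (\<zeta> (x, z), x) * ennreal (d (x, z)) \<partial>Z \<partial>lborel)"
    and f: "sqint lborel f" and g: "sqint lborel g"
  shows "(\<integral>x. Top Y \<eta> b f x * g x \<partial>lborel) = (\<integral>x. f x * Top Z \<zeta> d g x \<partial>lborel)"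
proof -
  interpret b: schur Y \<eta> b A1 A2 by fact
  interpret d: schur Z \<zeta> d B1 B2 by fact
  have [measurable]: "f \<in> borel_measurable borel" "g \<in> borel_measurable borel"
    using sqint_measurable[OF f] sqint_measurable[OF g] by simp_all
  \<comment> \<open>Since \<open>ennreal\<close> sends negative reals to 0, \<open>c = 1\<close> and
    \<open>c = -1\<close> select the positive and the negative part.\<close>
  have key: "(\<integral>\<^sup>+p. ennreal (c * (case p of (x, y) \<Rightarrow> g x * (f (\<eta> (x, y)) * b (x, y)))) \<partial>(lborel \<Otimes>\<^sub>M Y))
    = (\<integral>\<^sup>+p. ennreal (c * (case p of (x, y) \<Rightarrow> f x * (g (\<zeta> (x, y)) * d (x, y)))) \<partial>(lborel \<Otimes>\<^sub>M Z))" for c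
  proof -
    have "(\<integral>\<^sup>+p. ennreal (c * (case p of (x, y) \<Rightarrow> g x * (f (\<eta> (x, y)) * b (x, y)))) \<partial>(lborel \<Otimes>\<^sub>M Y))
      = (\<integral>\<^sup>+x. \<integral>\<^sup>+y. ennreal (c * (g x * f (\<eta> (x, y)))) * ennreal (b (x, y)) \<partial>Y \<partial>lborel)"
      by (subst b.Y.nn_integral_fst[symmetric]) (auto simp: ennreal_mult''[symmetric] b.b_nonneg mult.assoc)
    also have "\<dots> = (\<integral>\<^sup>+x. \<integral>\<^sup>+z. ennreal (c * (g (\<zeta> (x, z)) * f x)) * ennreal (d (x, z)) \<partial>Z \<partial>lborel)"
      using eq[of "\<lambda>(x, y). ennreal (c * (g x * f y))"] by simp
    also have "\<dots> = (\<integral>\<^sup>+p. ennreal (c * (case p of (x, y) \<Rightarrow> f x * (g (\<zeta> (x, y)) * d (x, y)))) \<partial>(lborel \<Otimes>\<^sub>M Z))"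
      by (subst d.Y.nn_integral_fst[symmetric]) (auto simp: ennreal_mult''[symmetric] ennreal_mult'[symmetric] d.b_nonneg mult_ac)
    finally show ?thesis .
  qed
  have "(\<integral>x. Top Y \<eta> b f x * g x \<partial>lborel) = (\<integral>x. Top Z \<zeta> d g x * f x \<partial>lborel)"
    unfolding b.pairing_eq[OF f g] d.pairing_eq[OF g f]
      real_lebesgue_integral_def[OF b.integrable_pairing[OF f g]]
      real_lebesgue_integral_def[OF d.integrable_pairing[OF g f]]
    using key[of 1] key[of "-1"] by simp
  then show ?thesis by (simp add: mult.commute)
qed

text \<open>A positive functional that is bounded in the square norm has a square-integrable density
  (Radon--Nikodym), hence maps weakly Cauchy sequences to convergent ones.\<close>

lemma wcauchy_functional:
  fixes \<eta> :: "'y \<Rightarrow> 'a::euclidean_space"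
  assumes [measurable]: "\<eta> \<in> Y \<rightarrow>\<^sub>M borel" "b \<in> borel_measurable Y" and b0: "\<And>y. 0 \<le> b y"
    and c: "0 \<le> c"
    and bound: "\<And>f. sqint lborel f \<Longrightarrow>
      (\<integral>\<^sup>+y. ennreal \<bar>f (\<eta> y) * b y\<bar> \<partial>Y)\<^sup>2 \<le> ennreal (c * (sqn lborel f))"
    and u: "wcauchy u"
  shows "convergent (\<lambda>p. \<integral>y. u p (\<eta> y) * b y \<partial>Y)"
proof -
  define \<nu> where "\<nu> = distr (density Y (\<lambda>y. ennreal (b y))) borel \<eta>"
  have nn: "(\<integral>\<^sup>+x. ennreal (f x) \<partial>\<nu>) = (\<integral>\<^sup>+y. ennreal \<bar>f (\<eta> y) * b y\<bar> \<partial>Y)"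
    if [measurable]: "f \<in> borel_measurable borel" and f0: "\<And>x. 0 \<le> f x" for f :: "'a \<Rightarrow> real"
    unfolding \<nu>_def using f0 b0
    by (simp add: nn_integral_distr nn_integral_density ennreal_mult[symmetric] mult.commute)
  \<comment> \<open>The indicator of a null set has square norm 0, so the bound makes the set null
    for \<open>\<nu>\<close> as well.\<close>
  have "absolutely_continuous lborel \<nu>"
    unfolding absolutely_continuous_def
  proof
    fix N :: "'a set" assume N: "N \<in> null_sets lborel"
    then have [measurable]: "N \<in> sets borel" by auto
    have s: "sqint lborel (indicator N :: 'a \<Rightarrow> real)"
      using N by (intro sqint_indicator) auto
    have "(\<lambda>x. (indicator N x :: real)\<^sup>2) = indicator N" by (auto simp: indicator_def)
    then have "(sqn lborel (\<lambda>x. indicator N x :: real)) = 0"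
      using N by (simp add: measure_def null_setsD1)
    then have "(\<integral>\<^sup>+x. ennreal (indicator N x) \<partial>\<nu>)\<^sup>2 \<le> 0"
      using bound[OF s] by (subst nn) auto
    then have "emeasure \<nu> N = 0"
      by (simp add: ennreal_indicator \<nu>_def)
    then show "N \<in> null_sets \<nu>" by (auto simp: \<nu>_def)
  qed
  then obtain h where h[measurable]: "h \<in> borel_measurable borel" and \<nu>: "density lborel h = \<nu>"
    using sigma_finite_measure.Radon_Nikodym[OF sigma_finite_lborel, of \<nu>] by (auto simp: \<nu>_def)
  \<comment> \<open>The density \<open>h\<close> is not yet known to be square integrable; its
    truncations in height and in space are, and the bound can be applied to them.\<close>
  define f where "f n x = enn2real (min (h x) (of_nat n)) * indicator (ball 0 (real n)) x" for n x
  have fm[measurable]: "f n \<in> borel_measurable borel" for n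
    unfolding f_def by measurable
  have min_lt: "min (h x) (of_nat n) < top" for x and n :: nat
    by (metis ennreal_less_top ennreal_of_nat_eq_real_of_nat min_less_iff_disj)
  have f_le_n: "0 \<le> f n x" "f n x \<le> real n" for n x
  proof -
    have "enn2real (min (h x) (of_nat n)) \<le> enn2real (of_nat n)"
      by (intro enn2real_mono of_nat_less_top) auto
    then show "0 \<le> f n x" "f n x \<le> real n" by (auto simp: f_def indicator_def)
  qed
  have ef: "ennreal (f n x) = min (h x) (of_nat n) * indicator (ball 0 (real n)) x" for n x
    unfolding f_def using min_lt by (auto simp: indicator_def)
  have fs: "sqint lborel (f n)" for n
  proof (rule sqint_bound[where c="real n"])
    show "sqint lborel (indicator (ball 0 (real n)) :: 'a \<Rightarrow> real)"
      using emeasure_lborel_ball_finite[of "0::'a" "real n"] by (intro sqint_indicator) auto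
    show "\<bar>f n x\<bar> \<le> real n * \<bar>indicator (ball 0 (real n)) x\<bar>" for x
      using f_le_n[of n x] by (auto simp: f_def indicator_def)
  qed simp
  \<comment> \<open>The functional is tested with the truncation of its own density: the square norm
    \<open>?I\<close> of \<open>f n\<close> is at most the value of the functional at
    \<open>f n\<close>, whence \<open>?I^2 \<le> c * ?I\<close>.\<close>
  have fb: "(sqn lborel (f n)) \<le> c" for n
  proof -
    let ?I = "\<integral>x. (f n x)\<^sup>2 \<partial>lborel"
    have "ennreal ?I = (\<integral>\<^sup>+x. ennreal ((f n x)\<^sup>2) \<partial>lborel)"
      by (rule nn_integral_sqint[OF fs, symmetric])
    also have "\<dots> \<le> (\<integral>\<^sup>+x. h x * ennreal (f n x) \<partial>lborel)"
    proof (rule nn_integral_mono)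
      fix x
      have "ennreal ((f n x)\<^sup>2) = ennreal (f n x) * ennreal (f n x)"
        using f_le_n[of n x] by (simp add: power2_eq_square ennreal_mult)
      also have "\<dots> \<le> h x * ennreal (f n x)"
        by (intro mult_right_mono) (auto simp: ef indicator_def)
      finally show "ennreal ((f n x)\<^sup>2) \<le> h x * ennreal (f n x)" .
    qed
    also have "\<dots> = (\<integral>\<^sup>+x. ennreal (f n x) \<partial>\<nu>)"
      unfolding \<nu>[symmetric] by (simp add: nn_integral_density)
    also have "\<dots> = (\<integral>\<^sup>+y. ennreal \<bar>f n (\<eta> y) * b y\<bar> \<partial>Y)"
      using f_le_n by (intro nn) auto
    finally have "(ennreal ?I)\<^sup>2 \<le> (\<integral>\<^sup>+y. ennreal \<bar>f n (\<eta> y) * b y\<bar> \<partial>Y)\<^sup>2"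
      by (intro power_mono) auto
    also have "\<dots> \<le> ennreal (c * ?I)" by (rule bound[OF fs])
    finally have "?I\<^sup>2 \<le> c * ?I"
      using c by (simp add: ennreal_power ennreal_le_iff)
    then have "?I * ?I \<le> c * ?I" by (simp add: power2_eq_square)
    moreover have "0 \<le> ?I" by simp
    ultimately show ?thesis using c by (cases "?I = 0") auto
  qed
  have "(\<integral>\<^sup>+x. (h x)\<^sup>2 \<partial>lborel) \<le> (\<integral>\<^sup>+x. liminf (\<lambda>n. ennreal ((f n x)\<^sup>2)) \<partial>lborel)"
  proof (rule nn_integral_mono)
    fix x
    show "(h x)\<^sup>2 \<le> liminf (\<lambda>n. ennreal ((f n x)\<^sup>2))"
    proof (rule le_Liminf_iff[THEN iffD2], intro allI impI)
      fix y assume y: "y < (h x)\<^sup>2"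
      have "(\<lambda>n. min (h x) (of_nat n)) \<longlonglongrightarrow> min (h x) top"
        by (intro tendsto_min tendsto_const of_nat_tendsto_top_ennreal)
      then have "(\<lambda>n. min (h x) (of_nat n)) \<longlonglongrightarrow> h x" by simp
      from tendsto_mult_ennreal[OF this this]
      have "(\<lambda>n. (min (h x) (of_nat n))\<^sup>2) \<longlonglongrightarrow> (h x)\<^sup>2"
        by (auto simp: power2_eq_square)
      then have "\<forall>\<^sub>F n in sequentially. y < (min (h x) (of_nat n))\<^sup>2"
        using y by (rule order_tendstoD(1))
      moreover obtain N :: nat where "norm x < real N" using reals_Archimedean2 by blast
      then have "\<forall>\<^sub>F n in sequentially. x \<in> ball 0 (real n)"
        by (intro eventually_sequentiallyI[of N]) auto
      ultimately show "\<forall>\<^sub>F n in sequentially. y < ennreal ((f n x)\<^sup>2)"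
      proof eventually_elim
        case (elim n)
        have "ennreal ((f n x)\<^sup>2) = (ennreal (f n x))\<^sup>2" using f_le_n by (simp add: ennreal_power)
        then show ?case using elim by (simp add: ef)
      qed
    qed
  qed
  also have "\<dots> \<le> liminf (\<lambda>n. \<integral>\<^sup>+x. ennreal ((f n x)\<^sup>2) \<partial>lborel)"
    by (rule nn_integral_liminf) measurable
  also have "\<dots> \<le> ennreal c"
    by (intro Liminf_le) (auto simp: nn_integral_sqint[OF fs] fb ennreal_leI)
  finally have hb: "(\<integral>\<^sup>+x. (h x)\<^sup>2 \<partial>lborel) \<le> ennreal c" .
  then have "AE x in lborel. (h x)\<^sup>2 \<noteq> \<infinity>"
    by (intro nn_integral_PInf_AE) (auto simp: top_unique)
  then have h_eq: "AE x in lborel. h x = ennreal (enn2real (h x))"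
    by eventually_elim (simp add: power_eq_top_ennreal less_top)
  define \<psi> where "\<psi> x = enn2real (h x)" for x
  have [measurable]: "\<psi> \<in> borel_measurable borel" unfolding \<psi>_def by measurable
  have "(\<integral>\<^sup>+x. ennreal ((\<psi> x)\<^sup>2) \<partial>lborel) = (\<integral>\<^sup>+x. (h x)\<^sup>2 \<partial>lborel)"
  proof (rule nn_integral_cong_AE, use h_eq in eventually_elim)
    fix x assume "h x = ennreal (enn2real (h x))"
    then show "ennreal ((\<psi> x)\<^sup>2) = (h x)\<^sup>2" by (metis \<psi>_def enn2real_nonneg ennreal_power)
  qed
  then have \<psi>: "sqint lborel \<psi>"
    unfolding sqint_iff_nn using hb by (auto intro: le_less_trans)
  have \<nu>': "\<nu> = density lborel (\<lambda>x. ennreal (\<psi> x))"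
    unfolding \<nu>[symmetric] using h_eq by (intro density_cong) (auto simp: \<psi>_def)
  have "(\<integral>y. u p (\<eta> y) * b y \<partial>Y) = (\<integral>x. u p x * \<psi> x \<partial>lborel)" for p
  proof -
    have [measurable]: "u p \<in> borel_measurable borel"
      using u by (auto simp: wcauchy_def sqint_def)
    have "(\<integral>y. u p (\<eta> y) * b y \<partial>Y) = (\<integral>x. u p x \<partial>\<nu>)"
      unfolding \<nu>_def using b0 by (simp add: integral_distr integral_density mult.commute)
    also have "\<dots> = (\<integral>x. u p x * \<psi> x \<partial>lborel)"
      unfolding \<nu>' by (subst integral_density) (auto simp: \<psi>_def mult.commute)
    finally show ?thesis .
  qed
  then show ?thesis using u \<psi> by (simp add: wcauchy_def)
qed

text \<open>On the truncated part the images of a weakly Cauchy sequence converge pointwise and are dominated by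
  a multiple of the indicator of a ball, hence converge in the square norm.\<close>

lemma schur_compact:
  fixes \<eta> :: "'a::euclidean_space \<times> 'y \<Rightarrow> 'a"
  assumes "schur Y \<eta> b A1 A2"
    and trunc: "\<And>e. e > 0 \<Longrightarrow> \<exists>G\<in>sets (borel \<Otimes>\<^sub>M Y). \<exists>c\<ge>0. \<exists>R.
        (\<forall>x. (\<integral>\<^sup>+y. ennreal (b (x, y) * indicator (- G) (x, y)) \<partial>Y) \<le> ennreal e) \<and>
        (\<forall>x f. sqint lborel f \<longrightarrow> (\<integral>\<^sup>+y. ennreal \<bar>f (\<eta> (x, y)) * (b (x, y) * indicator G (x, y))\<bar> \<partial>Y)\<^sup>2
          \<le> ennreal (c * indicator (ball 0 R) x * (sqn lborel f)))"
    and u: "wcauchy u"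
  shows "l2cauchy lborel (\<lambda>p. Top Y \<eta> b (u p))"
  unfolding l2cauchy_def
proof (intro allI impI)
  fix e :: real assume e: "e > 0"
  interpret b: schur Y \<eta> b A1 A2 by fact
  obtain B where B: "\<And>p. (sqn lborel (u p)) \<le> B" and us: "\<And>p. sqint lborel (u p)"
    using u by (auto simp: wcauchy_def)
  have B0: "B \<ge> 0" using B[of 0] by (rule order_trans[rotated]) simp
  \<comment> \<open>The remainder acts on differences \<open>u p - u q\<close> of square norm at
    most \<open>4 * B\<close> and so contributes at most
    \<open>d * A2 * (4 * B) \<le> e / 4\<close>; the added 1s keep the denominator positive.\<close>
  define d where "d = e / (16 * (A2 + 1) * (B + 1))"
  have d: "d > 0" using e B0 b.A_nonneg by (simp add: d_def)
  obtain G c R where [measurable]: "G \<in> sets (borel \<Otimes>\<^sub>M Y)" and c: "c \<ge> 0"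
    and small: "\<And>x. (\<integral>\<^sup>+y. ennreal (b (x, y) * indicator (- G) (x, y)) \<partial>Y) \<le> ennreal d"
    and bound: "\<And>x f. sqint lborel f \<Longrightarrow> (\<integral>\<^sup>+y. ennreal \<bar>f (\<eta> (x, y)) * (b (x, y) * indicator G (x, y))\<bar> \<partial>Y)\<^sup>2
          \<le> ennreal (c * indicator (ball 0 R) x * (sqn lborel f))"
    using trunc[OF d] by blast
  define b1 where "b1 p = b p * indicator G p" for p
  define b2 where "b2 p = b p * indicator (- G) p" for p
  have b1_le: "0 \<le> b1 p" "b1 p \<le> b p" and b2_le: "0 \<le> b2 p" "b2 p \<le> b p" for p
    using b.b_nonneg[of p] by (auto simp: b1_def b2_def indicator_def)
  have b2G: "b2 p = b p * (1 - indicator G p)" for p by (simp add: b2_def indicator_def)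
  have [measurable]: "b1 \<in> borel_measurable (borel \<Otimes>\<^sub>M Y)" "b2 \<in> borel_measurable (borel \<Otimes>\<^sub>M Y)"
    unfolding b1_def[abs_def] b2G[abs_def] by measurable
  have col': "(\<integral>\<^sup>+x. \<integral>\<^sup>+y. f (\<eta> (x, y)) * ennreal (b' (x, y)) \<partial>Y \<partial>lborel) \<le> ennreal A2 * (\<integral>\<^sup>+x. f x \<partial>lborel)"
    if "f \<in> borel_measurable borel" "\<And>p. b' p \<le> b p" for f b'
    by (rule order_trans[OF _ b.col[OF that(1)]]) (intro nn_integral_mono mult_left_mono ennreal_leI that(2), simp)
  interpret b1: schur Y \<eta> b1 A1 A2
  proof
    show "(\<integral>\<^sup>+y. ennreal (b1 (x, y)) \<partial>Y) \<le> ennreal A1" for x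
      by (rule order_trans[OF nn_integral_mono[OF ennreal_leI[OF b1_le(2)]] b.row])
  qed (use b1_le b.A_nonneg col' in auto)
  interpret b2: schur Y \<eta> b2 d A2
  proof
    show "(\<integral>\<^sup>+y. ennreal (b2 (x, y)) \<partial>Y) \<le> ennreal d" for x
      using small by (simp add: b2_def)
  qed (use b2_le b.A_nonneg col' d in auto)
  have split: "AE x in lborel. b.T f x = b1.T f x + b2.T f x" if f: "sqint lborel f" for f
    using b1.AE_integrable[OF f] b2.AE_integrable[OF f]
  proof eventually_elim
    case (elim x)
    have "b p = b1 p + b2 p" for p by (simp add: b1_def b2_def indicator_def)
    then show ?case using elim by (simp add: Top_def distrib_left)
  qed
  define w where "w p = b1.T (u p)" for p
  have ws: "sqint lborel (w p)" for p unfolding w_def by (rule b1.sqint_T[OF us])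
  have [measurable]: "w p \<in> borel_measurable borel" for p using sqint_measurable[OF ws] by simp
  \<comment> \<open>At a fixed \<open>x\<close> the truncated operator is a positive functional, and
    \<open>bound\<close> is exactly its boundedness in the square norm.\<close>
  have w_conv: "convergent (\<lambda>p. w p x)" for x
    unfolding w_def Top_def
  proof (rule wcauchy_functional[OF _ _ _ _ _ u])
    show "0 \<le> c * indicator (ball 0 R) x" using c by simp
    show "(\<integral>\<^sup>+y. ennreal \<bar>f (\<eta> (x, y)) * b1 (x, y)\<bar> \<partial>Y)\<^sup>2
      \<le> ennreal (c * indicator (ball 0 R) x * (sqn lborel f))" if "sqint lborel f" for f
      using bound[OF that] by (simp add: b1_def)
  qed (use b1_le in auto)
  define v where "v x = lim (\<lambda>p. w p x)" for x
  have w_lim: "(\<lambda>p. w p x) \<longlonglongrightarrow> v x" for x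
    using w_conv by (simp add: v_def convergent_LIMSEQ_iff)
  have [measurable]: "v \<in> borel_measurable borel"
    by (rule borel_measurable_LIMSEQ_real[OF w_lim]) simp
  have w_le: "(w p x)\<^sup>2 \<le> c * B * indicator (ball 0 R) x" for p x
  proof -
    have "ennreal ((w p x)\<^sup>2) = (ennreal \<bar>w p x\<bar>)\<^sup>2" by (simp add: ennreal_power)
    also have "\<dots> \<le> (\<integral>\<^sup>+y. ennreal \<bar>u p (\<eta> (x, y)) * b1 (x, y)\<bar> \<partial>Y)\<^sup>2"
      unfolding w_def by (intro power_mono b1.abs_T_le) simp
    also have "\<dots> \<le> ennreal (c * indicator (ball 0 R) x * (sqn lborel (u p)))"
      using bound[OF us] by (simp add: b1_def)
    also have "\<dots> \<le> ennreal (c * indicator (ball 0 R) x * B)"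
      using c by (intro ennreal_leI mult_left_mono B) simp
    finally show ?thesis using c B0 by (subst (asm) ennreal_le_iff) (auto simp: mult_ac)
  qed
  have v_le: "(v x)\<^sup>2 \<le> c * B * indicator (ball 0 R) x" for x
    by (rule LIMSEQ_le_const2[OF tendsto_power[OF w_lim]]) (use w_le in auto)
  have "(\<lambda>p. \<integral>x. (w p x - v x)\<^sup>2 \<partial>lborel) \<longlonglongrightarrow> (\<integral>x. 0 \<partial>(lborel :: 'a measure))"
  proof (rule integral_dominated_convergence[where w="\<lambda>x. 4 * (c * B) * indicator (ball 0 R) x"])
    show "integrable lborel (\<lambda>x::'a. 4 * (c * B) * indicator (ball 0 R) x)"
      using emeasure_lborel_ball_finite[of "0::'a" R] by (intro integrable_mult_right) simp
    show "AE x in lborel. (\<lambda>p. (w p x - v x)\<^sup>2) \<longlonglongrightarrow> 0"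
    proof (rule AE_I2)
      fix x show "(\<lambda>p. (w p x - v x)\<^sup>2) \<longlonglongrightarrow> 0"
        using tendsto_power[OF tendsto_diff[OF w_lim[of x] tendsto_const[of "v x"]], of 2] by simp
    qed
    show "AE x in lborel. norm ((w p x - v x)\<^sup>2) \<le> 4 * (c * B) * indicator (ball 0 R) x" for p
    proof (rule AE_I2)
      fix x
      have "(w p x - v x)\<^sup>2 \<le> 2 * (w p x)\<^sup>2 + 2 * (v x)\<^sup>2"
        using zero_le_power2[of "w p x + v x"] by (simp add: power2_eq_square algebra_simps)
      then show "norm ((w p x - v x)\<^sup>2) \<le> 4 * (c * B) * indicator (ball 0 R) x"
        using w_le[of p x] v_le[of x] by simp
    qed
  qed auto
  then have wv: "(\<lambda>p. \<integral>x. (w p x - v x)\<^sup>2 \<partial>lborel) \<longlonglongrightarrow> 0" by simp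
  have vs: "sqint lborel v"
    unfolding sqint_def
  proof
    show "integrable lborel (\<lambda>x. (v x)\<^sup>2)"
    proof (rule Bochner_Integration.integrable_bound[of _ "\<lambda>x. c * B * indicator (ball 0 R) x"])
      show "integrable lborel (\<lambda>x::'a. (c * B) * indicator (ball 0 R) x)"
        using emeasure_lborel_ball_finite[of "0::'a" R] by (intro integrable_mult_right) simp
      show "AE x in lborel. norm ((v x)\<^sup>2) \<le> norm (c * B * indicator (ball 0 R) x)"
        using order_trans[OF v_le abs_ge_self] by (intro AE_I2) simp
    qed simp
  qed simp
  have "e / 16 > 0" using e by simp
  with wv have "\<forall>\<^sub>F p in sequentially. (sqn lborel (\<lambda>x. w p x - v x)) < e / 16"
    by (rule order_tendstoD(2))
  then obtain P where P: "\<And>p. p \<ge> P \<Longrightarrow> (sqn lborel (\<lambda>x. w p x - v x)) < e / 16"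
    unfolding eventually_sequentially by blast
  show "\<exists>P. \<forall>p\<ge>P. \<forall>q\<ge>P. (sqn lborel (\<lambda>x. b.T (u p) x - b.T (u q) x)) < e"
  proof (intro exI[of _ P] allI impI)
    fix p q assume p: "P \<le> p" and q: "P \<le> q"
    define z where "z x = u p x - u q x" for x
    have zs: "sqint lborel z" unfolding z_def by (rule sqint_diff[OF us us])
    have zB: "(sqn lborel z) \<le> 4 * B"
      using sqint_diff(2)[OF us[of p] us[of q]] B[of p] B[of q] by (simp add: z_def)
    have t2: "sqint lborel (b2.T z)" "(sqn lborel (\<lambda>x. b2.T z x)) \<le> e / 4"
    proof -
      show "sqint lborel (b2.T z)" by (rule b2.sqint_T[OF zs])
      have "(sqn lborel (\<lambda>x. b2.T z x)) \<le> d * A2 * (sqn lborel z)" by (rule b2.sqint_T[OF zs])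
      also have "\<dots> \<le> d * A2 * (4 * B)" using d b.A_nonneg by (intro mult_left_mono zB) auto
      also have "\<dots> \<le> d * (A2 + 1) * (4 * (B + 1))" using d b.A_nonneg B0 by (intro mult_mono) auto
      also have "\<dots> = e / 4"
      proof -
        have "A2 + 1 \<noteq> 0" "B + 1 \<noteq> 0" using b.A_nonneg B0 by auto
        then show ?thesis unfolding d_def by (simp add: divide_simps) (simp add: algebra_simps)
      qed
      finally show "(sqn lborel (\<lambda>x. b2.T z x)) \<le> e / 4" .
    qed
    have "(sqn lborel (\<lambda>x. (w p x - v x) - (w q x - v x)))
      \<le> 2 * (sqn lborel (\<lambda>x. w p x - v x)) + 2 * (sqn lborel (\<lambda>x. w q x - v x))"
      by (intro sqint_diff ws vs)
    then have wpq: "(sqn lborel (\<lambda>x. w p x - w q x)) < e / 4"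
      using P[OF p] P[OF q] by simp
    have "(sqn lborel (\<lambda>x. b.T (u p) x - b.T (u q) x)) = (sqn lborel (\<lambda>x. (w p x - w q x) + b2.T z x))"
    proof (rule integral_cong_AE)
      show "(\<lambda>x. (b.T (u p) x - b.T (u q) x)\<^sup>2) \<in> borel_measurable lborel"
        using sqint_measurable[OF b.sqint_T(1)[OF us]] by measurable
      show "(\<lambda>x. (w p x - w q x + b2.T z x)\<^sup>2) \<in> borel_measurable lborel"
        using sqint_measurable[OF t2(1)] by measurable
      show "AE x in lborel. (b.T (u p) x - b.T (u q) x)\<^sup>2 = (w p x - w q x + b2.T z x)\<^sup>2"
        using split[OF us[of p]] split[OF us[of q]] b2.T_diff[OF us[of p] us[of q]]
      proof eventually_elim
        case (elim x)
        have "b.T (u p) x - b.T (u q) x = w p x - w q x + b2.T z x"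
          using elim unfolding w_def z_def[abs_def] by linarith
        then show ?case by simp
      qed
    qed
    also have "\<dots> \<le> 2 * (sqn lborel (\<lambda>x. w p x - w q x)) + 2 * (sqn lborel (\<lambda>x. b2.T z x))"
      by (intro sqint_add sqint_diff ws t2)
    also have "\<dots> < e" using wpq t2(2) by linarith
    finally show "(sqn lborel (\<lambda>x. b.T (u p) x - b.T (u q) x)) < e" .
  qed
qed

subsection \<open>Collision kinematics\<close>

definition cmv :: "real \<Rightarrow> real \<Rightarrow> vel \<Rightarrow> vel \<Rightarrow> vel" where
  "cmv ma mb x y = (1 / (ma + mb)) *\<^sub>R (ma *\<^sub>R x + mb *\<^sub>R y)"

definition post1 :: "real \<Rightarrow> real \<Rightarrow> real \<Rightarrow> vel \<Rightarrow> vel \<Rightarrow> vel \<Rightarrow> vel" where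
  "post1 ma mb D x y w = cmv ma mb x y + (mb / (ma + mb) * sqrt ((norm (x - y))\<^sup>2 - 2 * D)) *\<^sub>R w"

definition post2 :: "real \<Rightarrow> real \<Rightarrow> real \<Rightarrow> vel \<Rightarrow> vel \<Rightarrow> vel \<Rightarrow> vel" where
  "post2 ma mb D x y w = cmv ma mb x y - (ma / (ma + mb) * sqrt ((norm (x - y))\<^sup>2 - 2 * D)) *\<^sub>R w"

text \<open>The collision kernel takes the squared relative speed and the cosine of the scattering
  angle. Using \<open>sgn (x - y)\<close> avoids a division and is harmless at \<open>x = y\<close>,
  where the kernel of a \<open>channel\<close> vanishes.\<close>

definition kin :: "(real \<Rightarrow> real \<Rightarrow> real) \<Rightarrow> vel \<Rightarrow> vel \<Rightarrow> vel \<Rightarrow> real" where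
  "kin B x y w = B ((norm (x - y))\<^sup>2) (sgn (x - y) \<bullet> w)"

text \<open>The kernel of the inverse collision, obtained from microreversibility.\<close>

definition BP :: "real \<Rightarrow> (real \<Rightarrow> real \<Rightarrow> real) \<Rightarrow> real \<Rightarrow> real \<Rightarrow> real" where
  "BP D B t c = (if t > 0 then B (t + 2 * D) c * sqrt (t + 2 * D) / sqrt t else 0)"

lemma cmv_measurable [measurable]:
  assumes [measurable]: "f \<in> M \<rightarrow>\<^sub>M borel" "g \<in> M \<rightarrow>\<^sub>M borel"
  shows "(\<lambda>p. cmv ma mb (f p) (g p)) \<in> M \<rightarrow>\<^sub>M borel"
  unfolding cmv_def by measurable

lemma post_measurable [measurable]:
  assumes [measurable]: "f \<in> M \<rightarrow>\<^sub>M borel" "g \<in> M \<rightarrow>\<^sub>M borel" "h \<in> M \<rightarrow>\<^sub>M borel"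
  shows "(\<lambda>p. post1 ma mb D (f p) (g p) (h p)) \<in> M \<rightarrow>\<^sub>M borel"
    and "(\<lambda>p. post2 ma mb D (f p) (g p) (h p)) \<in> M \<rightarrow>\<^sub>M borel"
  unfolding post1_def post2_def by measurable

text \<open>One summand of \<open>K\<close>: two masses, the energy threshold \<open>D\<close> and
  the kernel \<open>B\<close> left after the removal of the Dirac measures. The growth bound is
  chosen to suffice for the estimates and to survive reversal of the collision, so that every result
  about a channel also applies to the adjoint.\<close>

locale channel =
  fixes ma mb D :: real and B :: "real \<Rightarrow> real \<Rightarrow> real" and C :: real
  assumes ma: "ma > 0" and mb: "mb > 0" and C: "C \<ge> 0"
    and B_meas: "case_prod B \<in> borel_measurable (borel \<Otimes>\<^sub>M borel)"
    and B_nonneg: "\<And>t c. 0 \<le> B t c"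
    and B_zero: "\<And>t c. t \<le> 0 \<or> t \<le> 2 * D \<Longrightarrow> B t c = 0"
    and B_le: "\<And>t c. t > 0 \<Longrightarrow> B t c \<le> C * (1 + sqrt t)\<^sup>2 / sqrt t"
begin

lemma B_measurable [measurable]:
  assumes [measurable]: "f \<in> borel_measurable M" "g \<in> borel_measurable M"
  shows "(\<lambda>p. B (f p) (g p)) \<in> borel_measurable M"
  using measurable_compose[OF measurable_Pair[OF assms] B_meas] by simp

lemma kin_measurable [measurable]:
  assumes [measurable]: "f \<in> M \<rightarrow>\<^sub>M borel" "g \<in> M \<rightarrow>\<^sub>M borel" "h \<in> M \<rightarrow>\<^sub>M borel"
  shows "(\<lambda>p. kin B (f p) (g p) (h p)) \<in> borel_measurable M"
  unfolding kin_def by measurable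

lemma kin_nonneg: "0 \<le> kin B x y w" by (simp add: kin_def B_nonneg)

lemma swapped: "channel mb ma D B C"
  using ma mb C B_meas B_nonneg B_zero B_le by unfold_locales auto

text \<open>In \<open>BP\<close> the factor \<open>sqrt (t + 2 * D)\<close> cancels the denominator
  of the bound for \<open>B\<close>, and the new denominator is \<open>sqrt t\<close>. It remains to
  compare \<open>(1 + s)^2\<close>, where \<open>s^2 = t + 2 * D\<close>, with
  \<open>(1 + sqrt t)^2\<close>, at the price of a factor depending on \<open>D\<close>.\<close>

lemma BP_le:
  assumes t: "t > 0" shows "BP D B t c \<le> 4 * C * (1 + 2 * \<bar>D\<bar>) * (1 + sqrt t)\<^sup>2 / sqrt t"
proof (cases "t + 2 * D > 0")
  case True
  define s where "s = sqrt (t + 2 * D)"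
  have s: "s > 0" "s\<^sup>2 = t + 2 * D" using True by (auto simp: s_def)
  have "BP D B t c = B (t + 2 * D) c * s / sqrt t" using t by (simp add: BP_def s_def)
  also have "\<dots> \<le> (C * (1 + s)\<^sup>2 / s) * s / sqrt t"
    using B_le[OF True, of c] s t by (intro divide_right_mono mult_right_mono) (auto simp: s_def)
  also have "\<dots> = C * (1 + s)\<^sup>2 / sqrt t" using s by simp
  also have "\<dots> \<le> C * (4 * (1 + 2 * \<bar>D\<bar>) * (1 + sqrt t)\<^sup>2) / sqrt t"
  proof (intro divide_right_mono mult_left_mono C)
    have "(1 + s)\<^sup>2 \<le> 2 + 2 * s\<^sup>2"
      using zero_le_power2[of "1 - s"] by (simp add: power2_eq_square algebra_simps)
    also have "\<dots> \<le> 2 + 2 * (t + 2 * \<bar>D\<bar>)" using s by simp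
    also have "\<dots> \<le> 4 * (1 + 2 * \<bar>D\<bar>) * (1 + t)"
      using t by (simp add: algebra_simps)
    also have "\<dots> \<le> 4 * (1 + 2 * \<bar>D\<bar>) * (1 + sqrt t)\<^sup>2"
      using t by (intro mult_left_mono) (auto simp: power2_sum)
    finally show "(1 + s)\<^sup>2 \<le> \<dots>" .
  qed (use t in auto)
  finally show ?thesis by (simp add: mult_ac)
next
  case False
  then show ?thesis using t C by (simp add: BP_def B_zero)
qed

lemma reversed: "channel ma mb (- D) (BP D B) (4 * C * (1 + 2 * \<bar>D\<bar>))"
proof
  show "case_prod (BP D B) \<in> borel_measurable (borel \<Otimes>\<^sub>M borel)"
    unfolding BP_def by measurable
  show "0 \<le> BP D B t c" for t c
  proof (cases "t + 2 * D \<ge> 0")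
    case False
    then show ?thesis by (simp add: BP_def B_zero)
  qed (auto simp: BP_def B_nonneg)
  show "BP D B t c = 0" if "t \<le> 0 \<or> t \<le> 2 * - D" for t c
    using that by (auto simp: BP_def B_zero)
qed (use ma mb C BP_le in auto)

end

text \<open>Integration against the collision measure on quadruples of velocities, two before and
  two after. The symmetries of collisions are identities between such measures; the three terms of
  \<open>K\<close> correspond to different choices of \<open>F\<close>.\<close>

definition collint :: "real \<Rightarrow> real \<Rightarrow> real \<Rightarrow> (real \<Rightarrow> real \<Rightarrow> real) \<Rightarrow> (vel \<times> vel \<times> vel \<times> vel \<Rightarrow> ennreal) \<Rightarrow> ennreal" where
  "collint ma mb D B F = (\<integral>\<^sup>+x. \<integral>\<^sup>+y. \<integral>\<^sup>+w. F (x, y, post1 ma mb D x y w, post2 ma mb D x y w) * ennreal (kin B x y w) \<partial>usph \<partial>lborel \<partial>lborel)"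

text \<open>The passage to centre-of-mass coordinates is a composition of translations in one variable at a time.\<close>

lemma nn_integral_centre_of_mass:
  assumes H: "(\<lambda>(G, t, v). H G t v) \<in> borel_measurable (borel \<Otimes>\<^sub>M borel \<Otimes>\<^sub>M borel)"
    and m: "ma + mb \<noteq> 0"
  shows "(\<integral>\<^sup>+x. \<integral>\<^sup>+y. H (cmv ma mb x y) ((norm (x - y))\<^sup>2) (sgn (x - y)) \<partial>lborel \<partial>lborel)
    = (\<integral>\<^sup>+G. \<integral>\<^sup>+t. \<integral>\<^sup>+v. H G t v \<partial>usph \<partial>radm \<partial>lborel)"
proof -
  have [measurable]: "(\<lambda>p. H (f p) (g p) (h p)) \<in> borel_measurable M"
    if [measurable]: "f \<in> M \<rightarrow>\<^sub>M borel" "g \<in> M \<rightarrow>\<^sub>M borel" "h \<in> M \<rightarrow>\<^sub>M borel" for f g h and M :: "'x measure"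
    using measurable_compose[OF measurable_Pair[OF that(1) measurable_Pair[OF that(2,3)]] H] by simp
  have "(\<integral>\<^sup>+x. \<integral>\<^sup>+y. H (cmv ma mb x y) ((norm (x - y))\<^sup>2) (sgn (x - y)) \<partial>lborel \<partial>lborel)
    = (\<integral>\<^sup>+x. \<integral>\<^sup>+g. H (x - (mb / (ma + mb)) *\<^sub>R g) ((norm g)\<^sup>2) (sgn g) \<partial>lborel \<partial>lborel)"
  proof (rule nn_integral_cong)
    fix x :: vel
    have "cmv ma mb x (x - g) = x - (mb / (ma + mb)) *\<^sub>R g" for g
    proof -
      have "cmv ma mb x (x - g) = (1 / (ma + mb)) *\<^sub>R ((ma + mb) *\<^sub>R x - mb *\<^sub>R g)"
        by (simp add: cmv_def algebra_simps)
      then show ?thesis using m by (simp add: scaleR_diff_right)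
    qed
    then show "(\<integral>\<^sup>+y. H (cmv ma mb x y) ((norm (x - y))\<^sup>2) (sgn (x - y)) \<partial>lborel)
      = (\<integral>\<^sup>+g. H (x - (mb / (ma + mb)) *\<^sub>R g) ((norm g)\<^sup>2) (sgn g) \<partial>lborel)"
      by (subst nn_integral_reflect[symmetric, where t=x]) simp_all
  qed
  also have "\<dots> = (\<integral>\<^sup>+g. \<integral>\<^sup>+x. H (x - (mb / (ma + mb)) *\<^sub>R g) ((norm g)\<^sup>2) (sgn g) \<partial>lborel \<partial>lborel)"
    by (rule lborel_pair.Fubini') measurable
  also have "\<dots> = (\<integral>\<^sup>+g. \<integral>\<^sup>+x. H x ((norm g)\<^sup>2) (sgn g) \<partial>lborel \<partial>lborel)"
  proof (rule nn_integral_cong)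
    fix g :: vel
    show "(\<integral>\<^sup>+x. H (x - (mb / (ma + mb)) *\<^sub>R g) ((norm g)\<^sup>2) (sgn g) \<partial>lborel) = (\<integral>\<^sup>+x. H x ((norm g)\<^sup>2) (sgn g) \<partial>lborel)"
      using nn_integral_translate[of "\<lambda>x. H x ((norm g)\<^sup>2) (sgn g)" "- ((mb / (ma + mb)) *\<^sub>R g)"] by simp
  qed
  also have "\<dots> = (\<integral>\<^sup>+x. \<integral>\<^sup>+g. H x ((norm g)\<^sup>2) (sgn g) \<partial>lborel \<partial>lborel)"
    by (rule lborel_pair.Fubini') measurable
  also have "\<dots> = (\<integral>\<^sup>+G. \<integral>\<^sup>+t. \<integral>\<^sup>+v. H G t v \<partial>usph \<partial>radm \<partial>lborel)"
    by (intro nn_integral_cong nn_integral_polar) measurable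
  finally show ?thesis .
qed

text \<open>The pair of velocities with centre of mass \<open>G\<close>, squared relative speed
  \<open>t\<close> and direction \<open>v\<close> of the relative velocity. The outgoing pair has
  the same form with \<open>t - 2 * D\<close> and the new direction, which makes reversal an
  exchange of like data.\<close>

definition vpair :: "real \<Rightarrow> real \<Rightarrow> vel \<Rightarrow> real \<Rightarrow> vel \<Rightarrow> vel \<times> vel" where
  "vpair ma mb G t v = (G + (mb / (ma + mb) * sqrt t) *\<^sub>R v, G - (ma / (ma + mb) * sqrt t) *\<^sub>R v)"

lemma vpair_measurable [measurable]:
  assumes [measurable]: "f \<in> M \<rightarrow>\<^sub>M borel" "g \<in> borel_measurable M" "h \<in> M \<rightarrow>\<^sub>M borel"
  shows "(\<lambda>p. vpair ma mb (f p) (g p) (h p)) \<in> M \<rightarrow>\<^sub>M borel \<Otimes>\<^sub>M borel"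
  unfolding vpair_def by measurable

lemma vpair_cmv:
  assumes m: "ma + mb \<noteq> 0"
  shows "vpair ma mb (cmv ma mb x y) ((norm (x - y))\<^sup>2) (sgn (x - y)) = (x, y)"
proof -
  have n: "norm (x - y) *\<^sub>R sgn (x - y) = x - y"
    by (cases "x = y") (auto simp: sgn_div_norm)
  have x: "cmv ma mb x y + (mb / (ma + mb)) *\<^sub>R (x - y) = x"
  proof -
    have "cmv ma mb x y + (mb / (ma + mb)) *\<^sub>R (x - y) = (1 / (ma + mb)) *\<^sub>R ((ma *\<^sub>R x + mb *\<^sub>R y) + mb *\<^sub>R (x - y))"
      by (simp add: cmv_def scaleR_add_right)
    also have "(ma *\<^sub>R x + mb *\<^sub>R y) + mb *\<^sub>R (x - y) = (ma + mb) *\<^sub>R x"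
      by (simp add: algebra_simps)
    finally show ?thesis using m by simp
  qed
  have y: "cmv ma mb x y - (ma / (ma + mb)) *\<^sub>R (x - y) = y"
  proof -
    have "cmv ma mb x y - (ma / (ma + mb)) *\<^sub>R (x - y) = (1 / (ma + mb)) *\<^sub>R ((ma *\<^sub>R x + mb *\<^sub>R y) - ma *\<^sub>R (x - y))"
      by (simp only: cmv_def scaleR_diff_right[of "1 / (ma + mb)" "ma *\<^sub>R x + mb *\<^sub>R y"] scaleR_scaleR) simp
    also have "(ma *\<^sub>R x + mb *\<^sub>R y) - ma *\<^sub>R (x - y) = (ma + mb) *\<^sub>R y"
      by (simp add: algebra_simps)
    finally show ?thesis using m by simp
  qed
  show ?thesis
    unfolding vpair_def real_sqrt_abs abs_norm_cancel scaleR_scaleR[symmetric] n using x y by simp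
qed

context channel
begin

text \<open>In these coordinates the pairs before and after the collision share \<open>G\<close> and
  differ only in \<open>t\<close> and in the direction. The measure in \<open>t\<close> is written
  as a density with respect to Lebesgue measure, so that \<open>t\<close> can be translated.\<close>

lemma collint_canonical:
  assumes F[measurable]: "F \<in> borel_measurable ((borel \<Otimes>\<^sub>M borel) \<Otimes>\<^sub>M (borel \<Otimes>\<^sub>M borel))"
  shows "collint ma mb D B (\<lambda>(x, y, x', y'). F ((x, y), (x', y')))
    = (\<integral>\<^sup>+G. \<integral>\<^sup>+t. ennreal (sqrt t / 2) * indicator {0<..} t *
        (\<integral>\<^sup>+v. \<integral>\<^sup>+w. F (vpair ma mb G t v, vpair ma mb G (t - 2 * D) w) * ennreal (B t (v \<bullet> w)) \<partial>usph \<partial>usph) \<partial>lborel \<partial>lborel)"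
proof -
  have m: "ma + mb \<noteq> 0" using ma mb by simp
  define H where "H G t v = (\<integral>\<^sup>+w. F (vpair ma mb G t v, vpair ma mb G (t - 2 * D) w) * ennreal (B t (v \<bullet> w)) \<partial>usph)" for G t v
  have Hm: "(\<lambda>(G, t, v). H G t v) \<in> borel_measurable (borel \<Otimes>\<^sub>M borel \<Otimes>\<^sub>M borel)"
    unfolding H_def by measurable
  have "collint ma mb D B (\<lambda>(x, y, x', y'). F ((x, y), (x', y')))
    = (\<integral>\<^sup>+x. \<integral>\<^sup>+y. H (cmv ma mb x y) ((norm (x - y))\<^sup>2) (sgn (x - y)) \<partial>lborel \<partial>lborel)"
    unfolding collint_def H_def vpair_cmv[OF m] kin_def
    by (simp add: post1_def post2_def vpair_def)
  also have "\<dots> = (\<integral>\<^sup>+G. \<integral>\<^sup>+t. \<integral>\<^sup>+v. H G t v \<partial>usph \<partial>radm \<partial>lborel)"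
    by (rule nn_integral_centre_of_mass[OF Hm m])
  also have "\<dots> = (\<integral>\<^sup>+G. \<integral>\<^sup>+t. ennreal (sqrt t / 2) * indicator {0<..} t * (\<integral>\<^sup>+v. H G t v \<partial>usph) \<partial>lborel \<partial>lborel)"
  proof (intro nn_integral_cong nn_integral_radm)
    fix G
    show "(\<lambda>t. \<integral>\<^sup>+v. H G t v \<partial>usph) \<in> borel_measurable borel"
      unfolding H_def by measurable
  qed
  finally show ?thesis by (simp add: H_def)
qed

text \<open>Translate \<open>t\<close> by \<open>2 * D\<close> and exchange the two directions. The
  weight \<open>sqrt (t + 2 * D) * B (t + 2 * D)\<close> has to equal
  \<open>sqrt t * BP D B t\<close>, and this dictates the form of \<open>BP\<close>.\<close>

lemma collint_reverse:
  assumes F[measurable]: "F \<in> borel_measurable (borel \<Otimes>\<^sub>M borel \<Otimes>\<^sub>M borel \<Otimes>\<^sub>M borel)"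
  shows "collint ma mb D B F = collint ma mb (- D) (BP D B) (\<lambda>(x, y, x', y'). F (x', y', x, y))"
proof -
  interpret P: channel ma mb "- D" "BP D B" "4 * C * (1 + 2 * \<bar>D\<bar>)" by (rule reversed)
  interpret UU: pair_sigma_finite usph usph by unfold_locales
  define F1 where "F1 p = F (fst (fst p), snd (fst p), fst (snd p), snd (snd p))" for p
  have [measurable]: "F1 \<in> borel_measurable ((borel \<Otimes>\<^sub>M borel) \<Otimes>\<^sub>M (borel \<Otimes>\<^sub>M borel))"
    unfolding F1_def by measurable
  define F2 where "F2 p = F1 (snd p, fst p)" for p
  have [measurable]: "F2 \<in> borel_measurable ((borel \<Otimes>\<^sub>M borel) \<Otimes>\<^sub>M (borel \<Otimes>\<^sub>M borel))"
    unfolding F2_def by measurable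
  let ?P = "vpair ma mb"
  have "collint ma mb D B F = collint ma mb D B (\<lambda>(x, y, x', y'). F1 ((x, y), (x', y')))"
    by (simp add: F1_def case_prod_unfold)
  also have "\<dots> = (\<integral>\<^sup>+G. \<integral>\<^sup>+t. ennreal (sqrt t / 2) * indicator {0<..} t *
        (\<integral>\<^sup>+v. \<integral>\<^sup>+w. F1 (?P G t v, ?P G (t - 2 * D) w) * ennreal (B t (v \<bullet> w)) \<partial>usph \<partial>usph) \<partial>lborel \<partial>lborel)"
    by (rule collint_canonical) measurable
  also have "\<dots> = (\<integral>\<^sup>+G. \<integral>\<^sup>+t. ennreal (sqrt t / 2) * indicator {0<..} t *
        (\<integral>\<^sup>+w. \<integral>\<^sup>+v. F1 (?P G (t + 2 * D) v, ?P G t w) * ennreal (BP D B t (w \<bullet> v)) \<partial>usph \<partial>usph) \<partial>lborel \<partial>lborel)"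
  proof (rule nn_integral_cong)
    fix G :: vel
    have "(\<integral>\<^sup>+t. ennreal (sqrt t / 2) * indicator {0<..} t *
        (\<integral>\<^sup>+v. \<integral>\<^sup>+w. F1 (?P G t v, ?P G (t - 2 * D) w) * ennreal (B t (v \<bullet> w)) \<partial>usph \<partial>usph) \<partial>lborel)
      = (\<integral>\<^sup>+t. ennreal (sqrt (2 * D + t) / 2) * indicator {0<..} (2 * D + t) *
        (\<integral>\<^sup>+v. \<integral>\<^sup>+w. F1 (?P G (2 * D + t) v, ?P G (2 * D + t - 2 * D) w) * ennreal (B (2 * D + t) (v \<bullet> w)) \<partial>usph \<partial>usph) \<partial>lborel)"
      by (rule nn_integral_translate[symmetric]) measurable
    also have "\<dots> = (\<integral>\<^sup>+t. ennreal (sqrt t / 2) * indicator {0<..} t *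
        (\<integral>\<^sup>+w. \<integral>\<^sup>+v. F1 (?P G (t + 2 * D) v, ?P G t w) * ennreal (BP D B t (w \<bullet> v)) \<partial>usph \<partial>usph) \<partial>lborel)"
    proof (rule nn_integral_cong)
      fix t :: real
      \<comment> \<open>If either relative speed fails to be positive, both sides vanish, because
        \<open>B\<close> and \<open>BP\<close> are supported on the energetically admissible
        range.\<close>
      have w: "ennreal (sqrt (2 * D + t) / 2) * indicator {0<..} (2 * D + t) * ennreal (B (2 * D + t) c)
        = ennreal (sqrt t / 2) * indicator {0<..} t * ennreal (BP D B t c)" for c
      proof (cases "t > 0 \<and> 2 * D + t > 0")
        case True
        have "sqrt (2 * D + t) / 2 * B (2 * D + t) c = sqrt t / 2 * BP D B t c"
          using True by (simp add: BP_def add.commute)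
        then show ?thesis using True P.B_nonneg B_nonneg by (simp add: ennreal_mult[symmetric])
      next
        case False
        then have "indicator {0<..} (2 * D + t) * ennreal (B (2 * D + t) c) = 0"
           "indicator {0<..} t * ennreal (BP D B t c) = 0"
          by (auto simp: indicator_def B_zero P.B_zero)
        then show ?thesis by (simp only: mult.assoc mult_zero_right)
      qed
      have "ennreal (sqrt (2 * D + t) / 2) * indicator {0<..} (2 * D + t) *
          (\<integral>\<^sup>+v. \<integral>\<^sup>+w. F1 (?P G (2 * D + t) v, ?P G (2 * D + t - 2 * D) w) * ennreal (B (2 * D + t) (v \<bullet> w)) \<partial>usph \<partial>usph)
        = (\<integral>\<^sup>+v. \<integral>\<^sup>+w. F1 (?P G (t + 2 * D) v, ?P G t w) * (ennreal (sqrt (2 * D + t) / 2) * indicator {0<..} (2 * D + t) * ennreal (B (2 * D + t) (v \<bullet> w))) \<partial>usph \<partial>usph)"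
        by (simp flip: nn_integral_cmult add: ac_simps)
      also have "\<dots> = (\<integral>\<^sup>+w. \<integral>\<^sup>+v. F1 (?P G (t + 2 * D) v, ?P G t w) * (ennreal (sqrt t / 2) * indicator {0<..} t * ennreal (BP D B t (v \<bullet> w))) \<partial>usph \<partial>usph)"
        unfolding w by (rule UU.Fubini') measurable
      also have "\<dots> = ennreal (sqrt t / 2) * indicator {0<..} t *
        (\<integral>\<^sup>+w. \<integral>\<^sup>+v. F1 (?P G (t + 2 * D) v, ?P G t w) * ennreal (BP D B t (w \<bullet> v)) \<partial>usph \<partial>usph)"
        by (simp flip: nn_integral_cmult add: mult_ac inner_commute)
      finally show "ennreal (sqrt (2 * D + t) / 2) * indicator {0<..} (2 * D + t) *
          (\<integral>\<^sup>+v. \<integral>\<^sup>+w. F1 (?P G (2 * D + t) v, ?P G (2 * D + t - 2 * D) w) * ennreal (B (2 * D + t) (v \<bullet> w)) \<partial>usph \<partial>usph) = \<dots>" .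
    qed
    finally show "(\<integral>\<^sup>+t. ennreal (sqrt t / 2) * indicator {0<..} t *
        (\<integral>\<^sup>+v. \<integral>\<^sup>+w. F1 (?P G t v, ?P G (t - 2 * D) w) * ennreal (B t (v \<bullet> w)) \<partial>usph \<partial>usph) \<partial>lborel) = \<dots>" .
  qed
  also have "\<dots> = (\<integral>\<^sup>+G. \<integral>\<^sup>+t. ennreal (sqrt t / 2) * indicator {0<..} t *
        (\<integral>\<^sup>+v. \<integral>\<^sup>+w. F2 (?P G t v, ?P G (t - 2 * - D) w) * ennreal (BP D B t (v \<bullet> w)) \<partial>usph \<partial>usph) \<partial>lborel \<partial>lborel)"
    by (simp add: F2_def)
  also have "\<dots> = collint ma mb (- D) (BP D B) (\<lambda>(x, y, x', y'). F2 ((x, y), (x', y')))"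
    by (rule P.collint_canonical[symmetric]) measurable
  also have "\<dots> = collint ma mb (- D) (BP D B) (\<lambda>(x, y, x', y'). F (x', y', x, y))"
    by (simp add: F1_def F2_def)
  finally show ?thesis .
qed

text \<open>Exchanging the partners reverses the relative velocity before and after. Replacing
  \<omega> by its negative, which preserves the surface measure, restores the formulas for the
  outcome with the masses exchanged; the cosine is unaffected since both directions change
  sign.\<close>

lemma collint_swap:
  assumes F[measurable]: "F \<in> borel_measurable (borel \<Otimes>\<^sub>M borel \<Otimes>\<^sub>M borel \<Otimes>\<^sub>M borel)"
  shows "collint ma mb D B F = collint mb ma D B (\<lambda>(x, y, x', y'). F (y, x, y', x'))"
proof -
  have c: "cmv mb ma x y = cmv ma mb y x" for x y by (simp add: cmv_def add.commute)
  have 1: "post1 mb ma D x y (- w) = post2 ma mb D y x w" "post2 mb ma D x y (- w) = post1 ma mb D y x w" for x y w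
    by (simp_all add: post1_def post2_def c add.commute norm_minus_commute)
  have 2: "kin B x y (- w) = kin B y x w" for x y w
    using sgn_minus[of "x - y"] by (simp add: kin_def norm_minus_commute)
  have "collint mb ma D B (\<lambda>(x, y, x', y'). F (y, x, y', x'))
    = (\<integral>\<^sup>+x. \<integral>\<^sup>+y. \<integral>\<^sup>+w. F (y, x, post2 mb ma D x y w, post1 mb ma D x y w) * ennreal (kin B x y w) \<partial>usph \<partial>lborel \<partial>lborel)"
    by (simp add: collint_def)
  also have "\<dots> = (\<integral>\<^sup>+x. \<integral>\<^sup>+y. \<integral>\<^sup>+w. F (y, x, post2 mb ma D x y (- w), post1 mb ma D x y (- w)) * ennreal (kin B x y (- w)) \<partial>usph \<partial>lborel \<partial>lborel)"
    by (intro nn_integral_cong nn_integral_usph_uminus[symmetric]) measurable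
  also have "\<dots> = (\<integral>\<^sup>+x. \<integral>\<^sup>+y. \<integral>\<^sup>+w. F (y, x, post1 ma mb D y x w, post2 ma mb D y x w) * ennreal (kin B y x w) \<partial>usph \<partial>lborel \<partial>lborel)"
    by (simp add: 1 2)
  also have "\<dots> = (\<integral>\<^sup>+y. \<integral>\<^sup>+x. \<integral>\<^sup>+w. F (y, x, post1 ma mb D y x w, post2 ma mb D y x w) * ennreal (kin B y x w) \<partial>usph \<partial>lborel \<partial>lborel)"
    by (rule lborel_pair.Fubini') measurable
  finally show ?thesis by (simp add: collint_def)
qed

end

subsection \<open>Gaussian estimates\<close>

abbreviation "Usph \<equiv> measure usph UNIV"

lemma emeasure_usph_UNIV: "emeasure usph UNIV = ennreal Usph"
  using usph.emeasure_eq_measure[of UNIV] by simp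

lemma gauss_finite:
  assumes a: "a > 0"
  shows "(\<integral>\<^sup>+x. ennreal (exp (- a * (norm x)\<^sup>2)) \<partial>(lborel :: vel measure)) < \<infinity>"
proof -
  \<comment> \<open>Chosen so that \<open>1 + t \<le> k * exp (a / 2 * t)\<close>: half of the
    exponential absorbs the volume factor.\<close>
  define k where "k = 1 + 2 / a"
  have k: "k > 0" using a by (simp add: k_def add_pos_pos)
  have le: "sqrt t / 2 * exp (- a * t) \<le> k * exp (- (a / 2) * t)" if t: "t > 0" for t
  proof -
    have "sqrt t / 2 \<le> 1 + t"
    proof -
      have "0 \<le> (sqrt t - 1)\<^sup>2" by simp
      then show ?thesis using t by (simp add: power2_diff)
    qed
    also have "\<dots> \<le> k * exp (a / 2 * t)"
    proof -
      have "1 + a / 2 * t \<le> exp (a / 2 * t)" by (rule exp_ge_add_one_self)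
      then have "k * (1 + a / 2 * t) \<le> k * exp (a / 2 * t)" using k by simp
      moreover have "k * (1 + a / 2 * t) = 1 + t + 2 / a + a / 2 * t"
        using a by (simp add: k_def field_simps)
      moreover have "2 / a + a / 2 * t \<ge> 0" using a t by simp
      ultimately show ?thesis by linarith
    qed
    finally have "sqrt t / 2 * exp (- a * t) \<le> k * exp (a / 2 * t) * exp (- a * t)"
      by (rule mult_right_mono) simp
    also have "\<dots> = k * exp (- (a / 2) * t)"
      by (simp add: mult.assoc exp_add[symmetric])
    finally show ?thesis .
  qed
  have "(\<integral>\<^sup>+x. ennreal (exp (- a * (norm x)\<^sup>2)) \<partial>(lborel :: vel measure))
    = (\<integral>\<^sup>+t. \<integral>\<^sup>+w. ennreal (exp (- a * t)) \<partial>usph \<partial>radm)"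
    by (rule nn_integral_polar[where f="\<lambda>t w. ennreal (exp (- a * t))"]) measurable
  also have "\<dots> = (\<integral>\<^sup>+t. ennreal (exp (- a * t)) * ennreal Usph \<partial>radm)"
    by (simp add: emeasure_usph_UNIV)
  also have "\<dots> = (\<integral>\<^sup>+t. ennreal (sqrt t / 2) * indicator {0<..} t * (ennreal (exp (- a * t)) * ennreal Usph) \<partial>lborel)"
    by (rule nn_integral_radm) measurable
  also have "\<dots> \<le> (\<integral>\<^sup>+t. ennreal (k * Usph) * (ennreal (exp (- (a / 2) * t)) * indicator {0..} t) \<partial>lborel)"
  proof (rule nn_integral_mono)
    fix t :: real
    show "ennreal (sqrt t / 2) * indicator {0<..} t * (ennreal (exp (- a * t)) * ennreal Usph)
      \<le> ennreal (k * Usph) * (ennreal (exp (- (a / 2) * t)) * indicator {0..} t)"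
    proof (cases "t > 0")
      case True
      have "sqrt t / 2 * (exp (- a * t) * Usph) \<le> k * Usph * exp (- (a / 2) * t)"
        using mult_right_mono[OF le[OF True], of Usph] by (simp add: mult_ac)
      then show ?thesis using True k by (simp add: ennreal_mult[symmetric] ennreal_leI)
    qed simp
  qed
  also have "\<dots> = ennreal (k * Usph) * (\<integral>\<^sup>+t. ennreal (exp (- (a / 2) * t)) * indicator {0..} t \<partial>lborel)"
    by (rule nn_integral_cmult) measurable
  also have "(\<integral>\<^sup>+t. ennreal (exp (- (a / 2) * t)) * indicator {0..} t \<partial>lborel) = ennreal (0 - (- (2 / a) * exp (- (a / 2) * 0)))"
  proof (rule nn_integral_FTC_atLeast)
    show "((\<lambda>t. - (2 / a) * exp (- (a / 2) * t)) has_real_derivative exp (- (a / 2) * t)) (at t)" for t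
      using a by (auto intro!: derivative_eq_intros)
    have "((\<lambda>t. exp (- (a / 2) * t)) \<longlongrightarrow> 0) at_top"
    proof (rule filterlim_compose[OF exp_at_bot])
      show "filterlim (\<lambda>t. - (a / 2) * t) at_bot at_top"
        using a by (intro filterlim_tendsto_neg_mult_at_bot[OF tendsto_const _ filterlim_ident]) auto
    qed
    then show "((\<lambda>t. - (2 / a) * exp (- (a / 2) * t)) \<longlongrightarrow> 0) at_top"
      by (rule tendsto_mult_right_zero)
  qed auto
  also have "ennreal (k * Usph) * ennreal (0 - (- (2 / a) * exp (- (a / 2) * 0))) < \<infinity>"
    by (simp add: ennreal_mult_less_top)
  finally show ?thesis .
qed

definition gauss_mass :: "real \<Rightarrow> real" where
  "gauss_mass a = enn2real (\<integral>\<^sup>+x. ennreal (exp (- a * (norm x)\<^sup>2)) \<partial>(lborel :: vel measure))"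

lemma gauss_mass_nonneg: "0 \<le> gauss_mass a" by (simp add: gauss_mass_def)

lemma nn_integral_gauss:
  "a > 0 \<Longrightarrow> (\<integral>\<^sup>+x. ennreal (exp (- a * (norm x)\<^sup>2)) \<partial>(lborel :: vel measure)) = ennreal (gauss_mass a)"
  using gauss_finite[of a] by (simp add: gauss_mass_def)

text \<open>In the squared radius the singularity \<open>1 / sqrt t\<close> cancels the volume
  factor \<open>sqrt t / 2\<close> up to a constant.\<close>

lemma nn_integral_newton_ball:
  assumes r: "r \<ge> 0"
  shows "(\<integral>\<^sup>+g. ennreal (indicator (ball 0 r) g / norm (g :: vel)) \<partial>lborel) = ennreal (Usph * r\<^sup>2 / 2)"
proof -
  have [simp]: "norm g < r \<longleftrightarrow> (norm g)\<^sup>2 < r\<^sup>2" for g :: vel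
    using r by (metis abs_le_square_iff abs_norm_cancel abs_of_nonneg linorder_not_le)
  have "(\<integral>\<^sup>+g. ennreal (indicator (ball 0 r) g / norm (g :: vel)) \<partial>lborel)
    = (\<integral>\<^sup>+g. ennreal (indicator {..<r\<^sup>2} ((norm (g::vel))\<^sup>2) / sqrt ((norm g)\<^sup>2)) \<partial>lborel)"
    by (intro nn_integral_cong) (simp add: indicator_def)
  also have "\<dots> = (\<integral>\<^sup>+t. \<integral>\<^sup>+w. ennreal (indicator {..<r\<^sup>2} t / sqrt t) \<partial>usph \<partial>radm)"
    by (rule nn_integral_polar[where f="\<lambda>t w. ennreal (indicator {..<r\<^sup>2} t / sqrt t)"]) measurable
  also have "\<dots> = (\<integral>\<^sup>+t. ennreal (indicator {..<r\<^sup>2} t / sqrt t) * ennreal Usph \<partial>radm)"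
    by (simp add: emeasure_usph_UNIV)
  also have "\<dots> = (\<integral>\<^sup>+t. ennreal (sqrt t / 2) * indicator {0<..} t * (ennreal (indicator {..<r\<^sup>2} t / sqrt t) * ennreal Usph) \<partial>lborel)"
    by (rule nn_integral_radm) measurable
  also have "\<dots> = (\<integral>\<^sup>+t. ennreal (Usph / 2) * indicator {0<..<r\<^sup>2} t \<partial>lborel)"
  proof (rule nn_integral_cong)
    fix t :: real
    show "ennreal (sqrt t / 2) * indicator {0<..} t * (ennreal (indicator {..<r\<^sup>2} t / sqrt t) * ennreal Usph)
      = ennreal (Usph / 2) * indicator {0<..<r\<^sup>2} t"
      by (auto simp: indicator_def ennreal_mult[symmetric])
  qed
  also have "\<dots> = ennreal (Usph / 2) * ennreal (r\<^sup>2)"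
    by (subst nn_integral_cmult_indicator) auto
  also have "\<dots> = ennreal (Usph * r\<^sup>2 / 2)"
    by (simp add: ennreal_mult[symmetric])
  finally show ?thesis .
qed

text \<open>Beyond distance \<open>r\<close> the Newton kernel is at most \<open>1 / r\<close>, and
  within it the Gaussian is at most 1. What matters is that the bound does not depend on
  \<open>x\<close>.\<close>

lemma nn_integral_gauss_newton:
  assumes a: "a > 0" and r: "r > 0"
  shows "(\<integral>\<^sup>+y. ennreal (exp (- a * (norm y)\<^sup>2) / norm (x - y)) \<partial>(lborel :: vel measure))
    \<le> ennreal (gauss_mass a / r + Usph * r\<^sup>2 / 2)"
proof -
  have "(\<integral>\<^sup>+y. ennreal (exp (- a * (norm y)\<^sup>2) / norm (x - y)) \<partial>lborel)
    \<le> (\<integral>\<^sup>+y. ennreal (1 / r) * ennreal (exp (- a * (norm y)\<^sup>2)) + ennreal (indicator (ball 0 r) (x - y) / norm (x - y)) \<partial>lborel)"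
  proof (rule nn_integral_mono)
    fix y :: vel
    have e1: "exp (- a * (norm y)\<^sup>2) \<le> 1" using a by simp
    have "exp (- a * (norm y)\<^sup>2) / norm (x - y) \<le> 1 / r * exp (- a * (norm y)\<^sup>2) + indicator (ball 0 r) (x - y) / norm (x - y)"
    proof (cases "norm (x - y) < r")
      case True
      have "exp (- a * (norm y)\<^sup>2) / norm (x - y) \<le> 1 / norm (x - y)"
        using e1 by (intro divide_right_mono) auto
      then show ?thesis using True r by (simp add: add_increasing)
    next
      case False
      then have "exp (- a * (norm y)\<^sup>2) / norm (x - y) \<le> exp (- a * (norm y)\<^sup>2) / r"
        using r by (intro divide_left_mono mult_pos_pos) auto
      then show ?thesis using False by simp
    qed
    then show "ennreal (exp (- a * (norm y)\<^sup>2) / norm (x - y)) \<le> ennreal (1 / r) * ennreal (exp (- a * (norm y)\<^sup>2)) + ennreal (indicator (ball 0 r) (x - y) / norm (x - y))"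
      using r by (simp add: ennreal_mult[symmetric] ennreal_plus[symmetric] ennreal_leI del: ennreal_plus)
  qed
  also have "\<dots> = ennreal (1 / r) * (\<integral>\<^sup>+y. ennreal (exp (- a * (norm (y::vel))\<^sup>2)) \<partial>lborel) + (\<integral>\<^sup>+y. ennreal (indicator (ball 0 r) (x - y) / norm (x - y)) \<partial>lborel)"
    by (subst nn_integral_add) (auto simp: nn_integral_cmult)
  also have "(\<integral>\<^sup>+y. ennreal (indicator (ball 0 r) (x - y) / norm (x - y)) \<partial>lborel) = ennreal (Usph * r\<^sup>2 / 2)"
    using r nn_integral_reflect[of "\<lambda>g. ennreal (indicator (ball 0 r) g / norm g)" x]
    by (simp add: nn_integral_newton_ball)
  also have "ennreal (1 / r) * (\<integral>\<^sup>+y. ennreal (exp (- a * (norm (y::vel))\<^sup>2)) \<partial>lborel) + ennreal (Usph * r\<^sup>2 / 2) = ennreal (gauss_mass a / r + Usph * r\<^sup>2 / 2)"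
    using r gauss_mass_nonneg[of a] unfolding nn_integral_gauss[OF a]
    by (simp add: ennreal_mult[symmetric] ennreal_plus[symmetric] del: ennreal_plus)
  finally show ?thesis .
qed

text \<open>A Gaussian restricted to a sphere of radius \<open>\<rho>\<close> is compared with the same Gaussian on the shell
  between the radii \<open>\<rho>\<close> and \<open>\<rho> + 1\<close>, whose volume element carries the factor \<open>\<rho>\<^sup>2\<close>.\<close>

lemma sphere_gauss_pos:
  assumes a: "a > 0" and \<rho>: "\<rho> > 0"
  shows "ennreal (\<rho>\<^sup>2) * (\<integral>\<^sup>+w. ennreal (exp (- a * (norm (v - \<rho> *\<^sub>R w))\<^sup>2)) \<partial>usph) \<le> ennreal (exp a * gauss_mass (a / 2))"
proof -
  define I where "I = (\<integral>\<^sup>+w. ennreal (exp (- a * (norm (v - \<rho> *\<^sub>R w))\<^sup>2)) \<partial>usph)"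
  define S where "S = {\<rho>\<^sup>2..<(\<rho> + 1)\<^sup>2}"
  have I_le: "I \<le> ennreal (exp a) * (\<integral>\<^sup>+w. ennreal (exp (- (a / 2) * (norm (v - sqrt t *\<^sub>R w))\<^sup>2)) \<partial>usph)"
    if t: "t \<in> S" for t
  proof -
    have s: "\<rho> \<le> sqrt t" "sqrt t \<le> \<rho> + 1"
      using t \<rho> by (auto simp: S_def intro: real_le_rsqrt real_le_lsqrt)
    \<comment> \<open>Changing the radius by at most 1 moves the point by at most 1, and
      \<open>(d + 1)^2 \<le> 2 * d^2 + 2\<close>; this halves the exponent and costs the factor
      \<open>exp a\<close>.\<close>
    have pt: "exp (- a * (norm (v - \<rho> *\<^sub>R w))\<^sup>2) \<le> exp a * exp (- (a / 2) * (norm (v - sqrt t *\<^sub>R w))\<^sup>2)"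
      if w: "norm w = 1" for w
    proof -
      have "norm (v - sqrt t *\<^sub>R w) = norm ((v - \<rho> *\<^sub>R w) + (\<rho> - sqrt t) *\<^sub>R w)"
        by (simp add: algebra_simps)
      also have "\<dots> \<le> norm (v - \<rho> *\<^sub>R w) + \<bar>\<rho> - sqrt t\<bar>"
        using w by (intro order_trans[OF norm_triangle_ineq]) simp
      also have "\<dots> \<le> norm (v - \<rho> *\<^sub>R w) + 1" using s by simp
      finally have "(norm (v - sqrt t *\<^sub>R w))\<^sup>2 \<le> (norm (v - \<rho> *\<^sub>R w) + 1)\<^sup>2"
        by (intro power_mono) auto
      also have "\<dots> \<le> 2 * (norm (v - \<rho> *\<^sub>R w))\<^sup>2 + 2"
        using zero_le_power2[of "norm (v - \<rho> *\<^sub>R w) - 1"] by (simp add: power2_eq_square algebra_simps)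
      finally have "a / 2 * (norm (v - sqrt t *\<^sub>R w))\<^sup>2 \<le> a / 2 * (2 * (norm (v - \<rho> *\<^sub>R w))\<^sup>2 + 2)"
        using a by (intro mult_left_mono) auto
      then have "- a * (norm (v - \<rho> *\<^sub>R w))\<^sup>2 \<le> a + - (a / 2) * (norm (v - sqrt t *\<^sub>R w))\<^sup>2"
        by (simp add: algebra_simps)
      then show ?thesis by (simp add: exp_add[symmetric])
    qed
    have "I \<le> (\<integral>\<^sup>+w. ennreal (exp a) * ennreal (exp (- (a / 2) * (norm (v - sqrt t *\<^sub>R w))\<^sup>2)) \<partial>usph)"
      unfolding I_def
    proof (rule nn_integral_mono_AE)
      show "AE w in usph. ennreal (exp (- a * (norm (v - \<rho> *\<^sub>R w))\<^sup>2)) \<le> ennreal (exp a) * ennreal (exp (- (a / 2) * (norm (v - sqrt t *\<^sub>R w))\<^sup>2))"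
        using AE_usph by eventually_elim (use pt in \<open>simp add: ennreal_mult[symmetric] ennreal_leI\<close>)
    qed
    then show ?thesis by (simp add: nn_integral_cmult)
  qed
  have vol: "ennreal (\<rho>\<^sup>2) \<le> emeasure radm S"
  proof -
    have S_eq: "S = {..<(\<rho> + 1)\<^sup>2} - {..<\<rho>\<^sup>2}" by (auto simp: S_def)
    have "\<rho>\<^sup>2 \<le> (\<rho> + 1)\<^sup>2" using \<rho> by (intro power_mono) auto
    then have "emeasure radm S = emeasure radm {..<(\<rho> + 1)\<^sup>2} - emeasure radm {..<\<rho>\<^sup>2}"
      using \<rho> unfolding S_eq by (intro emeasure_Diff) (auto simp: emeasure_radm_lessThan)
    also have "\<dots> = ennreal ((\<rho> + 1) ^ 3 / 3 - \<rho> ^ 3 / 3)"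
      using \<rho> by (simp add: emeasure_radm_lessThan ennreal_minus)
    also have "(\<rho> + 1) ^ 3 / 3 - \<rho> ^ 3 / 3 = \<rho>\<^sup>2 + \<rho> + 1 / 3"
      by (simp add: power2_eq_square power3_eq_cube field_simps)
    finally show ?thesis using \<rho> by (simp add: ennreal_leI)
  qed
  have "ennreal (\<rho>\<^sup>2) * I \<le> emeasure radm S * I" by (intro mult_right_mono vol) simp
  also have "\<dots> = (\<integral>\<^sup>+t. I * indicator S t \<partial>radm)"
    by (subst nn_integral_cmult_indicator) (auto simp: S_def mult.commute)
  also have "\<dots> \<le> (\<integral>\<^sup>+t. ennreal (exp a) * (\<integral>\<^sup>+w. ennreal (exp (- (a / 2) * (norm (v - sqrt t *\<^sub>R w))\<^sup>2)) \<partial>usph) \<partial>radm)"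
    using I_le by (intro nn_integral_mono) (auto simp: indicator_def)
  also have "\<dots> = ennreal (exp a) * (\<integral>\<^sup>+t. \<integral>\<^sup>+w. ennreal (exp (- (a / 2) * (norm (v - sqrt t *\<^sub>R w))\<^sup>2)) \<partial>usph \<partial>radm)"
    by (rule nn_integral_cmult) measurable
  also have "(\<integral>\<^sup>+t. \<integral>\<^sup>+w. ennreal (exp (- (a / 2) * (norm (v - sqrt t *\<^sub>R w))\<^sup>2)) \<partial>usph \<partial>radm)
    = (\<integral>\<^sup>+x. ennreal (exp (- (a / 2) * (norm (v - x))\<^sup>2)) \<partial>lborel)"
    by (rule nn_integral_polar_scaleR[symmetric]) measurable
  also have "\<dots> = (\<integral>\<^sup>+x. ennreal (exp (- (a / 2) * (norm (x::vel))\<^sup>2)) \<partial>lborel)"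
    by (rule nn_integral_reflect[of "\<lambda>x. ennreal (exp (- (a / 2) * (norm x)\<^sup>2))" v]) measurable
  also have "\<dots> = ennreal (gauss_mass (a / 2))" using a by (intro nn_integral_gauss) simp
  finally show ?thesis by (simp add: I_def ennreal_mult gauss_mass_nonneg)
qed

text \<open>A negative \<open>\<rho>\<close> is the reflected situation for \<open>-v\<close>. Both
  signs occur, because the two partners leave on opposite sides of the centre of mass.\<close>

lemma sphere_gauss:
  assumes a: "a > 0"
  shows "ennreal (\<rho>\<^sup>2) * (\<integral>\<^sup>+w. ennreal (exp (- a * (norm (v - \<rho> *\<^sub>R w))\<^sup>2)) \<partial>usph) \<le> ennreal (exp a * gauss_mass (a / 2))"
proof -
  consider "\<rho> > 0" | "\<rho> = 0" | "\<rho> < 0" by linarith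
  then show ?thesis
  proof cases
    case 3
    have "norm (- v - (- \<rho>) *\<^sub>R w) = norm (v - \<rho> *\<^sub>R w)" for w
      using norm_minus_cancel[of "v - \<rho> *\<^sub>R w"] by (simp add: algebra_simps)
    then show ?thesis using sphere_gauss_pos[OF a, of "- \<rho>" "- v"] 3 by simp
  qed (use sphere_gauss_pos[OF a] in auto)
qed

text \<open>Shared by the weights \<open>E1\<close>, \<open>E2\<close>, \<open>E3\<close> below, which belong to the terms of \<open>K\<close> with \<open>h'\<close>, \<open>h'\<^sub>*\<close>
  and \<open>h\<^sub>*\<close>: a Gaussian in the second velocity and, after averaging over the sphere, decay of order
  \<open>|x - y|\<^sup>-\<^sup>2\<close>.\<close>

definition wdecay :: "real \<Rightarrow> (vel \<times> vel \<times> vel \<Rightarrow> real) \<Rightarrow> bool" where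
  "wdecay D E \<longleftrightarrow> (\<exists>K\<ge>0. \<exists>a>0. \<forall>x y. 2 * D < (norm (x - y))\<^sup>2 \<longrightarrow>
     ennreal ((1 + norm (x - y))\<^sup>2) * (\<integral>\<^sup>+w. ennreal (E (x, y, w)) \<partial>usph) \<le> ennreal (K * exp (- a * (norm y)\<^sup>2)))"

text \<open>Up to a constant, \<open>(1 + |g|)^2\<close> is at most \<open>1 + R^2\<close>, where
  \<open>R^2 = |g|^2 - 2 * D\<close>. The constant part is paid for by the total mass of the sphere,
  the part \<open>R^2\<close> by the decay of a Gaussian averaged over a sphere of radius
  proportional to \<open>R\<close>. The centre \<open>v x y\<close> may be arbitrary because that
  decay is uniform in it.\<close>

lemma wdecay_shifted:
  fixes v :: "vel \<Rightarrow> vel \<Rightarrow> vel"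
  assumes b: "b > 0" and b': "b' > 0" and \<kappa>: "\<kappa> \<noteq> 0"
  shows "wdecay D (\<lambda>(x, y, w). exp (- (b * (norm y)\<^sup>2 + b' * (norm (v x y - (\<kappa> * sqrt ((norm (x - y))\<^sup>2 - 2 * D)) *\<^sub>R w))\<^sup>2)))"
  unfolding wdecay_def
proof (intro exI conjI allI impI)
  define K0 where "K0 = exp b' * gauss_mass (b' / 2)"
  have K0: "K0 \<ge> 0" by (simp add: K0_def gauss_mass_nonneg)
  define K where "K = (2 + 4 * \<bar>D\<bar>) * Usph + 2 / \<kappa>\<^sup>2 * K0"
  show "0 \<le> K" using K0 by (simp add: K_def)
  show "b > 0" by fact
  fix x y :: vel assume D: "2 * D < (norm (x - y))\<^sup>2"
  define R where "R = sqrt ((norm (x - y))\<^sup>2 - 2 * D)"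
  have R: "R > 0" "R\<^sup>2 = (norm (x - y))\<^sup>2 - 2 * D" using D by (auto simp: R_def)
  define I where "I = (\<integral>\<^sup>+w. ennreal (exp (- b' * (norm (v x y - (\<kappa> * R) *\<^sub>R w))\<^sup>2)) \<partial>usph)"
  have I1: "I \<le> ennreal Usph"
  proof -
    have "I \<le> (\<integral>\<^sup>+w. 1 \<partial>usph)" unfolding I_def using b' by (intro nn_integral_mono) simp
    then show ?thesis by (simp add: emeasure_usph_UNIV)
  qed
  have I2: "ennreal ((\<kappa> * R)\<^sup>2) * I \<le> ennreal K0"
    unfolding I_def K0_def by (rule sphere_gauss[OF b'])
  have "(1 + norm (x - y))\<^sup>2 \<le> 2 + 2 * (norm (x - y))\<^sup>2"
    using zero_le_power2[of "1 - norm (x - y)"] by (simp add: power2_eq_square algebra_simps)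
  also have "\<dots> \<le> (2 + 4 * \<bar>D\<bar>) + 2 / \<kappa>\<^sup>2 * (\<kappa> * R)\<^sup>2"
    using R \<kappa> by (simp add: power_mult_distrib)
  finally have "ennreal ((1 + norm (x - y))\<^sup>2) * I \<le> ennreal ((2 + 4 * \<bar>D\<bar>) + 2 / \<kappa>\<^sup>2 * (\<kappa> * R)\<^sup>2) * I"
    by (intro mult_right_mono ennreal_leI) auto
  also have "\<dots> = ennreal (2 + 4 * \<bar>D\<bar>) * I + ennreal (2 / \<kappa>\<^sup>2) * (ennreal ((\<kappa> * R)\<^sup>2) * I)"
  proof -
    have aux: "ennreal (p + q * s) * I = ennreal p * I + ennreal q * (ennreal s * I)"
      if "0 \<le> p" "0 \<le> q" "0 \<le> s" for p q s
      using that by (simp add: ennreal_mult distrib_right mult.assoc)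
    show ?thesis by (rule aux) auto
  qed
  also have "\<dots> \<le> ennreal (2 + 4 * \<bar>D\<bar>) * ennreal Usph + ennreal (2 / \<kappa>\<^sup>2) * ennreal K0"
    by (intro add_mono mult_left_mono I1 I2) auto
  also have "\<dots> = ennreal K"
    unfolding K_def using K0 by (simp add: ennreal_mult[symmetric] ennreal_plus[symmetric] del: ennreal_plus)
  finally have IK: "ennreal ((1 + norm (x - y))\<^sup>2) * I \<le> ennreal K" .
  have "(\<integral>\<^sup>+w. ennreal (exp (- (b * (norm y)\<^sup>2 + b' * (norm (v x y - (\<kappa> * R) *\<^sub>R w))\<^sup>2))) \<partial>usph)
    = (\<integral>\<^sup>+w. ennreal (exp (- b * (norm y)\<^sup>2)) * ennreal (exp (- b' * (norm (v x y - (\<kappa> * R) *\<^sub>R w))\<^sup>2)) \<partial>usph)"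
    by (intro nn_integral_cong) (simp add: ennreal_mult[symmetric] exp_add[symmetric])
  also have "\<dots> = ennreal (exp (- b * (norm y)\<^sup>2)) * I"
    unfolding I_def by (rule nn_integral_cmult) measurable
  finally have "ennreal ((1 + norm (x - y))\<^sup>2) * (\<integral>\<^sup>+w. ennreal (exp (- (b * (norm y)\<^sup>2 + b' * (norm (v x y - (\<kappa> * R) *\<^sub>R w))\<^sup>2))) \<partial>usph)
    = ennreal (exp (- b * (norm y)\<^sup>2)) * (ennreal ((1 + norm (x - y))\<^sup>2) * I)"
    by (simp add: mult_ac)
  also have "\<dots> \<le> ennreal (exp (- b * (norm y)\<^sup>2)) * ennreal K"
    by (intro mult_left_mono IK) simp
  finally show "ennreal ((1 + norm (x - y))\<^sup>2) * (\<integral>\<^sup>+w. ennreal (case (x, y, w) of (x, y, w) \<Rightarrow> exp (- (b * (norm y)\<^sup>2 + b' * (norm (v x y - (\<kappa> * sqrt ((norm (x - y))\<^sup>2 - 2 * D)) *\<^sub>R w))\<^sup>2))) \<partial>usph)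
    \<le> ennreal (K * exp (- b * (norm y)\<^sup>2))"
    by (simp add: R_def ennreal_mult'' mult.commute)
qed

text \<open>Kinetic energy splits into that of the centre of mass and that of the relative motion
  with reduced mass \<open>ma * mb / (ma + mb)\<close>. The splitting \<open>gen\<close> is used
  twice, for the outgoing and for the incoming relative velocity.\<close>

lemma post_energy:
  assumes m: "ma > 0" "mb > 0" and D: "2 * D \<le> (norm (x - y))\<^sup>2" and w: "norm w = 1"
  shows "ma * (norm (post1 ma mb D x y w))\<^sup>2 + mb * (norm (post2 ma mb D x y w))\<^sup>2
    = ma * (norm x)\<^sup>2 + mb * (norm y)\<^sup>2 - 2 * (ma * mb / (ma + mb)) * D"
proof -
  define M where "M = ma + mb"
  have M: "M > 0" using m by (simp add: M_def)
  define G where "G = cmv ma mb x y"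
  have gen: "ma * (norm (G + (mb / M) *\<^sub>R z))\<^sup>2 + mb * (norm (G - (ma / M) *\<^sub>R z))\<^sup>2
    = M * (norm G)\<^sup>2 + ma * mb / M * (norm z)\<^sup>2" for z
  proof -
    have "ma * (norm (G + (mb / M) *\<^sub>R z))\<^sup>2 + mb * (norm (G - (ma / M) *\<^sub>R z))\<^sup>2
      = (ma + mb) * (G \<bullet> G) + (ma * (mb / M)\<^sup>2 + mb * (ma / M)\<^sup>2) * (z \<bullet> z)"
      unfolding power2_norm_eq_inner
      by (simp add: inner_simps inner_commute power2_eq_square algebra_simps)
    also have "ma * (mb / M)\<^sup>2 + mb * (ma / M)\<^sup>2 = ma * mb * M / M\<^sup>2"
      by (simp add: M_def power2_eq_square add_divide_distrib algebra_simps)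
    also have "ma * mb * M / M\<^sup>2 = ma * mb / M" using M by (simp add: power2_eq_square)
    finally show ?thesis by (simp add: M_def power2_norm_eq_inner)
  qed
  have R: "(sqrt ((norm (x - y))\<^sup>2 - 2 * D))\<^sup>2 = (norm (x - y))\<^sup>2 - 2 * D" using D by simp
  have v: "(G + (mb / M) *\<^sub>R (x - y), G - (ma / M) *\<^sub>R (x - y)) = (x, y)"
  proof -
    have n: "norm (x - y) *\<^sub>R sgn (x - y) = x - y"
      by (cases "x = y") (auto simp: sgn_div_norm)
    have "ma + mb \<noteq> 0" using m by simp
    from vpair_cmv[OF this, of x y] show ?thesis
      unfolding vpair_def real_sqrt_abs abs_norm_cancel scaleR_scaleR[symmetric] n M_def G_def .
  qed
  have "ma * (norm (post1 ma mb D x y w))\<^sup>2 + mb * (norm (post2 ma mb D x y w))\<^sup>2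
    = M * (norm G)\<^sup>2 + ma * mb / M * ((norm (x - y))\<^sup>2 - 2 * D)"
    using gen[of "sqrt ((norm (x - y))\<^sup>2 - 2 * D) *\<^sub>R w"] w R
    by (simp add: post1_def post2_def M_def G_def)
  also have "\<dots> = (M * (norm G)\<^sup>2 + ma * mb / M * (norm (x - y))\<^sup>2) - 2 * (ma * mb / M) * D"
    by (simp add: algebra_simps)
  also have "M * (norm G)\<^sup>2 + ma * mb / M * (norm (x - y))\<^sup>2 = ma * (norm x)\<^sup>2 + mb * (norm y)\<^sup>2"
    using gen[of "x - y"] v by simp
  finally show ?thesis by (simp add: M_def)
qed

text \<open>Dividing the root of a product of three Maxwellians by the root of one of them leaves,
  up to constants, the root of the product of the other two; the root of
  \<open>exp (- m * |v|^2 / 2)\<close> accounts for the factors \<open>m / 4\<close>.\<close>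

definition E1 :: "real \<Rightarrow> real \<Rightarrow> real \<Rightarrow> vel \<times> vel \<times> vel \<Rightarrow> real" where
  "E1 ma mb D = (\<lambda>(x, y, w). exp (- (mb / 4 * (norm y)\<^sup>2 + mb / 4 * (norm (post2 ma mb D x y w))\<^sup>2)))"

definition E2 :: "real \<Rightarrow> real \<Rightarrow> real \<Rightarrow> vel \<times> vel \<times> vel \<Rightarrow> real" where
  "E2 ma mb D = (\<lambda>(x, y, w). exp (- (mb / 4 * (norm y)\<^sup>2 + ma / 4 * (norm (post1 ma mb D x y w))\<^sup>2)))"

definition E3 :: "real \<Rightarrow> real \<Rightarrow> real \<Rightarrow> vel \<times> vel \<times> vel \<Rightarrow> real" where
  "E3 ma mb D = (\<lambda>(x, y, w). exp (- (ma / 4 * (norm (post1 ma mb D x y w))\<^sup>2 + mb / 4 * (norm (post2 ma mb D x y w))\<^sup>2)))"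

lemma wdecay_E1:
  assumes m: "ma > 0" "mb > 0" shows "wdecay D (E1 ma mb D)"
proof -
  have "E1 ma mb D = (\<lambda>(x, y, w). exp (- (mb / 4 * (norm y)\<^sup>2 + mb / 4 * (norm (cmv ma mb x y - (ma / (ma + mb) * sqrt ((norm (x - y))\<^sup>2 - 2 * D)) *\<^sub>R w))\<^sup>2)))"
    by (simp add: E1_def post2_def)
  then show ?thesis using m by (simp only:) (intro wdecay_shifted; simp)
qed

lemma wdecay_E2:
  assumes m: "ma > 0" "mb > 0" shows "wdecay D (E2 ma mb D)"
proof -
  have "E2 ma mb D = (\<lambda>(x, y, w). exp (- (mb / 4 * (norm y)\<^sup>2 + ma / 4 * (norm (cmv ma mb x y - (- (mb / (ma + mb)) * sqrt ((norm (x - y))\<^sup>2 - 2 * D)) *\<^sub>R w))\<^sup>2)))"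
    by (simp add: E2_def post1_def)
  then show ?thesis using m by (simp only:) (intro wdecay_shifted; simp)
qed

text \<open>Neither Gaussian is in \<open>y\<close>, so conservation of energy takes the place of
  the spherical average: the weight is a constant times \<open>exp (- 2 * z)\<close>, where
  \<open>z\<close> is an eighth of \<open>ma * |x|^2 + mb * |y|^2\<close>. One factor
  \<open>exp (- z)\<close> absorbs \<open>(1 + |x - y|)^2\<close>, the other leaves the Gaussian in
  \<open>y\<close> with exponent \<open>mb / 8\<close>.\<close>

lemma wdecay_E3:
  assumes m: "ma > 0" "mb > 0" shows "wdecay D (E3 ma mb D)"
  unfolding wdecay_def
proof (intro exI conjI allI impI)
  define q where "q = min ma mb"
  have q: "q > 0" "q \<le> ma" "q \<le> mb" using m by (auto simp: q_def)
  \<comment> \<open>With \<open>q\<close> the smaller mass,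
    \<open>q * (|x|^2 + |y|^2) \<le> 8 * z\<close>, which gives \<open>32 / q\<close>; the
    exponential accounts for the energy exchanged with the internal levels.\<close>
  define K where "K = (2 + 32 / q) * exp (ma * mb / (ma + mb) * D / 2)"
  have K: "K \<ge> 0" using q by (simp add: K_def)
  show "0 \<le> K * Usph" using K by simp
  show "mb / 8 > 0" using m by simp
  fix x y :: vel assume D: "2 * D < (norm (x - y))\<^sup>2"
  have pt: "(1 + norm (x - y))\<^sup>2 * E3 ma mb D (x, y, w) \<le> K * exp (- (mb / 8) * (norm y)\<^sup>2)" if w: "norm w = 1" for w
  proof -
    define z where "z = (ma * (norm x)\<^sup>2 + mb * (norm y)\<^sup>2) / 8"
    have e: "E3 ma mb D (x, y, w) = exp (ma * mb / (ma + mb) * D / 2) * exp (- (2 * z))"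
    proof -
      have "ma / 4 * (norm (post1 ma mb D x y w))\<^sup>2 + mb / 4 * (norm (post2 ma mb D x y w))\<^sup>2
        = (ma * (norm (post1 ma mb D x y w))\<^sup>2 + mb * (norm (post2 ma mb D x y w))\<^sup>2) / 4"
        by simp
      also have "\<dots> = (8 * z - 2 * (ma * mb / (ma + mb)) * D) / 4"
        using post_energy[OF m _ w, of D x y] D by (simp add: z_def)
      also have "\<dots> = - (ma * mb / (ma + mb) * D / 2 + - (2 * z))"
      proof -
        have "(8 * z - 2 * k) / 4 = - (k / 2 + - (2 * z))" for k by (simp add: field_simps)
        from this[of "ma * mb / (ma + mb) * D"] show ?thesis by (simp only: mult.assoc)
      qed
      finally have "- (ma / 4 * (norm (post1 ma mb D x y w))\<^sup>2 + mb / 4 * (norm (post2 ma mb D x y w))\<^sup>2)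
        = ma * mb / (ma + mb) * D / 2 + - (2 * z)" by linarith
      then show ?thesis by (simp only: E3_def prod.case exp_add)
    qed
    have "norm (x - y) \<le> norm x + norm y" by (rule norm_triangle_ineq4)
    then have "(1 + norm (x - y))\<^sup>2 \<le> (1 + (norm x + norm y))\<^sup>2" by (intro power_mono) auto
    also have "\<dots> \<le> 2 + 4 * (norm x)\<^sup>2 + 4 * (norm y)\<^sup>2"
      using zero_le_power2[of "1 - (norm x + norm y)"] zero_le_power2[of "norm x - norm y"]
      by (simp add: power2_eq_square algebra_simps)
    also have "\<dots> \<le> (2 + 32 / q) * (1 + z)"
    proof -
      have "q * ((norm x)\<^sup>2 + (norm y)\<^sup>2) \<le> 8 * z"
        using q by (simp add: z_def distrib_left add_mono mult_right_mono)
      then have "4 * (norm x)\<^sup>2 + 4 * (norm y)\<^sup>2 \<le> 32 / q * z" using q by (simp add: field_simps)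
      moreover have "z \<ge> 0" using m by (simp add: z_def)
      moreover have "(2 + 32 / q) * (1 + z) = 2 + 32 / q * z + (32 / q + 2 * z)" by (simp add: algebra_simps add_divide_distrib)
      moreover have "32 / q \<ge> 0" using q by simp
      ultimately show ?thesis by linarith
    qed
    also have "\<dots> \<le> (2 + 32 / q) * exp z"
      using q by (intro mult_left_mono exp_ge_add_one_self) (simp add: add_nonneg_nonneg)
    finally have "(1 + norm (x - y))\<^sup>2 * E3 ma mb D (x, y, w) \<le> (2 + 32 / q) * exp z * E3 ma mb D (x, y, w)"
      by (intro mult_right_mono) (auto simp: e)
    also have "\<dots> = K * exp (- z)"
      by (simp add: e K_def mult_ac exp_add[symmetric])
    also have "\<dots> \<le> K * exp (- (mb / 8) * (norm y)\<^sup>2)"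
      using K m by (intro mult_left_mono) (auto simp: z_def field_simps)
    finally show ?thesis .
  qed
  have "(\<lambda>w. E3 ma mb D (x, y, w)) \<in> borel_measurable borel"
    unfolding E3_def by simp
  then have "ennreal ((1 + norm (x - y))\<^sup>2) * (\<integral>\<^sup>+w. ennreal (E3 ma mb D (x, y, w)) \<partial>usph)
    = (\<integral>\<^sup>+w. ennreal ((1 + norm (x - y))\<^sup>2) * ennreal (E3 ma mb D (x, y, w)) \<partial>usph)"
    by (intro nn_integral_cmult[symmetric]) simp
  also have "\<dots> \<le> (\<integral>\<^sup>+w. ennreal (K * exp (- (mb / 8) * (norm y)\<^sup>2)) \<partial>usph)"
    by (rule nn_integral_mono_AE, use AE_usph in eventually_elim)
       (use pt in \<open>simp add: ennreal_mult'[symmetric] ennreal_leI\<close>)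
  also have "\<dots> = ennreal (K * Usph * exp (- (mb / 8) * (norm y)\<^sup>2))"
    using K by (simp add: emeasure_usph_UNIV ennreal_mult[symmetric] mult_ac)
  finally show "ennreal ((1 + norm (x - y))\<^sup>2) * (\<integral>\<^sup>+w. ennreal (E3 ma mb D (x, y, w)) \<partial>usph)
    \<le> ennreal (K * Usph * exp (- (mb / 8) * (norm y)\<^sup>2))" .
qed

subsection \<open>The relative velocity map\<close>

text \<open>The expression set to 0 is sublinear in \<open>x\<close>. If \<open>|g| \<le> A\<close>,
  a zero is an equality case of Cauchy-Schwarz, which confines \<open>x\<close> to a line. Otherwise
  the expression is negative at \<open>-g\<close>, its zeros lie on the frontier of the convex set
  where it is nonpositive, and such frontiers are null sets.\<close>

lemma negligible_cone:
  fixes g :: vel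
  assumes A: "A > 0"
  shows "negligible {x. A * norm x + x \<bullet> g = 0}"
proof (cases "norm g \<le> A")
  case True
  have "{x. A * norm x + x \<bullet> g = 0} \<subseteq> span {g}"
  proof
    fix x assume "x \<in> {x. A * norm x + x \<bullet> g = 0}"
    then have x: "A * norm x = x \<bullet> (- g)" by simp
    have le: "x \<bullet> (- g) \<le> norm x * norm (- g)" by (rule norm_cauchy_schwarz)
    have le2: "norm x * norm g \<le> norm x * A" using True by (intro mult_left_mono) auto
    have "x \<bullet> (- g) = norm x * norm (- g)"
      using x le le2 by (simp add: mult.commute)
    then have eq: "norm x *\<^sub>R (- g) = norm (- g) *\<^sub>R x" by (simp only: norm_cauchy_schwarz_eq)
    show "x \<in> span {g}"
    proof (cases "g = 0")
      case True
      then have "A * norm x = 0" using x by simp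
      then show ?thesis using A by (simp add: span_0)
    next
      case False
      then have "x = (- (norm x / norm g)) *\<^sub>R g"
        using arg_cong[OF eq, of "\<lambda>v. (1 / norm g) *\<^sub>R v"] by simp
      then show ?thesis by (metis span_base span_scale singletonI)
    qed
  qed
  moreover have "negligible (span {g})"
  proof (rule negligible_lowdim)
    have "dim (span {g}) \<le> card {g}" by (simp only: dim_span) (rule dim_le_card', simp)
    then show "dim (span {g}) < DIM(vel)" by simp
  qed
  ultimately show ?thesis by (rule negligible_subset[rotated])
next
  case False
  define f where "f x = A * norm x + x \<bullet> g" for x
  have sub: "f (x + y) \<le> f x + f y" for x y
    using mult_left_mono[OF norm_triangle_ineq[of x y], of A] A by (simp add: f_def inner_add_left distrib_left)
  have hom: "f (c *\<^sub>R x) = c * f x" if "c \<ge> 0" for c x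
    using that by (simp add: f_def distrib_left)
  have neg: "f (- g) < 0"
  proof -
    have "norm g > 0" using False A by linarith
    then have "A * norm g < norm g * norm g" using False by (intro mult_strict_right_mono) auto
    then show ?thesis by (simp add: f_def power2_norm_eq_inner[symmetric] power2_eq_square)
  qed
  have conv: "convex {x. f x \<le> 0}"
  proof (rule convexI)
    fix x y and u v :: real assume "x \<in> {x. f x \<le> 0}" "y \<in> {x. f x \<le> 0}" "0 \<le> u" "0 \<le> v"
    then have "f (u *\<^sub>R x + v *\<^sub>R y) \<le> u * f x + v * f y" "u * f x \<le> 0" "v * f y \<le> 0"
      using sub[of "u *\<^sub>R x" "v *\<^sub>R y"] by (auto simp: hom mult_nonneg_nonpos)
    then show "u *\<^sub>R x + v *\<^sub>R y \<in> {x. f x \<le> 0}" by simp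
  qed
  have "{x. f x = 0} \<subseteq> frontier {x. f x \<le> 0}"
  proof
    fix x assume "x \<in> {x. f x = 0}"
    then have x: "f x = 0" by simp
    have "x \<notin> interior {x. f x \<le> 0}"
    proof
      assume "x \<in> interior {x. f x \<le> 0}"
      then obtain e where e: "e > 0" "ball x e \<subseteq> {x. f x \<le> 0}" unfolding mem_interior by blast
      \<comment> \<open>From an interior zero \<open>x\<close> one may step a little further away
        from \<open>-g\<close> without leaving the set. Then \<open>x\<close> lies strictly between
        the point \<open>z\<close> reached and \<open>-g\<close>, and convexity makes the value at
        \<open>x\<close> negative.\<close>
      define t where "t = e / (2 * (norm (x + g) + 1))"
      have t: "t > 0" using e by (simp add: t_def add_nonneg_pos)
      define z where "z = x + t *\<^sub>R (x + g)"
      have "norm (z - x) = t * norm (x + g)" using t by (simp add: z_def)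
      also have "\<dots> < e"
      proof -
        have "t * norm (x + g) \<le> t * (norm (x + g) + 1)" using t by simp
        also have "\<dots> = e / 2"
        proof -
          have "norm (x + g) + 1 \<noteq> 0" using norm_ge_zero[of "x + g"] by linarith
          then show ?thesis unfolding t_def by (simp add: divide_simps)
        qed
        finally show ?thesis using e by simp
      qed
      finally have "f z \<le> 0" using e(2) by (auto simp: dist_norm norm_minus_commute)
      have "(1 + t) *\<^sub>R x = z + t *\<^sub>R (- g)" by (simp add: z_def algebra_simps)
      then have "(1 + t) * f x \<le> f z + t * f (- g)"
        using sub[of z "t *\<^sub>R (- g)"] hom[of "1 + t" x] hom[of t "- g"] t by simp
      moreover have "t * f (- g) < 0" using t neg by (simp add: mult_pos_neg)
      ultimately show False using x \<open>f z \<le> 0\<close> by simp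
    qed
    moreover have "x \<in> closure {x. f x \<le> 0}" using x closure_subset by fastforce
    ultimately show "x \<in> frontier {x. f x \<le> 0}" by (simp add: frontier_def)
  qed
  then show ?thesis
    using negligible_convex_frontier[OF conv] negligible_subset unfolding f_def by blast
qed

definition relR :: "real \<Rightarrow> vel \<Rightarrow> real" where
  "relR D g = sqrt ((norm g)\<^sup>2 - 2 * D)"

definition relmap :: "real \<Rightarrow> real \<Rightarrow> vel \<Rightarrow> vel \<Rightarrow> vel" where
  "relmap \<kappa> D w g = g + (\<kappa> * relR D g) *\<^sub>R w"

text \<open>The Jacobian determinant of \<open>relmap\<close> with respect to \<open>g\<close>: the
  derivative is the identity plus a map of rank one.\<close>

definition relJ :: "real \<Rightarrow> real \<Rightarrow> vel \<Rightarrow> vel \<Rightarrow> real" where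
  "relJ \<kappa> D w g = 1 + \<kappa> * (w \<bullet> g) / relR D g"

lemma rel_measurable [measurable]:
  assumes [measurable]: "f \<in> M \<rightarrow>\<^sub>M borel" "h \<in> M \<rightarrow>\<^sub>M borel"
  shows "(\<lambda>p. relmap \<kappa> D (f p) (h p)) \<in> M \<rightarrow>\<^sub>M borel"
    and "(\<lambda>p. relJ \<kappa> D (f p) (h p)) \<in> borel_measurable M"
  unfolding relmap_def relJ_def relR_def by measurable

lemma relmap_derivative:
  assumes g: "2 * D < (norm g)\<^sup>2"
  shows "(relmap \<kappa> D w has_derivative (\<lambda>v. v + (\<kappa> * (g \<bullet> v) / relR D g) *\<^sub>R w)) (at g within S)"
proof -
  have g': "0 < g \<bullet> g - 2 * D" using g by (simp add: power2_norm_eq_inner)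
  have "((\<lambda>g. g \<bullet> g - 2 * D) has_derivative (\<lambda>v. 2 * (g \<bullet> v))) (at g within S)"
    by (auto intro!: derivative_eq_intros simp: inner_commute)
  from has_derivative_real_sqrt[OF g' this]
  have "((\<lambda>g. sqrt (g \<bullet> g - 2 * D)) has_derivative (\<lambda>v. (g \<bullet> v) / sqrt (g \<bullet> g - 2 * D))) (at g within S)"
    by (simp add: field_simps)
  then have "((\<lambda>h. h + (\<kappa> * sqrt (h \<bullet> h - 2 * D)) *\<^sub>R w) has_derivative
      (\<lambda>v. v + (\<kappa> * ((g \<bullet> v) / sqrt (g \<bullet> g - 2 * D))) *\<^sub>R w)) (at g within S)"
    by (intro has_derivative_add has_derivative_ident has_derivative_scaleR_left has_derivative_mult_right)
  then show ?thesis
    by (simp add: relmap_def[abs_def] relR_def power2_norm_eq_inner)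
qed

lemma det_rank_one:
  fixes w u :: "real^3"
  shows "det (matrix (\<lambda>v. v + (u \<bullet> v) *\<^sub>R w)) = 1 + u \<bullet> w"
  by (simp add: det_3 matrix_def axis_def inner_vec_def sum_3) algebra

text \<open>Given \<open>w\<close> and the image \<open>y\<close>, a preimage is determined by its
  value \<open>R\<close> of \<open>relR\<close>, and \<open>R\<close> solves a quadratic equation
  whose coefficients depend on \<open>y\<close> but not on the preimage. The product
  \<open>J * R\<close> is minus half the derivative of the quadratic at \<open>R\<close>, so it has
  opposite signs at two distinct roots; where \<open>J\<close> has one sign there is just one
  preimage. The factorisation used also covers \<open>\<kappa>^2 = 1\<close>, where the equation is
  linear.\<close>

lemma relmap_inj:
  assumes w: "norm w = 1"
    and g: "2 * D < (norm g)\<^sup>2" "s * relJ \<kappa> D w g > 0"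
    and h: "2 * D < (norm h)\<^sup>2" "s * relJ \<kappa> D w h > 0"
    and eq: "relmap \<kappa> D w g = relmap \<kappa> D w h"
  shows "g = h"
proof -
  define y where "y = relmap \<kappa> D w g"
  define \<sigma> where "\<sigma> = w \<bullet> y"
  have R: "relR D g > 0" "relR D h > 0" using g h by (auto simp: relR_def)
  have quad: "(\<kappa>\<^sup>2 - 1) * (relR D z)\<^sup>2 - 2 * \<kappa> * \<sigma> * relR D z + (y \<bullet> y - 2 * D) = 0"
    and lin: "relJ \<kappa> D w z * relR D z = \<kappa> * \<sigma> - (\<kappa>\<^sup>2 - 1) * relR D z"
    if z: "2 * D < (norm z)\<^sup>2" "relmap \<kappa> D w z = y" for z
  proof -
    have zy: "z = y - (\<kappa> * relR D z) *\<^sub>R w" using z(2) by (auto simp: relmap_def)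
    have Rz: "relR D z > 0" "(relR D z)\<^sup>2 = z \<bullet> z - 2 * D"
      using z(1) by (auto simp: relR_def power2_norm_eq_inner)
    have ww: "w \<bullet> w = 1" using w by (simp add: power2_norm_eq_inner[symmetric])
    have "z \<bullet> z = y \<bullet> y - 2 * (\<kappa> * relR D z) * \<sigma> + (\<kappa> * relR D z)\<^sup>2"
      by (subst zy, subst zy) (simp add: inner_simps ww \<sigma>_def inner_commute power2_eq_square algebra_simps)
    then show "(\<kappa>\<^sup>2 - 1) * (relR D z)\<^sup>2 - 2 * \<kappa> * \<sigma> * relR D z + (y \<bullet> y - 2 * D) = 0"
      using Rz(2) by algebra
    have wz: "w \<bullet> z = \<sigma> - \<kappa> * relR D z" by (subst zy) (simp add: inner_simps ww \<sigma>_def)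
    have "relJ \<kappa> D w z * relR D z = relR D z + \<kappa> * (w \<bullet> z)"
      using Rz(1) by (simp add: relJ_def distrib_right)
    then show "relJ \<kappa> D w z * relR D z = \<kappa> * \<sigma> - (\<kappa>\<^sup>2 - 1) * relR D z"
      using wz by algebra
  qed
  have yg: "relmap \<kappa> D w g = y" and yh: "relmap \<kappa> D w h = y" using eq by (auto simp: y_def)
  have "(relR D g - relR D h) * ((\<kappa>\<^sup>2 - 1) * (relR D g + relR D h) - 2 * \<kappa> * \<sigma>) = 0"
    using quad[OF g(1) yg] quad[OF h(1) yh] by (simp add: power2_eq_square algebra_simps)
  moreover have "(\<kappa>\<^sup>2 - 1) * (relR D g + relR D h) - 2 * \<kappa> * \<sigma> \<noteq> 0"
  proof
    assume "(\<kappa>\<^sup>2 - 1) * (relR D g + relR D h) - 2 * \<kappa> * \<sigma> = 0"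
    then have "relJ \<kappa> D w g * relR D g + relJ \<kappa> D w h * relR D h = 0"
      using lin[OF g(1) yg] lin[OF h(1) yh] by (simp add: algebra_simps)
    then have "(s * relJ \<kappa> D w g) * relR D g + (s * relJ \<kappa> D w h) * relR D h = 0"
      by (simp add: mult.assoc distrib_left[symmetric])
    moreover have "(s * relJ \<kappa> D w g) * relR D g > 0" "(s * relJ \<kappa> D w h) * relR D h > 0"
      using g(2) h(2) R by simp_all
    ultimately show False by linarith
  qed
  ultimately have "relR D g = relR D h" by simp
  then show ?thesis using eq by (simp add: relmap_def)
qed

text \<open>The sign of \<open>s\<close> selects a sign of the Jacobian, hence a region where the
  map is injective. Only an inequality results, as the image need not be all of space.\<close>

lemma relmap_change_of_variables_half:
  fixes f :: "vel \<Rightarrow> real"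
  assumes w: "norm w = 1" and f: "integrable lborel f" "\<And>x. 0 \<le> f x"
  shows "(\<integral>\<^sup>+g. ennreal (\<bar>relJ \<kappa> D w g\<bar> * f (relmap \<kappa> D w g)) * indicator {g. 2 * D < (norm g)\<^sup>2 \<and> s * relJ \<kappa> D w g > 0} g \<partial>lborel)
    \<le> ennreal (\<integral>x. f x \<partial>lborel)"
proof -
  define S where "S = {g. 2 * D < (norm g)\<^sup>2 \<and> s * relJ \<kappa> D w g > 0}"
  have Sb: "S \<in> sets borel" unfolding S_def by measurable
  then have S: "S \<in> sets lebesgue" by simp
  define \<phi> where "\<phi> = relmap \<kappa> D w"
  define \<phi>' where "\<phi>' g = (\<lambda>v. v + (\<kappa> * (g \<bullet> v) / relR D g) *\<^sub>R w)" for g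
  have der: "(\<phi> has_derivative \<phi>' g) (at g within S)" if "g \<in> S" for g
    unfolding \<phi>_def \<phi>'_def using that by (intro relmap_derivative) (simp add: S_def)
  have inj: "inj_on \<phi> S"
    unfolding \<phi>_def by (rule inj_onI) (rule relmap_inj[OF w], auto simp: S_def)
  have det: "\<bar>det (matrix (\<phi>' g))\<bar> = \<bar>relJ \<kappa> D w g\<bar>" for g
  proof -
    have "\<phi>' g = (\<lambda>v. v + (((\<kappa> / relR D g) *\<^sub>R g) \<bullet> v) *\<^sub>R w)"
      by (simp add: \<phi>'_def fun_eq_iff)
    then show ?thesis by (simp only: det_rank_one) (simp add: relJ_def inner_commute)
  qed
  have S': "\<phi> ` S \<in> sets lebesgue"
  proof (rule differentiable_image_in_sets_lebesgue[OF S])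
    show "\<phi> differentiable_on S"
      unfolding differentiable_on_def differentiable_def using der by blast
  qed simp
  have "set_integrable lebesgue UNIV f"
    using f(1) by (simp add: set_integrable_def integrable_completion)
  then have fS: "f absolutely_integrable_on (\<phi> ` S)"
    by (rule set_integrable_subset) (use S' in auto)
  \<comment> \<open>The change-of-variables theorem concerns functions with values in a Cartesian
    power of the reals, so \<open>f\<close> is read as a map into \<open>real^1\<close>.\<close>
  define F :: "vel \<Rightarrow> real^1" where "F x = (\<chi> i. f x)" for x
  have lin: "bounded_linear (\<lambda>a::real. (\<chi> i. a) :: real^1)"
    by (rule bounded_linear_intro[where K=1]) (auto simp: vec_eq_iff norm_vec_def L2_set_def)
  have FS: "F absolutely_integrable_on (\<phi> ` S)"
    using absolutely_integrable_linear[OF fS lin] by (simp add: F_def[abs_def] o_def)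
  have FI: "integral (\<phi> ` S) F = (\<chi> i. integral (\<phi> ` S) f)"
    using integral_linear[OF set_lebesgue_integral_eq_integral(1)[OF fS] lin] by (simp add: F_def[abs_def] o_def)
  have res: "(\<lambda>x. \<bar>det (matrix (\<phi>' x))\<bar> *\<^sub>R F (\<phi> x)) absolutely_integrable_on S"
    "integral S (\<lambda>x. \<bar>det (matrix (\<phi>' x))\<bar> *\<^sub>R F (\<phi> x)) = (\<chi> i. integral (\<phi> ` S) f)"
    using iffD2[OF has_absolute_integral_change_of_variables[OF S der inj], of F "\<chi> i. integral (\<phi> ` S) f"] FS FI
    by auto
  have "((\<lambda>x. \<bar>det (matrix (\<phi>' x))\<bar> *\<^sub>R F (\<phi> x)) has_integral (\<chi> i. integral (\<phi> ` S) f)) S"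
    using set_lebesgue_integral_eq_integral(1)[OF res(1)] res(2) by (simp add: has_integral_iff)
  from has_integral_linear[OF this bounded_linear_vec_nth[of 1]]
  have "((\<lambda>x. \<bar>relJ \<kappa> D w x\<bar> * f (\<phi> x)) has_integral (integral (\<phi> ` S) f)) S"
    by (simp add: o_def F_def det)
  then have "(\<integral>\<^sup>+g. ennreal (\<bar>relJ \<kappa> D w g\<bar> * f (\<phi> g)) * indicator S g \<partial>lborel) = ennreal (integral (\<phi> ` S) f)"
    using f(2) by (intro nn_integral_has_integral_lebesgue') auto
  also have "\<dots> \<le> ennreal (integral UNIV f)"
    using set_lebesgue_integral_eq_integral(1)[OF fS] has_integral_integral_lborel[OF f(1)] f(2)
    by (intro ennreal_leI integral_subset_le) (auto simp: has_integral_iff)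
  finally show ?thesis by (simp add: S_def \<phi>_def integral_lborel[OF f(1)])
qed

text \<open>Points with vanishing Jacobian contribute nothing thanks to the factor
  \<open>\<bar>relJ \<kappa> D w g\<bar>\<close>, and each sign contributes at most the whole
  integral of \<open>f\<close>; hence the 2.\<close>

lemma relmap_change_of_variables:
  fixes f :: "vel \<Rightarrow> real"
  assumes w: "norm w = 1" and f: "integrable lborel f" "\<And>x. 0 \<le> f x"
  shows "(\<integral>\<^sup>+g. ennreal (\<bar>relJ \<kappa> D w g\<bar> * f (relmap \<kappa> D w g)) * indicator {g. 2 * D < (norm g)\<^sup>2} g \<partial>lborel)
    \<le> ennreal (2 * (\<integral>x. f x \<partial>lborel))"
proof -
  have [measurable]: "f \<in> borel_measurable borel" using f(1) by (simp add: borel_measurable_integrable[of lborel, simplified])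
  let ?S = "\<lambda>s. {g. 2 * D < (norm g)\<^sup>2 \<and> s * relJ \<kappa> D w g > 0}"
  let ?h = "\<lambda>g. ennreal (\<bar>relJ \<kappa> D w g\<bar> * f (relmap \<kappa> D w g))"
  have [measurable]: "?S s \<in> sets borel" for s by measurable
  have "(\<integral>\<^sup>+g. ?h g * indicator {g. 2 * D < (norm g)\<^sup>2} g \<partial>lborel)
    \<le> (\<integral>\<^sup>+g. ?h g * indicator (?S 1) g + ?h g * indicator (?S (-1)) g \<partial>lborel)"
    by (intro nn_integral_mono) (auto simp: indicator_def)
  also have "\<dots> = (\<integral>\<^sup>+g. ?h g * indicator (?S 1) g \<partial>lborel) + (\<integral>\<^sup>+g. ?h g * indicator (?S (-1)) g \<partial>lborel)"
    by (rule nn_integral_add) measurable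
  also have "\<dots> \<le> ennreal (\<integral>x. f x \<partial>lborel) + ennreal (\<integral>x. f x \<partial>lborel)"
    by (intro add_mono relmap_change_of_variables_half w f)
  also have "\<dots> = ennreal (2 * (\<integral>x. f x \<partial>lborel))"
    using f(2) by (simp add: ennreal_plus[symmetric] del: ennreal_plus)
  finally show ?thesis .
qed

text \<open>For \<open>J = 0\<close> with \<open>g\<close> fixed, \<open>\<omega>\<close> lies on a circular cone, which is a null set.\<close>

lemma relJ_small:
  assumes e: "e > 0" and L: "L > 0"
  obtains d where "d > 0"
    "(\<integral>\<^sup>+g. \<integral>\<^sup>+w. indicator {(g, w). norm g \<le> L \<and> 2 * D < (norm g)\<^sup>2 \<and> \<bar>relJ \<kappa> D w g\<bar> < d} (g, w) \<partial>usph \<partial>lborel) < ennreal e"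
proof -
  define A where "A n = {(g, w). norm g \<le> L \<and> 2 * D < (norm g)\<^sup>2 \<and> \<bar>relJ \<kappa> D w g\<bar> < 1 / real (Suc n)}" for n
  have sets_eq: "sets ((lborel :: vel measure) \<Otimes>\<^sub>M usph) = sets (borel \<Otimes>\<^sub>M borel)"
    by (intro sets_pair_measure_cong) auto
  have A: "A n \<in> sets (borel \<Otimes>\<^sub>M borel)" for n
  proof -
    have "{p \<in> space (borel \<Otimes>\<^sub>M borel). norm (fst p :: vel) \<le> L \<and> 2 * D < (norm (fst p))\<^sup>2 \<and> \<bar>relJ \<kappa> D (snd p) (fst p)\<bar> < 1 / real (Suc n)} \<in> sets (borel \<Otimes>\<^sub>M borel)"
      by measurable
    then show ?thesis by (simp add: A_def case_prod_unfold space_pair_measure)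
  qed
  let ?M = "(lborel :: vel measure) \<Otimes>\<^sub>M usph"
  have em: "emeasure ?M X = (\<integral>\<^sup>+g. \<integral>\<^sup>+w. indicator X (g, w) \<partial>usph \<partial>lborel)" if "X \<in> sets (borel \<Otimes>\<^sub>M borel)" for X
    using that sets_eq by (subst usph.nn_integral_fst) auto
  \<comment> \<open>Continuity from above: the sets shrink to the zero set of the Jacobian, and they
    have finite measure because \<open>g\<close> is bounded.\<close>
  have "(\<lambda>n. emeasure ?M (A n)) \<longlonglongrightarrow> emeasure ?M (\<Inter>n. A n)"
  proof (rule Lim_emeasure_decseq)
    show "range A \<subseteq> sets ?M" using A sets_eq by auto
    show "decseq A"
      unfolding A_def decseq_def by (auto elim!: less_le_trans simp: frac_le)
    have "emeasure ?M (cball 0 L \<times> UNIV) = emeasure lborel (cball (0::vel) L) * emeasure usph UNIV"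
      by (rule usph.emeasure_pair_measure_Times) auto
    also have "\<dots> < \<infinity>"
      using emeasure_lborel_cball_finite[of "0::vel" L] by (simp add: emeasure_usph_UNIV ennreal_mult_less_top)
    finally have fin: "emeasure ?M (cball 0 L \<times> UNIV) < \<infinity>" .
    show "emeasure ?M (A n) \<noteq> \<infinity>" for n
    proof -
      have "emeasure ?M (A n) \<le> emeasure ?M (cball 0 L \<times> UNIV)"
        by (intro emeasure_mono) (auto simp: A_def sets_eq)
      then show ?thesis using fin by auto
    qed
  qed
  moreover have "emeasure ?M (\<Inter>n. A n) = 0"
  proof -
    have IA: "(\<Inter>n. A n) \<in> sets (borel \<Otimes>\<^sub>M borel)" using A by auto
    have "(\<integral>\<^sup>+w. indicator (\<Inter>n. A n) (g, w) \<partial>usph) = 0" for g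
    proof (cases "2 * D < (norm g)\<^sup>2")
      case False
      then show ?thesis by (simp add: A_def indicator_def)
    next
      case True
      then have R: "relR D g > 0" by (simp add: relR_def)
      \<comment> \<open>Multiplied by \<open>|x| * relR D g\<close>, the equation
        \<open>relJ = 0\<close> for the direction of \<open>x\<close> becomes positively homogeneous
        in \<open>x\<close>; its solutions form the cone \<open>Z\<close>.\<close>
      define Z where "Z = {x. relR D g * norm x + x \<bullet> (\<kappa> *\<^sub>R g) = 0}"
      have Zb: "Z \<in> sets borel" unfolding Z_def by measurable
      have "negligible Z" unfolding Z_def by (rule negligible_cone[OF R])
      then have "Z \<in> null_sets lborel"
        using Zb by (simp add: negligible_iff_null_sets null_sets_completion_iff)
      then have nz: "AE x in lborel. x \<notin> Z" by (rule AE_not_in)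
      have [measurable]: "{w. relJ \<kappa> D w g = 0} \<in> sets borel" by measurable
      have "(\<integral>\<^sup>+w. indicator (\<Inter>n. A n) (g, w) \<partial>usph) \<le> (\<integral>\<^sup>+w. indicator {w. relJ \<kappa> D w g = 0} w \<partial>usph)"
      proof (rule nn_integral_mono)
        fix w
        have "relJ \<kappa> D w g = 0" if "(g, w) \<in> (\<Inter>n. A n)"
        proof (rule ccontr)
          assume "relJ \<kappa> D w g \<noteq> 0"
          then obtain n where "1 / real (Suc n) < \<bar>relJ \<kappa> D w g\<bar>"
            using reals_Archimedean[of "\<bar>relJ \<kappa> D w g\<bar>"] by (auto simp: inverse_eq_divide)
          moreover have "\<bar>relJ \<kappa> D w g\<bar> < 1 / real (Suc n)" using that by (auto simp: A_def)
          ultimately show False by simp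
        qed
        then show "indicator (\<Inter>n. A n) (g, w) \<le> (indicator {w. relJ \<kappa> D w g = 0} w :: ennreal)"
          by (auto simp: indicator_def)
      qed
      also have "\<dots> = (\<integral>\<^sup>+x. ennreal (3 * indicator (ball 0 1) x) * indicator {w. relJ \<kappa> D w g = 0} (sgn x) \<partial>lborel)"
        by (rule nn_integral_usph) measurable
      also have "\<dots> = (\<integral>\<^sup>+x. 0 \<partial>(lborel :: vel measure))"
      proof (rule nn_integral_cong_AE)
        have "AE x in lborel. (x::vel) \<noteq> 0" by (rule AE_lborel_singleton)
        with nz show "AE x in lborel. ennreal (3 * indicator (ball 0 1) x) * indicator {w. relJ \<kappa> D w g = 0} (sgn x) = 0"
        proof eventually_elim
          case (elim x)
          have "relJ \<kappa> D (sgn x) g \<noteq> 0"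
          proof
            assume "relJ \<kappa> D (sgn x) g = 0"
            then have "relR D g + \<kappa> * (sgn x \<bullet> g) = 0" using R by (simp add: relJ_def field_simps)
            then have "norm x * (relR D g + \<kappa> * (sgn x \<bullet> g)) = 0" by simp
            moreover have "norm x * (sgn x \<bullet> g) = x \<bullet> g"
              using elim by (simp add: sgn_div_norm)
            ultimately have "relR D g * norm x + x \<bullet> (\<kappa> *\<^sub>R g) = 0"
              by (simp add: algebra_simps)
            then show False using elim by (simp add: Z_def)
          qed
          then show ?case by simp
        qed
      qed
      finally show ?thesis by simp
    qed
    then show ?thesis using em[OF IA] by simp
  qed
  ultimately have "(\<lambda>n. emeasure ?M (A n)) \<longlonglongrightarrow> 0" by simp
  then have "\<forall>\<^sub>F n in sequentially. emeasure ?M (A n) < ennreal e"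
    using e by (intro order_tendstoD(2)) auto
  then obtain n where n: "emeasure ?M (A n) < ennreal e" using eventually_happens by force
  show ?thesis
    by (rule that[of "1 / real (Suc n)"]) (use n em[OF A] in \<open>auto simp: A_def\<close>)
qed

subsection \<open>The collision operators as Schur operators\<close>

abbreviation Ym :: "(vel \<times> vel) measure" where
  "Ym \<equiv> lborel \<Otimes>\<^sub>M usph"

text \<open>Every argument of \<open>h\<close> in \<open>K\<close> has this form, with
  \<open>g = x - y\<close>, so that one change of variables treats the three terms together.\<close>

definition etaM :: "real \<Rightarrow> real \<Rightarrow> real \<Rightarrow> vel \<times> vel \<times> vel \<Rightarrow> vel" where
  "etaM c \<kappa> D = (\<lambda>(x, y, w). x - c *\<^sub>R relmap \<kappa> D w (x - y))"

definition kerM :: "(vel \<times> vel \<times> vel \<Rightarrow> real) \<Rightarrow> (real \<Rightarrow> real \<Rightarrow> real) \<Rightarrow> vel \<times> vel \<times> vel \<Rightarrow> real" where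
  "kerM E B = (\<lambda>(x, y, w). E (x, y, w) * kin B x y w)"

lemma sets_Ym: "sets Ym = sets (borel \<Otimes>\<^sub>M borel)"
  and sets_bYm: "sets (borel \<Otimes>\<^sub>M Ym) = sets (borel \<Otimes>\<^sub>M borel \<Otimes>\<^sub>M borel)"
  by (intro sets_pair_measure_cong; simp)+

interpretation Ym: sigma_finite_measure Ym
proof -
  interpret pair_sigma_finite "lborel :: vel measure" usph by unfold_locales
  show "sigma_finite_measure Ym" by unfold_locales
qed

lemma etaM_measurable [measurable]: "etaM c \<kappa> D \<in> borel \<Otimes>\<^sub>M Ym \<rightarrow>\<^sub>M borel"
  unfolding etaM_def by measurable

lemma nn_integral_Ym:
  assumes [measurable]: "f \<in> borel_measurable (borel \<Otimes>\<^sub>M borel)"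
  shows "(\<integral>\<^sup>+p. f p \<partial>Ym) = (\<integral>\<^sup>+y. \<integral>\<^sup>+w. f (y, w) \<partial>usph \<partial>lborel)"
  by (rule usph.nn_integral_fst[symmetric]) measurable

text \<open>A channel with the Gaussian weight of one term of \<open>K\<close>, abstracted to a
  weight that is at most 1 and has the decay \<open>wdecay\<close>; the three terms are then
  estimated at once.\<close>

locale kernel = channel ma mb D B C for ma mb D B C +
  fixes E :: "vel \<times> vel \<times> vel \<Rightarrow> real" and c \<kappa> :: real
  assumes E_meas [measurable]: "E \<in> borel_measurable (borel \<Otimes>\<^sub>M borel \<Otimes>\<^sub>M borel)"
    and E_nonneg: "0 \<le> E p" and E_le1: "E p \<le> 1"
    and c: "c > 0" and decay: "wdecay D E"
begin

abbreviation "ker \<equiv> kerM E B"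
abbreviation "eta \<equiv> etaM c \<kappa> D"

lemma ker_measurable [measurable]: "ker \<in> borel_measurable (borel \<Otimes>\<^sub>M borel \<Otimes>\<^sub>M borel)"
  unfolding kerM_def by measurable

lemma ker_measurable' [measurable]: "ker \<in> borel_measurable (borel \<Otimes>\<^sub>M Ym)"
  using ker_measurable by (simp cong: measurable_cong_sets add: sets_bYm)

lemma ker_nonneg: "0 \<le> ker p"
  by (cases p) (simp add: kerM_def E_nonneg kin_nonneg)

lemma ker_zero: "\<not> 2 * D < (norm (x - y))\<^sup>2 \<or> x = y \<Longrightarrow> ker (x, y, w) = 0"
  by (auto simp: kerM_def kin_def B_zero)

lemma kin_le: "x \<noteq> y \<Longrightarrow> kin B x y w \<le> C * (1 + norm (x - y))\<^sup>2 / norm (x - y)"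
  using B_le[of "(norm (x - y))\<^sup>2"] by (simp add: kin_def)

text \<open>The decay of the weight cancels the growth \<open>(1 + |x - y|)^2\<close> of the
  collision kernel. What survives is a Gaussian in \<open>y\<close> times the Newton kernel.\<close>

lemma sphere_row:
  obtains K a where "K \<ge> 0" "a > 0"
    "\<And>x y. (\<integral>\<^sup>+w. ennreal (ker (x, y, w)) \<partial>usph) \<le> ennreal (K * exp (- a * (norm y)\<^sup>2) / norm (x - y))"
proof -
  obtain K a where K: "K \<ge> 0" and a: "a > 0"
    and dec: "\<And>x y. 2 * D < (norm (x - y))\<^sup>2 \<Longrightarrow>
     ennreal ((1 + norm (x - y))\<^sup>2) * (\<integral>\<^sup>+w. ennreal (E (x, y, w)) \<partial>usph) \<le> ennreal (K * exp (- a * (norm y)\<^sup>2))"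
    using decay unfolding wdecay_def by blast
  have "(\<integral>\<^sup>+w. ennreal (ker (x, y, w)) \<partial>usph) \<le> ennreal (C * K * exp (- a * (norm y)\<^sup>2) / norm (x - y))" for x y
  proof (cases "2 * D < (norm (x - y))\<^sup>2 \<and> x \<noteq> y")
    case False
    then show ?thesis using ker_zero[of x y] by auto
  next
    case True
    let ?r = "norm (x - y)"
    have r: "?r > 0" using True by simp
    have "(\<integral>\<^sup>+w. ennreal (ker (x, y, w)) \<partial>usph) \<le> (\<integral>\<^sup>+w. ennreal (C / ?r) * (ennreal ((1 + ?r)\<^sup>2) * ennreal (E (x, y, w))) \<partial>usph)"
    proof (rule nn_integral_mono)
      fix w
      have split: "ennreal (p * (q * z)) = ennreal p * (ennreal q * ennreal z)" if "0 \<le> p" "0 \<le> q" "0 \<le> z" for p q z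
        using that by (simp add: ennreal_mult)
      have "ker (x, y, w) \<le> E (x, y, w) * (C * (1 + ?r)\<^sup>2 / ?r)"
        unfolding kerM_def prod.case using True by (intro mult_left_mono kin_le E_nonneg) auto
      also have "\<dots> = C / ?r * ((1 + ?r)\<^sup>2 * E (x, y, w))" by simp
      finally have "ennreal (ker (x, y, w)) \<le> ennreal \<dots>" by (rule ennreal_leI)
      also have "\<dots> = ennreal (C / ?r) * (ennreal ((1 + ?r)\<^sup>2) * ennreal (E (x, y, w)))"
        using C r E_nonneg by (intro split) auto
      finally show "ennreal (ker (x, y, w)) \<le> \<dots>" .
    qed
    also have "\<dots> = ennreal (C / ?r) * (ennreal ((1 + ?r)\<^sup>2) * (\<integral>\<^sup>+w. ennreal (E (x, y, w)) \<partial>usph))"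
      by (simp add: nn_integral_cmult)
    also have "\<dots> \<le> ennreal (C / ?r) * ennreal (K * exp (- a * (norm y)\<^sup>2))"
      using True by (intro mult_left_mono dec) auto
    also have "\<dots> = ennreal (C * K * exp (- a * (norm y)\<^sup>2) / ?r)"
      using C K r by (simp add: ennreal_mult[symmetric] mult_ac)
    finally show ?thesis .
  qed
  then show ?thesis using that[of "C * K" a] C K a by auto
qed

lemma row_bound:
  obtains A where "A \<ge> 0" "\<And>x. (\<integral>\<^sup>+p. ennreal (ker (x, p)) \<partial>Ym) \<le> ennreal A"
proof -
  obtain K a where K: "K \<ge> 0" and a: "a > 0"
    and row: "\<And>x y. (\<integral>\<^sup>+w. ennreal (ker (x, y, w)) \<partial>usph) \<le> ennreal (K * exp (- a * (norm y)\<^sup>2) / norm (x - y))"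
    using sphere_row by blast
  have "(\<integral>\<^sup>+p. ennreal (ker (x, p)) \<partial>Ym) \<le> ennreal (K * (gauss_mass a / 1 + Usph * 1\<^sup>2 / 2))" for x
  proof -
    have "(\<integral>\<^sup>+p. ennreal (ker (x, p)) \<partial>Ym) = (\<integral>\<^sup>+y. \<integral>\<^sup>+w. ennreal (ker (x, y, w)) \<partial>usph \<partial>lborel)"
      by (rule nn_integral_Ym) measurable
    also have "\<dots> \<le> (\<integral>\<^sup>+y. ennreal K * ennreal (exp (- a * (norm y)\<^sup>2) / norm (x - y)) \<partial>lborel)"
      using K by (intro nn_integral_mono order_trans[OF row]) (simp add: ennreal_mult[symmetric])
    also have "\<dots> = ennreal K * (\<integral>\<^sup>+y. ennreal (exp (- a * (norm y)\<^sup>2) / norm (x - y)) \<partial>lborel)"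
      by (rule nn_integral_cmult) measurable
    also have "\<dots> \<le> ennreal K * ennreal (gauss_mass a / 1 + Usph * 1\<^sup>2 / 2)"
      by (intro mult_left_mono nn_integral_gauss_newton a) auto
    also have "\<dots> = ennreal (K * (gauss_mass a / 1 + Usph * 1\<^sup>2 / 2))"
      using K by (simp add: ennreal_mult' )
    finally show ?thesis .
  qed
  then show ?thesis using that[of "K * (gauss_mass a / 1 + Usph * 1\<^sup>2 / 2)"] K gauss_mass_nonneg[of a] by auto
qed

text \<open>Cauchy-Schwarz, with the square root of the Jacobian moved from the kernel to
  \<open>f\<close>. For each direction the integral over \<open>y\<close> of the Jacobian times the
  square of \<open>f\<close> is controlled by the change of variables; the kernel divided by the
  root of the Jacobian is bounded on \<open>G\<close>, where \<open>y\<close> stays in a ball about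
  \<open>x\<close>.\<close>

lemma truncated_functional:
  assumes L: "L > 0" and d: "d > 0" and \<beta>: "\<beta> \<ge> 0"
    and G: "G \<in> sets (borel \<Otimes>\<^sub>M borel \<Otimes>\<^sub>M borel)"
    and G_sub: "\<And>y w. (x, y, w) \<in> G \<Longrightarrow> norm (x - y) < L \<and> 2 * D < (norm (x - y))\<^sup>2 \<and> d \<le> \<bar>relJ \<kappa> D w (x - y)\<bar>
       \<and> ker (x, y, w) \<le> \<beta>"
    and f: "sqint lborel f"
  shows "(\<integral>\<^sup>+p. ennreal \<bar>f (eta (x, p)) * (ker (x, p) * indicator G (x, p))\<bar> \<partial>Ym)\<^sup>2
    \<le> ennreal (2 * Usph / c ^ 3 * (\<beta>\<^sup>2 / d * measure lborel (ball (0::vel) L) * Usph) * (sqn lborel f))"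
proof -
  note G[measurable]
  have GY[measurable]: "G \<in> sets (borel \<Otimes>\<^sub>M Ym)" using G sets_bYm by simp
  have [measurable]: "f \<in> borel_measurable borel" using sqint_measurable[OF f] by simp
  define J where "J p = \<bar>relJ \<kappa> D (snd p) (x - fst p)\<bar>" for p :: "vel \<times> vel"
  define H where "H p = (if 2 * D < (norm (x - fst p))\<^sup>2 then 1 else 0 :: real)" for p :: "vel \<times> vel"
  have [measurable]: "J \<in> borel_measurable Ym" "H \<in> borel_measurable Ym"
    unfolding J_def H_def by measurable
  have [measurable]: "J \<in> borel_measurable (borel \<Otimes>\<^sub>M borel)" "H \<in> borel_measurable (borel \<Otimes>\<^sub>M borel)"
    unfolding J_def H_def by measurable
  define u where "u p = \<bar>f (eta (x, p))\<bar> * sqrt (J p) * H p" for p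
  define v where "v p = ker (x, p) * indicator G (x, p) / sqrt (J p)" for p
  have [measurable]: "u \<in> borel_measurable Ym" "v \<in> borel_measurable Ym"
    unfolding u_def v_def by measurable
  have u0: "0 \<le> u p" and v0: "0 \<le> v p" for p
    by (auto simp: u_def v_def J_def H_def ker_nonneg)
  have GJ: "d \<le> J p" "H p = 1" "norm (x - fst p) < L" "ker (x, p) \<le> \<beta>" if "(x, p) \<in> G" for p
    using G_sub[of "fst p" "snd p"] that by (auto simp: J_def H_def)
  have uv: "\<bar>f (eta (x, p)) * (ker (x, p) * indicator G (x, p))\<bar> = u p * v p" for p
  proof (cases "(x, p) \<in> G")
    case True
    then have "sqrt (J p) > 0" using GJ(1)[OF True] d by simp
    then show ?thesis using True GJ[OF True] ker_nonneg[of "(x, p)"] by (simp add: u_def v_def abs_mult)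
  qed (simp add: u_def v_def)
  have "(\<integral>\<^sup>+p. ennreal \<bar>f (eta (x, p)) * (ker (x, p) * indicator G (x, p))\<bar> \<partial>Ym)\<^sup>2
    = (\<integral>\<^sup>+p. ennreal (u p) * ennreal (v p) \<partial>Ym)\<^sup>2"
    unfolding uv using u0 v0 by (simp add: ennreal_mult)
  also have "\<dots> \<le> (\<integral>\<^sup>+p. (ennreal (u p))\<^sup>2 \<partial>Ym) * (\<integral>\<^sup>+p. (ennreal (v p))\<^sup>2 \<partial>Ym)"
    by (rule Cauchy_Schwarz_nn_integral) measurable
  also have "\<dots> \<le> ennreal (2 * Usph / c ^ 3 * (sqn lborel f)) * ennreal (\<beta>\<^sup>2 / d * measure lborel (ball (0::vel) L) * Usph)"
  proof (rule mult_mono)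
    have "(\<integral>\<^sup>+p. (ennreal (v p))\<^sup>2 \<partial>Ym) \<le> (\<integral>\<^sup>+p. ennreal (\<beta>\<^sup>2 / d) * indicator (ball x L \<times> UNIV) p \<partial>Ym)"
    proof (rule nn_integral_mono)
      fix p :: "vel \<times> vel"
      show "(ennreal (v p))\<^sup>2 \<le> ennreal (\<beta>\<^sup>2 / d) * indicator (ball x L \<times> UNIV) p"
      proof (cases "(x, p) \<in> G")
        case True
        have "(v p)\<^sup>2 = (ker (x, p))\<^sup>2 / J p"
          using True GJ(1)[OF True] d by (simp add: v_def power_divide)
        also have "\<dots> \<le> \<beta>\<^sup>2 / d"
          using GJ(1,4)[OF True] d ker_nonneg[of "(x, p)"] by (intro frac_le power_mono) auto
        finally have "(v p)\<^sup>2 \<le> \<beta>\<^sup>2 / d" .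
        moreover have "p \<in> ball x L \<times> UNIV"
          using GJ(3)[OF True] by (cases p) (simp add: dist_norm)
        ultimately show ?thesis using v0 by (simp add: ennreal_power ennreal_leI)
      qed (simp add: v_def)
    qed
    also have "\<dots> = ennreal (\<beta>\<^sup>2 / d) * emeasure Ym (ball x L \<times> UNIV)"
      by (rule nn_integral_cmult_indicator) (simp add: sets_Ym)
    also have "emeasure Ym (ball x L \<times> UNIV) = emeasure lborel (ball x L) * emeasure usph UNIV"
      by (rule usph.emeasure_pair_measure_Times) auto
    also have "emeasure lborel (ball x L) = ennreal (measure lborel (ball (0::vel) L))"
    proof -
      have "indicator (ball 0 L) (x - y) = (indicator (ball x L) y :: ennreal)" for y
        by (simp add: indicator_def dist_norm norm_minus_commute)
      then have "emeasure lborel (ball x L) = (\<integral>\<^sup>+y. indicator (ball 0 L) (x - y) \<partial>lborel)"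
        by simp
      also have "\<dots> = (\<integral>\<^sup>+y. indicator (ball (0::vel) L) y \<partial>lborel)"
        by (rule nn_integral_reflect) measurable
      finally show ?thesis
        using emeasure_lborel_ball_finite[of "0::vel" L] by (simp add: emeasure_eq_ennreal_measure)
    qed
    also have "ennreal (\<beta>\<^sup>2 / d) * (ennreal (measure lborel (ball (0::vel) L)) * emeasure usph UNIV)
      = ennreal (\<beta>\<^sup>2 / d * measure lborel (ball (0::vel) L) * Usph)"
      using d by (simp add: emeasure_usph_UNIV ennreal_mult[symmetric] mult.assoc)
    finally show "(\<integral>\<^sup>+p. (ennreal (v p))\<^sup>2 \<partial>Ym) \<le> ennreal (\<beta>\<^sup>2 / d * measure lborel (ball (0::vel) L) * Usph)" .
    \<comment> \<open>The argument of \<open>f\<close> is \<open>x - c *\<^sub>R z\<close> with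
      \<open>z\<close> a value of \<open>relmap\<close>; the affine passage from \<open>z\<close> to
      this point accounts for \<open>c ^ 3\<close>.\<close>
    define F where "F z = (f (x - c *\<^sub>R z))\<^sup>2" for z
    have [measurable]: "F \<in> borel_measurable borel" unfolding F_def by measurable
    have cF: "ennreal (sqn lborel f) = ennreal (c ^ 3) * (\<integral>\<^sup>+z. ennreal (F z) \<partial>lborel)"
      using nn_integral_affine[of "\<lambda>x. ennreal ((f x)\<^sup>2)" "- c" x] c
      by (simp add: nn_integral_sqint[OF f] F_def)
    have Ffin: "(\<integral>\<^sup>+z. ennreal (F z) \<partial>lborel) < \<infinity>"
    proof (rule ccontr)
      assume "\<not> ?thesis"
      then have "(\<integral>\<^sup>+z. ennreal (F z) \<partial>lborel) = \<infinity>" by (simp add: less_top[symmetric])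
      then have "ennreal (sqn lborel f) = \<infinity>"
        unfolding cF using c by (simp add: ennreal_mult_top)
      then show False by simp
    qed
    have Fi: "integrable lborel F"
      using Ffin by (intro integrableI_nonneg) (auto simp: F_def)
    have FI: "(\<integral>z. F z \<partial>lborel) = (sqn lborel f) / c ^ 3"
    proof -
      have "(\<integral>\<^sup>+z. ennreal (F z) \<partial>lborel) = ennreal (\<integral>z. F z \<partial>lborel)"
        by (rule nn_integral_eq_integral[OF Fi]) (simp add: F_def)
      then have "ennreal (sqn lborel f) = ennreal (c ^ 3 * (\<integral>z. F z \<partial>lborel))"
        using cF c by (simp add: ennreal_mult')
      moreover have "0 \<le> (\<integral>z. F z \<partial>lborel)" by (simp add: F_def)
      ultimately have "(sqn lborel f) = c ^ 3 * (\<integral>z. F z \<partial>lborel)"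
        using c by (subst (asm) ennreal_inj) auto
      then show ?thesis using c by simp
    qed
    have "(\<integral>\<^sup>+p. (ennreal (u p))\<^sup>2 \<partial>Ym) = (\<integral>\<^sup>+y. \<integral>\<^sup>+w. (ennreal (u (y, w)))\<^sup>2 \<partial>usph \<partial>lborel)"
      by (rule usph.nn_integral_fst[symmetric]) measurable
    also have "\<dots> = (\<integral>\<^sup>+w. \<integral>\<^sup>+y. (ennreal (u (y, w)))\<^sup>2 \<partial>lborel \<partial>usph)"
    proof -
      interpret pair_sigma_finite "lborel :: vel measure" usph by unfold_locales
      show ?thesis by (rule Fubini'[symmetric]) simp
    qed
    also have "\<dots> \<le> (\<integral>\<^sup>+w. ennreal (2 * (\<integral>z. F z \<partial>lborel)) \<partial>usph)"
    proof (rule nn_integral_mono_AE, use AE_usph in eventually_elim)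
      fix w :: vel assume w: "norm w = 1"
      define h where "h g = ennreal (\<bar>relJ \<kappa> D w g\<bar> * F (relmap \<kappa> D w g)) * indicator {g. 2 * D < (norm g)\<^sup>2} g" for g
      have [measurable]: "{g::vel. 2 * D < (norm g)\<^sup>2} \<in> sets borel" by measurable
      have [measurable]: "h \<in> borel_measurable borel" unfolding h_def by measurable
      have "(ennreal (u (y, w)))\<^sup>2 = h (x - y)" for y
        using u0 by (simp add: ennreal_power u_def h_def etaM_def F_def J_def H_def power_mult_distrib mult_ac)
      then have "(\<integral>\<^sup>+y. (ennreal (u (y, w)))\<^sup>2 \<partial>lborel) = (\<integral>\<^sup>+y. h (x - y) \<partial>lborel)" by simp
      also have "\<dots> = (\<integral>\<^sup>+g. h g \<partial>lborel)" by (rule nn_integral_reflect) measurable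
      also have "\<dots> \<le> ennreal (2 * (\<integral>z. F z \<partial>lborel))"
        unfolding h_def by (rule relmap_change_of_variables[OF w Fi]) (simp add: F_def)
      finally show "(\<integral>\<^sup>+y. (ennreal (u (y, w)))\<^sup>2 \<partial>lborel) \<le> ennreal (2 * (\<integral>z. F z \<partial>lborel))" .
    qed
    also have "\<dots> = ennreal (2 * Usph / c ^ 3 * (sqn lborel f))"
      using c by (simp add: FI emeasure_usph_UNIV ennreal_mult[symmetric] mult_ac)
    finally show "(\<integral>\<^sup>+p. (ennreal (u p))\<^sup>2 \<partial>Ym) \<le> ennreal (2 * Usph / c ^ 3 * (sqn lborel f))" .
  qed auto
  also have "\<dots> = ennreal (2 * Usph / c ^ 3 * (\<beta>\<^sup>2 / d * measure lborel (ball (0::vel) L) * Usph) * (sqn lborel f))"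
    using c d by (simp add: ennreal_mult[symmetric] mult_ac)
  finally show ?thesis .
qed

text \<open>Four pieces are removed, each costing at most \<open>e / 4\<close> in every row:
  relative speeds of at least \<open>L\<close>, relative speeds below \<open>\<delta>\<close>,
  points \<open>x\<close> far out, and Jacobians below \<open>d\<close>. If
  \<open>|x| \<ge> N = L + T\<close> and \<open>|x - y| < L\<close>, then
  \<open>|y| \<ge> T\<close>, so the third piece is small by the Gaussian in
  \<open>y\<close>.\<close>

lemma truncation:
  assumes e: "e > 0"
  shows "\<exists>G\<in>sets (borel \<Otimes>\<^sub>M Ym). \<exists>c'\<ge>0. \<exists>R.
        (\<forall>x. (\<integral>\<^sup>+p. ennreal (ker (x, p) * indicator (- G) (x, p)) \<partial>Ym) \<le> ennreal e) \<and>
        (\<forall>x f. sqint lborel f \<longrightarrow> (\<integral>\<^sup>+p. ennreal \<bar>f (eta (x, p)) * (ker (x, p) * indicator G (x, p))\<bar> \<partial>Ym)\<^sup>2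
          \<le> ennreal (c' * indicator (ball 0 R) x * (sqn lborel f)))"
proof -
  obtain K a where K: "K \<ge> 0" and a: "a > 0"
    and row: "\<And>x y. (\<integral>\<^sup>+w. ennreal (ker (x, y, w)) \<partial>usph) \<le> ennreal (K * exp (- a * (norm y)\<^sup>2) / norm (x - y))"
    using sphere_row by blast
  \<comment> \<open>At relative speeds of at least \<open>L\<close> the Newton kernel is at most
    \<open>1 / L\<close>; the added 1 keeps \<open>L\<close> positive.\<close>
  define L where "L = 4 * K * gauss_mass a / e + 1"
  have L: "L > 0" using K gauss_mass_nonneg[of a] e by (simp add: L_def add_nonneg_pos)
  have L1: "K / L * gauss_mass a \<le> e / 4"
  proof -
    have "K * gauss_mass a \<le> e / 4 * L" using e by (simp add: L_def field_simps)
    then show ?thesis using L by (simp add: field_simps)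
  qed
  \<comment> \<open>Over a ball of radius \<open>\<delta>\<close> the Newton kernel has integral
    \<open>Usph * \<delta>^2 / 2\<close>, and the Gaussian is at most 1.\<close>
  define \<delta> where "\<delta> = sqrt (e / (2 * (K * Usph + 1)))"
  have KU: "K * Usph + 1 > 0" using K by (simp add: add_nonneg_pos)
  have \<delta>: "\<delta> > 0" using e KU by (simp add: \<delta>_def)
  have \<delta>1: "K * (Usph * \<delta>\<^sup>2 / 2) \<le> e / 4"
  proof -
    have "\<delta>\<^sup>2 = e / (2 * (K * Usph + 1))" using e KU by (simp add: \<delta>_def)
    then have "K * (Usph * \<delta>\<^sup>2 / 2) = e / 4 * (K * Usph / (K * Usph + 1))" by simp
    also have "\<dots> \<le> e / 4 * 1" using e KU by (intro mult_left_mono) auto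
    finally show ?thesis by simp
  qed
  define Q where "Q = K * (Usph * L\<^sup>2 / 2)"
  have Q: "Q \<ge> 0" using K by (simp add: Q_def)
  \<comment> \<open>\<open>Q\<close> bounds the row over relative speeds below \<open>L\<close> with
    the Gaussian replaced by 1; by \<open>1 + a * T^2 \<le> exp (a * T^2)\<close> this
    \<open>T\<close> makes the Gaussian small enough to compensate it.\<close>
  define T where "T = sqrt (4 * Q / (e * a))"
  have T: "T \<ge> 0" "T\<^sup>2 = 4 * Q / (e * a)" using Q e a by (auto simp: T_def)
  have T1: "exp (- a * T\<^sup>2) * Q \<le> e / 4"
  proof -
    have "a * T\<^sup>2 = 4 * Q / e" using T a by simp
    moreover have "1 + a * T\<^sup>2 \<le> exp (a * T\<^sup>2)" by (rule exp_ge_add_one_self)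
    ultimately have "1 + 4 * Q / e \<le> exp (a * T\<^sup>2)" by simp
    then have "e / 4 + Q \<le> e / 4 * exp (a * T\<^sup>2)" using e by (simp add: field_simps)
    then have "Q \<le> e / 4 * exp (a * T\<^sup>2)" using e by linarith
    then have "exp (- a * T\<^sup>2) * Q \<le> exp (- a * T\<^sup>2) * (e / 4 * exp (a * T\<^sup>2))"
      by (intro mult_left_mono) auto
    also have "\<dots> = e / 4" by (simp add: exp_minus)
    finally show ?thesis .
  qed
  define N where "N = L + T"
  define \<beta> where "\<beta> = C * (1 + L)\<^sup>2 / \<delta>"
  have \<beta>: "\<beta> \<ge> 0" using C \<delta> by (simp add: \<beta>_def)
  \<comment> \<open>The threshold \<open>d\<close> is chosen last: it has to compensate the bound
    \<open>\<beta>\<close> of the kernel, which depends on \<open>L\<close> and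
    \<open>\<delta>\<close>.\<close>
  have "e / (4 * (\<beta> + 1)) > 0" using e \<beta> by simp
  then obtain d where d: "d > 0"
    and small: "(\<integral>\<^sup>+g. \<integral>\<^sup>+w. indicator {(g, w). norm g \<le> L \<and> 2 * D < (norm g)\<^sup>2 \<and> \<bar>relJ \<kappa> D w g\<bar> < d} (g, w) \<partial>usph \<partial>lborel)
      < ennreal (e / (4 * (\<beta> + 1)))"
    using relJ_small[OF _ L, of "e / (4 * (\<beta> + 1))" D \<kappa>] by blast
  define G where "G = {(x, y, w). norm x < N \<and> \<delta> \<le> norm (x - y) \<and> norm (x - y) < L \<and> 2 * D < (norm (x - y))\<^sup>2 \<and> d \<le> \<bar>relJ \<kappa> D w (x - y)\<bar>}"
  have G: "G \<in> sets (borel \<Otimes>\<^sub>M borel \<Otimes>\<^sub>M borel)"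
  proof -
    have "{p \<in> space (borel \<Otimes>\<^sub>M borel \<Otimes>\<^sub>M borel). norm (fst p :: vel) < N \<and> \<delta> \<le> norm (fst p - fst (snd p)) \<and> norm (fst p - fst (snd p)) < L
       \<and> 2 * D < (norm (fst p - fst (snd p)))\<^sup>2 \<and> d \<le> \<bar>relJ \<kappa> D (snd (snd p)) (fst p - fst (snd p))\<bar>} \<in> sets (borel \<Otimes>\<^sub>M borel \<Otimes>\<^sub>M borel)"
      by measurable
    then show ?thesis by (simp add: G_def case_prod_unfold space_pair_measure)
  qed
  note G[measurable]
  have ker_\<beta>: "ker (x, y, w) \<le> \<beta>" if "\<delta> \<le> norm (x - y)" "norm (x - y) < L" for x y w
  proof -
    have xy: "x \<noteq> y" using that \<delta> by auto
    have "ker (x, y, w) \<le> 1 * kin B x y w"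
      unfolding kerM_def prod.case by (intro mult_right_mono E_le1 kin_nonneg)
    also have "\<dots> \<le> C * (1 + norm (x - y))\<^sup>2 / norm (x - y)" using kin_le[OF xy] by simp
    also have "\<dots> \<le> \<beta>"
      unfolding \<beta>_def using that C \<delta> L by (intro frac_le mult_left_mono power_mono) auto
    finally show ?thesis .
  qed
  define A where "A = {(g::vel, w::vel). norm g \<le> L \<and> 2 * D < (norm g)\<^sup>2 \<and> \<bar>relJ \<kappa> D w g\<bar> < d}"
  have A[measurable]: "A \<in> sets (borel \<Otimes>\<^sub>M borel)"
  proof -
    have "{p \<in> space (borel \<Otimes>\<^sub>M borel). norm (fst p :: vel) \<le> L \<and> 2 * D < (norm (fst p))\<^sup>2 \<and> \<bar>relJ \<kappa> D (snd p) (fst p)\<bar> < d} \<in> sets (borel \<Otimes>\<^sub>M borel)"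
      by measurable
    then show ?thesis by (simp add: A_def case_prod_unfold space_pair_measure)
  qed
  have rest: "(\<integral>\<^sup>+p. ennreal (ker (x, p) * indicator (- G) (x, p)) \<partial>Ym) \<le> ennreal e" for x
  proof -
    define P where "P y = (L \<le> norm (x - y) \<or> norm (x - y) < \<delta> \<or> (N \<le> norm x \<and> norm (x - y) < L))" for y
    have [measurable]: "Measurable.pred borel P" unfolding P_def by measurable
    have "(\<integral>\<^sup>+p. ennreal (ker (x, p) * indicator (- G) (x, p)) \<partial>Ym)
      \<le> (\<integral>\<^sup>+p. ennreal (ker (x, p)) * indicator {y. P y} (fst p) + ennreal \<beta> * indicator A (x - fst p, snd p) \<partial>Ym)"
    proof (rule nn_integral_mono)
      fix p :: "vel \<times> vel"
      obtain y w where p: "p = (y, w)" by (cases p)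
      have "ennreal (ker (x, y, w) * indicator (- G) (x, y, w)) \<le> ennreal (ker (x, y, w)) * indicator {y. P y} y + ennreal \<beta> * indicator A (x - y, w)"
      proof (cases "P y \<or> (x, y, w) \<in> G \<or> \<not> 2 * D < (norm (x - y))\<^sup>2")
        case True
        then show ?thesis using ker_zero[of x y w] by (auto simp: indicator_def)
      next
        case False
        then have "(x - y, w) \<in> A" "\<delta> \<le> norm (x - y)" "norm (x - y) < L" by (auto simp: P_def A_def G_def)
        then show ?thesis using ker_\<beta>[of x y w] False by (simp add: ennreal_leI)
      qed
      then show "ennreal (ker (x, p) * indicator (- G) (x, p)) \<le> ennreal (ker (x, p)) * indicator {y. P y} (fst p) + ennreal \<beta> * indicator A (x - fst p, snd p)"
        by (simp add: p)
    qed
    also have "\<dots> = (\<integral>\<^sup>+p. ennreal (ker (x, p)) * indicator {y. P y} (fst p) \<partial>Ym) + (\<integral>\<^sup>+p. ennreal \<beta> * indicator A (x - fst p, snd p) \<partial>Ym)"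
      by (rule nn_integral_add) measurable
    also have "\<dots> \<le> ennreal (3 * e / 4) + ennreal (e / 4)"
    proof (rule add_mono)
      have "(\<integral>\<^sup>+p. ennreal (ker (x, p)) * indicator {y. P y} (fst p) \<partial>Ym)
        = (\<integral>\<^sup>+y. \<integral>\<^sup>+w. indicator {y. P y} y * ennreal (ker (x, y, w)) \<partial>usph \<partial>lborel)"
        by (subst nn_integral_Ym) (simp_all add: mult.commute)
      also have "\<dots> = (\<integral>\<^sup>+y. indicator {y. P y} y * (\<integral>\<^sup>+w. ennreal (ker (x, y, w)) \<partial>usph) \<partial>lborel)"
        by (simp add: nn_integral_cmult)
      also have "\<dots> \<le> (\<integral>\<^sup>+y. ennreal (K / L) * ennreal (exp (- a * (norm y)\<^sup>2)) + (ennreal K * ennreal (indicator (ball 0 \<delta>) (x - y) / norm (x - y))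
            + ennreal (K * exp (- a * T\<^sup>2)) * ennreal (indicator (ball 0 L) (x - y) / norm (x - y))) \<partial>lborel)"
      proof (rule nn_integral_mono)
        fix y :: vel
        let ?r = "norm (x - y)"
        let ?k = "K * exp (- a * (norm y)\<^sup>2) / ?r"
        have i0: "0 \<le> (indicator S z :: real) / ?r" for S z by simp
        have e1: "exp (- a * (norm y)\<^sup>2) \<le> 1" using a by simp
        have "?k \<le> K / L * exp (- a * (norm y)\<^sup>2) + (K * (indicator (ball 0 \<delta>) (x - y) / ?r) + K * exp (- a * T\<^sup>2) * (indicator (ball 0 L) (x - y) / ?r))" if Py: "P y"
        proof -
          consider "L \<le> ?r" | "?r < \<delta>" | "N \<le> norm x" "?r < L" using Py by (auto simp: P_def)
          then show ?thesis
          proof cases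
            case 1
            then have "?k \<le> K * exp (- a * (norm y)\<^sup>2) / L"
              using L K by (intro divide_left_mono mult_pos_pos) auto
            then have "?k \<le> K / L * exp (- a * (norm y)\<^sup>2)" by simp
            moreover have "0 \<le> K * (indicator (ball 0 \<delta>) (x - y) / ?r) + K * exp (- a * T\<^sup>2) * (indicator (ball 0 L) (x - y) / ?r)"
              using K by (intro add_nonneg_nonneg mult_nonneg_nonneg i0) auto
            ultimately show ?thesis by linarith
          next
            case 2
            then have "indicator (ball 0 \<delta>) (x - y) = (1::real)" by simp
            moreover have "?k \<le> K * 1 / ?r" using e1 K by (intro divide_right_mono mult_left_mono) auto
            moreover have "0 \<le> K * exp (- a * T\<^sup>2) * (indicator (ball 0 L) (x - y) / ?r)" "0 \<le> K / L * exp (- a * (norm y)\<^sup>2)"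
              using K L by (intro mult_nonneg_nonneg i0, auto)+
            ultimately show ?thesis by simp
          next
            case 3
            have "norm x \<le> ?r + norm y" using norm_triangle_ineq[of "x - y" y] by simp
            then have "T \<le> norm y" using 3 by (simp add: N_def)
            then have "T\<^sup>2 \<le> (norm y)\<^sup>2" using T by (intro power_mono)
            then have "?k \<le> K * exp (- a * T\<^sup>2) / ?r"
              using a K by (intro divide_right_mono mult_left_mono) auto
            moreover have "indicator (ball 0 L) (x - y) = (1::real)" using 3 by simp
            moreover have "0 \<le> K * (indicator (ball 0 \<delta>) (x - y) / ?r)" "0 \<le> K / L * exp (- a * (norm y)\<^sup>2)"
              using K L by (intro mult_nonneg_nonneg i0, auto)+
            ultimately show ?thesis by simp
          qed
        qed
        then have "indicator {y. P y} y * ennreal ?k \<le> ennreal (K / L * exp (- a * (norm y)\<^sup>2) + (K * (indicator (ball 0 \<delta>) (x - y) / ?r) + K * exp (- a * T\<^sup>2) * (indicator (ball 0 L) (x - y) / ?r)))"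
          by (auto simp: indicator_def intro: ennreal_leI)
        also have "\<dots> = ennreal (K / L) * ennreal (exp (- a * (norm y)\<^sup>2)) + (ennreal K * ennreal (indicator (ball 0 \<delta>) (x - y) / ?r)
            + ennreal (K * exp (- a * T\<^sup>2)) * ennreal (indicator (ball 0 L) (x - y) / ?r))"
        proof -
          have split: "ennreal (p * p' + (q * q' + t * t')) = ennreal p * ennreal p' + (ennreal q * ennreal q' + ennreal t * ennreal t')"
            if "0 \<le> p" "0 \<le> p'" "0 \<le> q" "0 \<le> q'" "0 \<le> t" "0 \<le> t'" for p p' q q' t t'
            using that by (simp add: ennreal_mult)
          show ?thesis by (rule split) (use K L in auto)
        qed
        finally show "indicator {y. P y} y * (\<integral>\<^sup>+w. ennreal (ker (x, y, w)) \<partial>usph) \<le> \<dots>"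
          using mult_left_mono[OF row[of x y], of "indicator {y. P y} y"] by (rule order_trans[rotated]) simp
      qed
      also have "\<dots> = ennreal (K / L) * (\<integral>\<^sup>+y. ennreal (exp (- a * (norm (y::vel))\<^sup>2)) \<partial>lborel)
         + (ennreal K * (\<integral>\<^sup>+y. ennreal (indicator (ball 0 \<delta>) (x - y) / norm (x - y)) \<partial>lborel)
            + ennreal (K * exp (- a * T\<^sup>2)) * (\<integral>\<^sup>+y. ennreal (indicator (ball 0 L) (x - y) / norm (x - y)) \<partial>lborel))"
        by (simp add: nn_integral_add nn_integral_cmult)
      also have "(\<integral>\<^sup>+y. ennreal (indicator (ball 0 \<delta>) (x - y) / norm (x - y)) \<partial>lborel) = ennreal (Usph * \<delta>\<^sup>2 / 2)"
        using \<delta> nn_integral_reflect[of "\<lambda>g. ennreal (indicator (ball 0 \<delta>) g / norm g)" x]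
        by (simp add: nn_integral_newton_ball)
      also have "(\<integral>\<^sup>+y. ennreal (indicator (ball 0 L) (x - y) / norm (x - y)) \<partial>lborel) = ennreal (Usph * L\<^sup>2 / 2)"
        using L nn_integral_reflect[of "\<lambda>g. ennreal (indicator (ball 0 L) g / norm g)" x]
        by (simp add: nn_integral_newton_ball)
      also have "(\<integral>\<^sup>+y. ennreal (exp (- a * (norm (y::vel))\<^sup>2)) \<partial>lborel) = ennreal (gauss_mass a)"
        by (rule nn_integral_gauss[OF a])
      also have "ennreal (K / L) * ennreal (gauss_mass a) + (ennreal K * ennreal (Usph * \<delta>\<^sup>2 / 2) + ennreal (K * exp (- a * T\<^sup>2)) * ennreal (Usph * L\<^sup>2 / 2))
        = ennreal (K / L * gauss_mass a + (K * (Usph * \<delta>\<^sup>2 / 2) + exp (- a * T\<^sup>2) * Q))"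
        unfolding Q_def using K L gauss_mass_nonneg[of a]
        by (simp add: ennreal_mult[symmetric] ennreal_plus[symmetric] mult_ac del: ennreal_plus)
      also have "\<dots> \<le> ennreal (3 * e / 4)"
        using L1 \<delta>1 T1 by (intro ennreal_leI) linarith
      finally show "(\<integral>\<^sup>+p. ennreal (ker (x, p)) * indicator {y. P y} (fst p) \<partial>Ym) \<le> ennreal (3 * e / 4)" .
      have "(\<integral>\<^sup>+p. ennreal \<beta> * indicator A (x - fst p, snd p) \<partial>Ym) = (\<integral>\<^sup>+y. \<integral>\<^sup>+w. ennreal \<beta> * indicator A (x - y, w) \<partial>usph \<partial>lborel)"
        by (subst nn_integral_Ym) simp_all
      also have "\<dots> = ennreal \<beta> * (\<integral>\<^sup>+y. \<integral>\<^sup>+w. indicator A (x - y, w) \<partial>usph \<partial>lborel)"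
        by (simp add: nn_integral_cmult)
      also have "(\<integral>\<^sup>+y. \<integral>\<^sup>+w. indicator A (x - y, w) \<partial>usph \<partial>lborel) = (\<integral>\<^sup>+g. \<integral>\<^sup>+w. indicator A (g, w) \<partial>usph \<partial>lborel)"
        by (rule nn_integral_reflect[of "\<lambda>g. \<integral>\<^sup>+w. indicator A (g, w) \<partial>usph"]) measurable
      also have "ennreal \<beta> * \<dots> \<le> ennreal \<beta> * ennreal (e / (4 * (\<beta> + 1)))"
        using small unfolding A_def by (intro mult_left_mono) auto
      also have "\<dots> = ennreal (\<beta> / (\<beta> + 1) * (e / 4))"
        using \<beta> e by (simp add: ennreal_mult[symmetric])
      also have "\<dots> \<le> ennreal (1 * (e / 4))"
        using \<beta> e by (intro ennreal_leI mult_right_mono) auto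
      finally show "(\<integral>\<^sup>+p. ennreal \<beta> * indicator A (x - fst p, snd p) \<partial>Ym) \<le> ennreal (e / 4)" by simp
    qed
    also have "\<dots> = ennreal e" using e by (simp add: ennreal_plus[symmetric] del: ennreal_plus)
    finally show ?thesis .
  qed
  define c' where "c' = 2 * Usph / c ^ 3 * (\<beta>\<^sup>2 / d * measure lborel (ball (0::vel) L) * Usph)"
  have c'0: "c' \<ge> 0" using c d by (simp add: c'_def)
  have bound: "(\<integral>\<^sup>+p. ennreal \<bar>f (eta (x, p)) * (ker (x, p) * indicator G (x, p))\<bar> \<partial>Ym)\<^sup>2
          \<le> ennreal (c' * indicator (ball 0 N) x * (sqn lborel f))" if f: "sqint lborel f" for x f
  proof (cases "norm x < N")
    case True
    have "(\<integral>\<^sup>+p. ennreal \<bar>f (eta (x, p)) * (ker (x, p) * indicator G (x, p))\<bar> \<partial>Ym)\<^sup>2 \<le> ennreal (c' * (sqn lborel f))"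
      unfolding c'_def
      by (rule truncated_functional[OF L d \<beta> G _ f]) (use ker_\<beta> in \<open>auto simp: G_def\<close>)
    then show ?thesis using True by simp
  next
    case False
    then have "indicator G (x, p) = (0::real)" for p by (cases p) (simp add: G_def)
    then show ?thesis by simp
  qed
  show ?thesis
  proof (rule bexI[of _ G], rule exI[of _ c'], rule conjI[OF c'0], rule exI[of _ N], intro conjI allI impI)
    show "G \<in> sets (borel \<Otimes>\<^sub>M Ym)" using G sets_bYm by simp
  qed (use rest bound in auto)
qed

end

text \<open>For \<open>F\<close> depending on one argument only, the identity turns the integral in
  the column bound of \<open>b\<close> into row integrals of \<open>d\<close>, so two row bounds
  suffice.\<close>

lemma schur_of_adjoint:
  fixes \<eta> :: "'a::euclidean_space \<times> 'y \<Rightarrow> 'a"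
  assumes Y: "sigma_finite_measure Y" and Z: "sigma_finite_measure Z"
    and m[measurable]: "\<eta> \<in> borel \<Otimes>\<^sub>M Y \<rightarrow>\<^sub>M borel" "b \<in> borel_measurable (borel \<Otimes>\<^sub>M Y)"
      "\<zeta> \<in> borel \<Otimes>\<^sub>M Z \<rightarrow>\<^sub>M borel" "d \<in> borel_measurable (borel \<Otimes>\<^sub>M Z)"
    and b0: "\<And>p. 0 \<le> b p" and A: "0 \<le> A1" "0 \<le> A2"
    and row: "\<And>x. (\<integral>\<^sup>+y. ennreal (b (x, y)) \<partial>Y) \<le> ennreal A1"
    and row': "\<And>x. (\<integral>\<^sup>+z. ennreal (d (x, z)) \<partial>Z) \<le> ennreal A2"
    and eq: "\<And>F. F \<in> borel_measurable (borel \<Otimes>\<^sub>M borel) \<Longrightarrow>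
      (\<integral>\<^sup>+x. \<integral>\<^sup>+y. F (x, \<eta> (x, y)) * ennreal (b (x, y)) \<partial>Y \<partial>lborel)
      = (\<integral>\<^sup>+x. \<integral>\<^sup>+z. F (\<zeta> (x, z), x) * ennreal (d (x, z)) \<partial>Z \<partial>lborel)"
  shows "schur Y \<eta> b A1 A2"
proof (rule schur.intro)
  interpret Z: sigma_finite_measure Z by (rule Z)
  fix f :: "'a \<Rightarrow> ennreal" assume f[measurable]: "f \<in> borel_measurable borel"
  have "(\<integral>\<^sup>+x. \<integral>\<^sup>+y. f (\<eta> (x, y)) * ennreal (b (x, y)) \<partial>Y \<partial>lborel)
    = (\<integral>\<^sup>+x. \<integral>\<^sup>+z. f x * ennreal (d (x, z)) \<partial>Z \<partial>lborel)"
    using eq[of "\<lambda>p. f (snd p)"] by simp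
  also have "\<dots> = (\<integral>\<^sup>+x. f x * (\<integral>\<^sup>+z. ennreal (d (x, z)) \<partial>Z) \<partial>lborel)"
    by (intro nn_integral_cong nn_integral_cmult) measurable
  also have "\<dots> \<le> (\<integral>\<^sup>+x. ennreal A2 * f x \<partial>lborel)"
  proof (rule nn_integral_mono)
    fix x
    show "f x * (\<integral>\<^sup>+z. ennreal (d (x, z)) \<partial>Z) \<le> ennreal A2 * f x"
      using mult_left_mono[OF row'[of x], of "f x"] by (simp add: mult.commute)
  qed
  also have "\<dots> = ennreal A2 * (\<integral>\<^sup>+x. f x \<partial>lborel)" by (rule nn_integral_cmult) simp
  finally show "(\<integral>\<^sup>+x. \<integral>\<^sup>+y. f (\<eta> (x, y)) * ennreal (b (x, y)) \<partial>Y \<partial>lborel) \<le> ennreal A2 * (\<integral>\<^sup>+x. f x \<partial>lborel)" .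
qed (use assms in auto)

text \<open>What the rest of the proof uses of a kernel: boundedness on square-integrable functions,
  and compactness in the form that weakly Cauchy sequences are mapped to Cauchy sequences in square
  norm.\<close>

definition compact_kernel :: "(vel \<times> vel \<times> vel \<Rightarrow> vel) \<Rightarrow> (vel \<times> vel \<times> vel \<Rightarrow> real) \<Rightarrow> bool" where
  "compact_kernel \<eta> b \<longleftrightarrow> (\<exists>A1 A2. schur Ym \<eta> b A1 A2) \<and> (\<forall>u. wcauchy u \<longrightarrow> l2cauchy lborel (\<lambda>p. Top Ym \<eta> b (u p)))"

text \<open>Equality, up to transposition, of the measures on pairs of points defined by the two
  kernels, expressed through integrals of nonnegative functions.\<close>

definition adjoint_kernels where
  "adjoint_kernels \<eta> b \<zeta> d \<longleftrightarrow> (\<forall>F\<in>borel_measurable (borel \<Otimes>\<^sub>M borel).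
      (\<integral>\<^sup>+x. \<integral>\<^sup>+y. F (x, \<eta> (x, y)) * ennreal (b (x, y)) \<partial>Ym \<partial>(lborel :: vel measure))
      = (\<integral>\<^sup>+x. \<integral>\<^sup>+z. F (\<zeta> (x, z), x :: vel) * ennreal (d (x, z)) \<partial>Ym \<partial>lborel))"

lemma compact_kernelI:
  assumes "kernel ma mb D B C E c" "kernel ma' mb' D' B' C' E' c'"
    and adj: "adjoint_kernels (etaM c \<kappa> D) (kerM E B) (etaM c' \<kappa>' D') (kerM E' B')"
  shows "compact_kernel (etaM c \<kappa> D) (kerM E B)"
proof -
  interpret k: kernel ma mb D B C E c \<kappa> by fact
  interpret l: kernel ma' mb' D' B' C' E' c' \<kappa>' by fact
  obtain A1 where A1: "A1 \<ge> 0" "\<And>x. (\<integral>\<^sup>+p. ennreal (k.ker (x, p)) \<partial>Ym) \<le> ennreal A1"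
    using k.row_bound by blast
  obtain A2 where A2: "A2 \<ge> 0" "\<And>x. (\<integral>\<^sup>+p. ennreal (l.ker (x, p)) \<partial>Ym) \<le> ennreal A2"
    using l.row_bound by blast
  have s: "schur Ym k.eta k.ker A1 A2"
    by (rule schur_of_adjoint[where \<zeta>=l.eta and d=l.ker, OF Ym.sigma_finite_measure_axioms Ym.sigma_finite_measure_axioms])
       (use A1 A2 adj k.ker_nonneg in \<open>auto simp: adjoint_kernels_def\<close>)
  then show ?thesis
    unfolding compact_kernel_def using schur_compact[OF s k.truncation] by blast
qed

lemma compact_kernel_sqint: "compact_kernel \<eta> b \<Longrightarrow> sqint lborel f \<Longrightarrow> sqint lborel (Top Ym \<eta> b f)"
  unfolding compact_kernel_def using schur.sqint_T(1) by blast

lemma compact_kernel_cong: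
  "compact_kernel \<eta> b \<Longrightarrow> sqint lborel f \<Longrightarrow> sqint lborel g \<Longrightarrow> AE x in lborel. f x = g x
    \<Longrightarrow> AE x in lborel. Top Ym \<eta> b f x = Top Ym \<eta> b g x"
  unfolding compact_kernel_def using schur.T_cong_AE by blast

lemma compact_kernel_integrable:
  "compact_kernel \<eta> b \<Longrightarrow> sqint lborel f \<Longrightarrow> AE x in lborel. integrable Ym (\<lambda>y. f (\<eta> (x, y)) * b (x, y))"
  unfolding compact_kernel_def using schur.AE_integrable by blast

lemma compact_kernel_adjoint:
  assumes "compact_kernel \<eta> b" "compact_kernel \<zeta> d" "adjoint_kernels \<eta> b \<zeta> d" "sqint lborel f" "sqint lborel g"
  shows "(\<integral>x. Top Ym \<eta> b f x * g x \<partial>lborel) = (\<integral>x. f x * Top Ym \<zeta> d g x \<partial>lborel)"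
proof -
  obtain A1 A2 B1 B2 where "schur Ym \<eta> b A1 A2" "schur Ym \<zeta> d B1 B2"
    using assms unfolding compact_kernel_def by blast
  from schur_adjoint[OF this _ assms(4,5)] assms(3) show ?thesis by (auto simp: adjoint_kernels_def)
qed

text \<open>With \<open>c = mb / (ma + mb)\<close>, the point \<open>x - c *\<^sub>R (x - y)\<close>
  is the centre of mass. Then \<open>\<kappa> = -1\<close> and \<open>\<kappa> = ma / mb\<close>
  give the two velocities after the collision, while \<open>c = 1\<close>,
  \<open>\<kappa> = 0\<close> gives the partner \<open>y\<close> before it.\<close>

abbreviation "H1 ma mb \<equiv> etaM (mb / (ma + mb)) (- 1)"
abbreviation "H2 ma mb \<equiv> etaM (mb / (ma + mb)) (ma / mb)"
abbreviation "H3 \<equiv> etaM 1 0"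
abbreviation "W1 ma mb D B \<equiv> kerM (E1 ma mb D) B"
abbreviation "W2 ma mb D B \<equiv> kerM (E2 ma mb D) B"
abbreviation "W3 ma mb D B \<equiv> kerM (E3 ma mb D) B"

lemma cmv_alt:
  assumes "ma + mb \<noteq> 0"
  shows "x - (mb / (ma + mb)) *\<^sub>R (x - y) = cmv ma mb x y"
proof -
  have "cmv ma mb x y = (1 / (ma + mb)) *\<^sub>R ((ma + mb) *\<^sub>R x - mb *\<^sub>R (x - y))"
    by (simp add: cmv_def algebra_simps)
  then show ?thesis using assms by (simp add: scaleR_diff_right[of "1 / (ma + mb)" "(ma + mb) *\<^sub>R x"] del: scaleR_diff_right)
qed

context channel
begin

lemma H_eq:
  "H1 ma mb D (x, y, w) = post1 ma mb D x y w"
  "H2 ma mb D (x, y, w) = post2 ma mb D x y w"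
  "H3 D (x, y, w) = y"
proof -
  have m: "ma + mb \<noteq> 0" using ma mb by simp
  show "H1 ma mb D (x, y, w) = post1 ma mb D x y w"
    using cmv_alt[OF m, of x y] unfolding post1_def
    by (simp add: etaM_def relmap_def relR_def scaleR_diff_right[of _ "x - y"] del: scaleR_diff_right)
  show "H2 ma mb D (x, y, w) = post2 ma mb D x y w"
    using cmv_alt[OF m, of x y] mb unfolding post2_def
    by (simp add: etaM_def relmap_def relR_def scaleR_add_right[of _ "x - y"] diff_diff_eq[symmetric] del: scaleR_diff_right scaleR_add_right)
  show "H3 D (x, y, w) = y" by (simp add: etaM_def relmap_def)
qed

lemma E_le1: "E1 ma mb D p \<le> 1" "E2 ma mb D p \<le> 1" "E3 ma mb D p \<le> 1"
proof -
  have e: "exp (- (a * (norm u)\<^sup>2 + b * (norm v)\<^sup>2)) \<le> 1" if "0 \<le> a" "0 \<le> b" for a b :: real and u v :: vel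
  proof -
    have "0 \<le> a * (norm u)\<^sup>2 + b * (norm v)\<^sup>2" using that by simp
    then show ?thesis by (simp only: exp_le_one_iff neg_le_0_iff_le)
  qed
  show "E1 ma mb D p \<le> 1" "E2 ma mb D p \<le> 1" "E3 ma mb D p \<le> 1"
    unfolding E1_def E2_def E3_def using ma mb by (cases p; simp only: prod.case; intro e; simp)+
qed

lemma E_meas: "E1 ma mb D \<in> borel_measurable (borel \<Otimes>\<^sub>M borel \<Otimes>\<^sub>M borel)"
  "E2 ma mb D \<in> borel_measurable (borel \<Otimes>\<^sub>M borel \<Otimes>\<^sub>M borel)"
  "E3 ma mb D \<in> borel_measurable (borel \<Otimes>\<^sub>M borel \<Otimes>\<^sub>M borel)"
  unfolding E1_def E2_def E3_def by measurable

lemma E_nonneg: "0 \<le> E1 ma mb D p" "0 \<le> E2 ma mb D p" "0 \<le> E3 ma mb D p"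
  by (auto simp: E1_def E2_def E3_def split: prod.split)

lemma kernel1: "kernel ma mb D B C (E1 ma mb D) (mb / (ma + mb))"
  by unfold_locales (use ma mb wdecay_E1 E_le1 E_meas E_nonneg in auto)

lemma kernel2: "kernel ma mb D B C (E2 ma mb D) (mb / (ma + mb))"
  by unfold_locales (use ma mb wdecay_E2 E_le1 E_meas E_nonneg in auto)

lemma kernel3: "kernel ma mb D B C (E3 ma mb D) 1"
  by unfold_locales (use ma mb wdecay_E3 E_le1 E_meas E_nonneg in auto)

lemma nn_integral_collint:
  assumes F[measurable]: "F \<in> borel_measurable (borel \<Otimes>\<^sub>M borel \<Otimes>\<^sub>M borel \<Otimes>\<^sub>M borel)"
    and G: "\<And>x y w. G (x, y, w) = F (x, y, post1 ma mb D x y w, post2 ma mb D x y w) * ennreal (kin B x y w)"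
  shows "(\<integral>\<^sup>+x. \<integral>\<^sup>+p. G (x, p) \<partial>Ym \<partial>lborel) = collint ma mb D B F"
proof -
  have "(\<lambda>(x, y, w). F (x, y, post1 ma mb D x y w, post2 ma mb D x y w) * ennreal (kin B x y w)) \<in> borel_measurable (borel \<Otimes>\<^sub>M borel \<Otimes>\<^sub>M borel)"
    by measurable
  also have "(\<lambda>(x, y, w). F (x, y, post1 ma mb D x y w, post2 ma mb D x y w) * ennreal (kin B x y w)) = G"
    using G by auto
  finally have [measurable]: "G \<in> borel_measurable (borel \<Otimes>\<^sub>M borel \<Otimes>\<^sub>M borel)" .
  have "(\<integral>\<^sup>+x. \<integral>\<^sup>+p. G (x, p) \<partial>Ym \<partial>lborel) = (\<integral>\<^sup>+x. \<integral>\<^sup>+y. \<integral>\<^sup>+w. G (x, y, w) \<partial>usph \<partial>lborel \<partial>lborel)"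
    by (intro nn_integral_cong nn_integral_Ym) measurable
  then show ?thesis by (simp add: collint_def G)
qed

text \<open>This term couples \<open>x\<close> with \<open>x'\<close>, which reversal exchanges. Its
  weight, a Gaussian in \<open>y\<close> and \<open>y'\<close> with equal exponents, is invariant,
  so the adjoint belongs to the reversed collision with the masses in place.\<close>

lemma adj1: "adjoint_kernels (H1 ma mb D) (W1 ma mb D B) (H1 ma mb (- D)) (W1 ma mb (- D) (BP D B))"
  unfolding adjoint_kernels_def
proof
  interpret P: channel ma mb "- D" "BP D B" "4 * C * (1 + 2 * \<bar>D\<bar>)" by (rule reversed)
  fix F :: "vel \<times> vel \<Rightarrow> ennreal" assume [measurable]: "F \<in> borel_measurable (borel \<Otimes>\<^sub>M borel)"
  define K :: "vel \<times> vel \<times> vel \<times> vel \<Rightarrow> ennreal" where "K = (\<lambda>(x, y, x', y'). F (x, x') * ennreal (exp (- (mb / 4 * (norm y)\<^sup>2 + mb / 4 * (norm y')\<^sup>2))))"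
  have K[measurable]: "K \<in> borel_measurable (borel \<Otimes>\<^sub>M borel \<Otimes>\<^sub>M borel \<Otimes>\<^sub>M borel)"
    unfolding K_def by measurable
  have "(\<integral>\<^sup>+x. \<integral>\<^sup>+p. F (x, H1 ma mb D (x, p)) * ennreal (W1 ma mb D B (x, p)) \<partial>Ym \<partial>lborel) = collint ma mb D B K"
    by (rule nn_integral_collint[of K "\<lambda>q. F (fst q, H1 ma mb D q) * ennreal (W1 ma mb D B q)", simplified])
       (simp_all add: H_eq kerM_def E1_def K_def ennreal_mult kin_nonneg mult.assoc K)
  also have "\<dots> = collint ma mb (- D) (BP D B) (\<lambda>(x, y, x', y'). K (x', y', x, y))"
    by (rule collint_reverse[OF K])
  also have "\<dots> = (\<integral>\<^sup>+x. \<integral>\<^sup>+p. F (H1 ma mb (- D) (x, p), x) * ennreal (W1 ma mb (- D) (BP D B) (x, p)) \<partial>Ym \<partial>lborel)"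
    by (rule P.nn_integral_collint[of _ "\<lambda>q. F (H1 ma mb (- D) q, fst q) * ennreal (W1 ma mb (- D) (BP D B) q)", simplified, symmetric])
       (simp_all add: P.H_eq kerM_def E1_def K_def ennreal_mult P.kin_nonneg mult.assoc minus_diff_commute)
  finally show "(\<integral>\<^sup>+x. \<integral>\<^sup>+p. F (x, H1 ma mb D (x, p)) * ennreal (W1 ma mb D B (x, p)) \<partial>Ym \<partial>lborel) = \<dots>" .
qed

text \<open>This term couples \<open>x\<close> with \<open>y'\<close>. Reversal followed by exchange
  of the partners interchanges these two, and also \<open>y\<close> with \<open>x'\<close>; the
  exchanged masses restore the form of the weight.\<close>

lemma adj2: "adjoint_kernels (H2 ma mb D) (W2 ma mb D B) (H2 mb ma (- D)) (W2 mb ma (- D) (BP D B))"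
  unfolding adjoint_kernels_def
proof
  interpret P: channel ma mb "- D" "BP D B" "4 * C * (1 + 2 * \<bar>D\<bar>)" by (rule reversed)
  interpret Q: channel mb ma "- D" "BP D B" "4 * C * (1 + 2 * \<bar>D\<bar>)" by (rule P.swapped)
  fix F :: "vel \<times> vel \<Rightarrow> ennreal" assume [measurable]: "F \<in> borel_measurable (borel \<Otimes>\<^sub>M borel)"
  define K :: "vel \<times> vel \<times> vel \<times> vel \<Rightarrow> ennreal" where "K = (\<lambda>(x, y, x', y'). F (x, y') * ennreal (exp (- (mb / 4 * (norm y)\<^sup>2 + ma / 4 * (norm x')\<^sup>2))))"
  have K[measurable]: "K \<in> borel_measurable (borel \<Otimes>\<^sub>M borel \<Otimes>\<^sub>M borel \<Otimes>\<^sub>M borel)"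
    unfolding K_def by measurable
  have K': "(\<lambda>(x, y, x', y'). K (x', y', x, y)) \<in> borel_measurable (borel \<Otimes>\<^sub>M borel \<Otimes>\<^sub>M borel \<Otimes>\<^sub>M borel)"
    by measurable
  have "(\<integral>\<^sup>+x. \<integral>\<^sup>+p. F (x, H2 ma mb D (x, p)) * ennreal (W2 ma mb D B (x, p)) \<partial>Ym \<partial>lborel) = collint ma mb D B K"
    by (rule nn_integral_collint[of K "\<lambda>q. F (fst q, H2 ma mb D q) * ennreal (W2 ma mb D B q)", simplified])
       (simp_all add: H_eq kerM_def E2_def K_def ennreal_mult kin_nonneg mult.assoc K)
  also have "\<dots> = collint ma mb (- D) (BP D B) (\<lambda>(x, y, x', y'). K (x', y', x, y))"
    by (rule collint_reverse[OF K])
  also have "\<dots> = collint mb ma (- D) (BP D B) (\<lambda>(x, y, x', y'). K (y', x', y, x))"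
    using P.collint_swap[OF K'] by simp
  also have "\<dots> = (\<integral>\<^sup>+x. \<integral>\<^sup>+p. F (H2 mb ma (- D) (x, p), x) * ennreal (W2 mb ma (- D) (BP D B) (x, p)) \<partial>Ym \<partial>lborel)"
    by (rule Q.nn_integral_collint[of _ "\<lambda>q. F (H2 mb ma (- D) q, fst q) * ennreal (W2 mb ma (- D) (BP D B) q)", simplified, symmetric])
       (simp_all add: Q.H_eq kerM_def E2_def K_def ennreal_mult Q.kin_nonneg mult.assoc minus_diff_commute)
  finally show "(\<integral>\<^sup>+x. \<integral>\<^sup>+p. F (x, H2 ma mb D (x, p)) * ennreal (W2 ma mb D B (x, p)) \<partial>Ym \<partial>lborel) = \<dots>" .
qed

text \<open>Both coupled velocities precede the collision, so exchange of the partners alone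
  interchanges them.\<close>

lemma adj3: "adjoint_kernels (H3 D) (W3 ma mb D B) (H3 D) (W3 mb ma D B)"
  unfolding adjoint_kernels_def
proof
  interpret Q: channel mb ma D B C by (rule swapped)
  fix F :: "vel \<times> vel \<Rightarrow> ennreal" assume [measurable]: "F \<in> borel_measurable (borel \<Otimes>\<^sub>M borel)"
  define K :: "real \<Rightarrow> real \<Rightarrow> vel \<times> vel \<times> vel \<times> vel \<Rightarrow> ennreal" where "K ma mb = (\<lambda>(x, y, x', y'). F (x, y) * ennreal (exp (- (ma / 4 * (norm x')\<^sup>2 + mb / 4 * (norm y')\<^sup>2))))"
    for ma mb
  have K[measurable]: "K ma mb \<in> borel_measurable (borel \<Otimes>\<^sub>M borel \<Otimes>\<^sub>M borel \<Otimes>\<^sub>M (borel :: vel measure))"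
    unfolding K_def by measurable
  have "(\<integral>\<^sup>+x. \<integral>\<^sup>+p. F (x, H3 D (x, p)) * ennreal (W3 ma mb D B (x, p)) \<partial>Ym \<partial>lborel) = collint ma mb D B (K ma mb)"
    by (rule nn_integral_collint[of "K ma mb" "\<lambda>q. F (fst q, H3 D q) * ennreal (W3 ma mb D B q)", simplified])
       (simp_all add: H_eq kerM_def E3_def K_def ennreal_mult kin_nonneg mult.assoc K[unfolded K_def])
  also have "\<dots> = collint mb ma D B (\<lambda>(x, y, x', y'). K ma mb (y, x, y', x'))"
    by (rule collint_swap[OF K])
  also have "\<dots> = (\<integral>\<^sup>+x. \<integral>\<^sup>+p. F (H3 D (x, p), x) * ennreal (W3 mb ma D B (x, p)) \<partial>Ym \<partial>lborel)"
    by (rule Q.nn_integral_collint[of _ "\<lambda>q. F (H3 D q, fst q) * ennreal (W3 mb ma D B q)", simplified, symmetric])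
       (simp_all add: Q.H_eq kerM_def E3_def K_def ennreal_mult Q.kin_nonneg mult.assoc minus_diff_commute)
  finally show "(\<integral>\<^sup>+x. \<integral>\<^sup>+p. F (x, H3 D (x, p)) * ennreal (W3 ma mb D B (x, p)) \<partial>Ym \<partial>lborel) = \<dots>" .
qed

lemma good1: "compact_kernel (H1 ma mb D) (W1 ma mb D B)"
  by (rule compact_kernelI[OF kernel1 channel.kernel1[OF reversed] adj1])

lemma good2: "compact_kernel (H2 ma mb D) (W2 ma mb D B)"
  by (rule compact_kernelI[OF kernel2 channel.kernel2[OF channel.swapped[OF reversed]] adj2])

lemma good3: "compact_kernel (H3 D) (W3 ma mb D B)"
  by (rule compact_kernelI[OF kernel3 channel.kernel3[OF swapped] adj3])

end

subsection \<open>The collision model\<close>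

lemma AE_sum_eq:
  assumes "finite J" "\<And>j. j \<in> J \<Longrightarrow> AE x in M. f j x = g j x"
  shows "AE x in M. (\<Sum>j\<in>J. f j x) = (\<Sum>j\<in>J. g j x)"
proof -
  have "AE x in M. \<forall>j\<in>J. f j x = g j x" using assms by (intro AE_finite_allI)
  then show ?thesis by eventually_elim (simp cong: sum.cong)
qed

lemma sqrt_gauss:
  assumes "0 < N1" "0 < N2" "0 < P"
  shows "sqrt ((N1 * exp (- a * A / 2)) * (N2 * exp (- b * B / 2)) / P) = sqrt (N1 * N2 / P) * exp (- (a / 4 * A + b / 4 * B))"
proof -
  have "exp (- a * A / 2) * exp (- b * B / 2) = (exp (- (a / 4 * A + b / 4 * B)))\<^sup>2"
    by (simp add: power2_eq_square exp_add[symmetric] algebra_simps)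
  moreover have "(N1 * p) * (N2 * q) / P = N1 * N2 / P * (p * q)" for p q by simp
  ultimately have "(N1 * exp (- a * A / 2)) * (N2 * exp (- b * B / 2)) / P = N1 * N2 / P * (exp (- (a / 4 * A + b / 4 * B)))\<^sup>2"
    by (simp only:)
  then show ?thesis by (simp only: real_sqrt_mult real_sqrt_abs abs_exp_cancel)
qed

lemma inL2_iff: "inL2 s r h \<longleftrightarrow> (\<forall>a<s. \<forall>i<r a. sqint lborel (h a i))"
  by (simp add: inL2_def sqint_def)

locale collision_model =
  fixes s :: nat and r :: "nat \<Rightarrow> nat" and m :: "nat \<Rightarrow> real"
    and I :: "nat \<Rightarrow> nat \<Rightarrow> real" and \<phi> :: "nat \<Rightarrow> nat \<Rightarrow> real" and n :: "nat \<Rightarrow> real"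
    and sig :: "nat \<Rightarrow> nat \<Rightarrow> real \<Rightarrow> real \<Rightarrow> nat \<Rightarrow> nat \<Rightarrow> nat \<Rightarrow> nat \<Rightarrow> real"
    and C \<gamma> :: real
  assumes m_pos: "\<forall>a<s. m a > 0"
    and n_pos: "\<forall>a<s. n a > 0"
    and phi_pos: "\<forall>a<s. \<forall>i<r a. \<phi> a i > 0"
    and sig_meas: "\<forall>a<s. \<forall>b<s. \<forall>i<r a. \<forall>k<r a. \<forall>j<r b. \<forall>l<r b.
         (\<lambda>p::real \<times> real. sig a b (fst p) (snd p) i j k l) \<in> borel_measurable borel"
    and sig_nonneg: "\<forall>a<s. \<forall>b<s. \<forall>i<r a. \<forall>k<r a. \<forall>j<r b. \<forall>l<r b.
         \<forall>x c. x \<ge> 0 \<longrightarrow> -1 \<le> c \<longrightarrow> c \<le> 1 \<longrightarrow> sig a b x c i j k l \<ge> 0"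
    and microrev: "\<forall>a<s. \<forall>b<s. \<forall>i<r a. \<forall>k<r a. \<forall>j<r b. \<forall>l<r b.
         \<forall>x y c. x > 0 \<longrightarrow> y > 0 \<longrightarrow> -1 \<le> c \<longrightarrow> c \<le> 1 \<longrightarrow>
           y\<^sup>2 = x\<^sup>2 - 2 * DeltaIt m I a b k l i j \<longrightarrow>
           \<phi> a i * \<phi> b j * x\<^sup>2 * sig a b x c i j k l
             = \<phi> a k * \<phi> b l * y\<^sup>2 * sig a b y c k l i j"
    and sym_species: "\<forall>a<s. \<forall>b<s. \<forall>i<r a. \<forall>k<r a. \<forall>j<r b. \<forall>l<r b.
         \<forall>x c. x \<ge> 0 \<longrightarrow> -1 \<le> c \<longrightarrow> c \<le> 1 \<longrightarrow>
           sig a b x c k l i j = sig b a x c l k j i"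
    and C_pos: "C > 0"
    and gamma: "0 < \<gamma>" "\<gamma> < 1"
    and bound: "\<forall>a<s. \<forall>b<s. \<forall>i<r a. \<forall>k<r a. \<forall>j<r b. \<forall>l<r b.
         \<forall>x c. x > 0 \<longrightarrow> -1 \<le> c \<longrightarrow> c \<le> 1 \<longrightarrow> x\<^sup>2 > 2 * DeltaIt m I a b k l i j \<longrightarrow>
           (let \<Psi> = x * sqrt (x\<^sup>2 - 2 * DeltaIt m I a b k l i j)
            in 0 \<le> sig a b x c i j k l \<and>
               sig a b x c i j k l \<le> C / x\<^sup>2 * (\<Psi> + \<Psi> powr (\<gamma> / 2)))"
begin

definition valid :: "nat \<Rightarrow> nat \<Rightarrow> nat \<Rightarrow> nat \<Rightarrow> nat \<Rightarrow> nat \<Rightarrow> bool" where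
  "valid a b i j k l \<longleftrightarrow> a < s \<and> b < s \<and> i < r a \<and> k < r a \<and> j < r b \<and> l < r b"

definition Dx :: "nat \<Rightarrow> nat \<Rightarrow> nat \<Rightarrow> nat \<Rightarrow> nat \<Rightarrow> nat \<Rightarrow> real" where
  "Dx a b i j k l = DeltaIt m I a b k l i j"

text \<open>The factor left by the Dirac measures, in the variables \<open>t = |g|^2\<close> and the
  cosine; \<open>t - 2 * Dx\<close> is \<open>|g'|^2\<close>. The cutoff to genuine cosines is made
  because the assumptions on \<open>sig\<close> concern only these, whereas a \<open>channel\<close>
  has its bounds for all \<open>c\<close>.\<close>

definition Bx :: "nat \<Rightarrow> nat \<Rightarrow> nat \<Rightarrow> nat \<Rightarrow> nat \<Rightarrow> nat \<Rightarrow> real \<Rightarrow> real \<Rightarrow> real" where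
  "Bx a b i j k l t c = (if 0 < t \<and> 2 * Dx a b i j k l < t \<and> \<bar>c\<bar> \<le> 1
     then \<phi> a k * \<phi> b l * sig a b (sqrt (t - 2 * Dx a b i j k l)) c k l i j * (t - 2 * Dx a b i j k l) / sqrt t else 0)"

lemma Dx_reverse: "Dx a b k l i j = - Dx a b i j k l"
proof -
  have "I a i + I b j - I a k - I b l = - (I a k + I b l - I a i - I b j)" by simp
  then show ?thesis by (simp only: Dx_def DeltaIt_def DeltaI_def mult_minus_right)
qed

lemma Dx_swap: "Dx b a j i l k = Dx a b i j k l"
proof -
  have "I b l + I a k - I b j - I a i = I a k + I b l - I a i - I b j" by simp
  then show ?thesis
    by (simp only: Dx_def DeltaIt_def DeltaI_def add.commute[of "m b"] mult.commute[of "m b"])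
qed

text \<open>In \<open>BP\<close> the speeds cancel so that both sides have denominator
  \<open>sqrt t\<close>; the numerators are the two sides of microreversibility for the collision
  from \<open>(k, l)\<close> to \<open>(i, j)\<close> at relative speed
  \<open>sqrt t\<close>.\<close>

lemma Bx_reverse:
  assumes v: "valid a b i j k l"
  shows "BP (Dx a b i j k l) (Bx a b i j k l) = Bx a b k l i j"
proof (intro ext)
  fix t c
  let ?D = "Dx a b i j k l"
  show "BP ?D (Bx a b i j k l) t c = Bx a b k l i j t c"
  proof (cases "t > 0 \<and> t + 2 * ?D > 0 \<and> \<bar>c\<bar> \<le> 1")
    case False
    then show ?thesis by (auto simp: BP_def Bx_def Dx_reverse[of a b k l i j])
  next
    case True
    have D: "DeltaIt m I a b i j k l = - ?D"
      using Dx_reverse[of a b k l i j] by (simp only: Dx_def)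
    have "\<phi> a k * \<phi> b l * (sqrt t)\<^sup>2 * sig a b (sqrt t) c k l i j
      = \<phi> a i * \<phi> b j * (sqrt (t + 2 * ?D))\<^sup>2 * sig a b (sqrt (t + 2 * ?D)) c i j k l"
      by (rule microrev[rule_format, of a b k i l j]) (use v True in \<open>auto simp: valid_def D\<close>)
    then have "\<phi> a k * \<phi> b l * sig a b (sqrt t) c k l i j * t
      = \<phi> a i * \<phi> b j * sig a b (sqrt (t + 2 * ?D)) c i j k l * (t + 2 * ?D)"
      using True by (simp add: mult_ac)
    then show ?thesis using True by (simp add: BP_def Bx_def Dx_reverse[of a b k l i j])
  qed
qed

lemma Bx_swap:
  assumes v: "valid a b i j k l"
  shows "Bx b a j i l k = Bx a b i j k l"
proof (intro ext)
  fix t c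
  let ?D = "Dx a b i j k l"
  show "Bx b a j i l k t c = Bx a b i j k l t c"
  proof (cases "0 < t \<and> 2 * ?D < t \<and> \<bar>c\<bar> \<le> 1")
    case True
    have "sig a b (sqrt (t - 2 * ?D)) c k l i j = sig b a (sqrt (t - 2 * ?D)) c l k j i"
      using sym_species[rule_format, of a b i k j l "sqrt (t - 2 * ?D)" c] v True by (auto simp: valid_def)
    then show ?thesis by (simp add: Bx_def Dx_swap[of b a j i l k] mult.commute)
  qed (auto simp: Bx_def Dx_swap[of b a j i l k])
qed

lemma sig_measurable:
  assumes "valid a b i j k l" and [measurable]: "f \<in> borel_measurable M" "g \<in> borel_measurable M"
  shows "(\<lambda>p. sig a b (f p) (g p) k l i j) \<in> borel_measurable M"
proof -
  have "(\<lambda>p::real \<times> real. sig a b (fst p) (snd p) k l i j) \<in> borel_measurable (borel \<Otimes>\<^sub>M borel)"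
    using sig_meas assms(1) unfolding borel_prod by (auto simp: valid_def)
  from measurable_compose[OF measurable_Pair[OF assms(2,3)] this] show ?thesis by simp
qed

text \<open>The factor \<open>R^2 = |g'|^2\<close> cancels the singular prefactor
  \<open>C / R^2\<close> of the assumed bound. Then
  \<open>\<Psi> powr (\<gamma> / 2) \<le> 1 + \<Psi>\<close> since \<open>\<gamma> / 2 < 1\<close>,
  and \<open>2 * \<Psi> \<le> R^2 + t\<close>, which grows as required because \<open>R^2\<close>
  and \<open>t\<close> differ by a constant.\<close>

lemma channel_Bx:
  assumes v: "valid a b i j k l"
  shows "\<exists>C'. channel (m a) (m b) (Dx a b i j k l) (Bx a b i j k l) C'"
proof
  let ?D = "Dx a b i j k l"
  let ?P = "\<phi> a k * \<phi> b l"
  let ?C = "?P * C * (2 + 2 * \<bar>?D\<bar>)"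
  have P: "?P > 0" using v phi_pos by (simp add: valid_def)
  show "channel (m a) (m b) ?D (Bx a b i j k l) ?C"
  proof
    show "m a > 0" "m b > 0" using v m_pos by (auto simp: valid_def)
    show "?C \<ge> 0" using P C_pos by simp
    note sig_measurable[OF v, measurable]
    show "case_prod (Bx a b i j k l) \<in> borel_measurable (borel \<Otimes>\<^sub>M borel)"
      unfolding Bx_def by measurable
    show "0 \<le> Bx a b i j k l t c" for t c
    proof (cases "0 < t \<and> 2 * ?D < t \<and> \<bar>c\<bar> \<le> 1")
      case True
      have "0 \<le> sig a b (sqrt (t - 2 * ?D)) c k l i j"
        using sig_nonneg v True by (auto simp: valid_def)
      then show ?thesis using True P by (simp add: Bx_def)
    qed (auto simp: Bx_def)
    show "Bx a b i j k l t c = 0" if "t \<le> 0 \<or> t \<le> 2 * ?D" for t c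
      using that by (auto simp: Bx_def)
    show "Bx a b i j k l t c \<le> ?C * (1 + sqrt t)\<^sup>2 / sqrt t" if t: "t > 0" for t c
    proof (cases "2 * ?D < t \<and> \<bar>c\<bar> \<le> 1")
      case False
      then show ?thesis using P C_pos t by (auto simp: Bx_def)
    next
      case True
      define R where "R = sqrt (t - 2 * ?D)"
      have R: "R > 0" "R\<^sup>2 = t - 2 * ?D" using True by (auto simp: R_def)
      define \<Psi> where "\<Psi> = R * sqrt t"
      have Psi: "\<Psi> > 0" using R t by (simp add: \<Psi>_def)
      \<comment> \<open>The cross section in \<open>Bx\<close> is that of the reversed collision at
        relative speed \<open>R\<close>, so the bound is used with energy gap \<open>- ?D\<close>;
        \<open>\<Psi>\<close> is the same in both directions.\<close>
      have le: "sig a b R c k l i j \<le> C / R\<^sup>2 * (\<Psi> + \<Psi> powr (\<gamma> / 2))"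
      proof -
        have D: "DeltaIt m I a b i j k l = - ?D"
          using Dx_reverse[of a b k l i j] by (simp only: Dx_def)
        have "let \<Psi> = R * sqrt (R\<^sup>2 - 2 * DeltaIt m I a b i j k l)
            in 0 \<le> sig a b R c k l i j \<and> sig a b R c k l i j \<le> C / R\<^sup>2 * (\<Psi> + \<Psi> powr (\<gamma> / 2))"
          by (rule bound[rule_format, of a b k i l j]) (use v True R t in \<open>auto simp: valid_def D\<close>)
        then show ?thesis by (simp add: Let_def D R(2) \<Psi>_def)
      qed
      have "\<Psi> powr (\<gamma> / 2) \<le> 1 + \<Psi>"
      proof (cases "\<Psi> \<le> 1")
        case True
        then have "\<Psi> powr (\<gamma> / 2) \<le> 1" using Psi gamma by (intro powr_le1) auto
        then show ?thesis using Psi by simp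
      next
        case False
        then have "\<Psi> powr (\<gamma> / 2) \<le> \<Psi> powr 1" using gamma by (intro powr_mono) auto
        then show ?thesis using Psi by simp
      qed
      then have "C / R\<^sup>2 * (\<Psi> + \<Psi> powr (\<gamma> / 2)) \<le> C / R\<^sup>2 * (1 + 2 * \<Psi>)"
        using C_pos by (intro mult_left_mono) auto
      with le have le2: "sig a b R c k l i j \<le> C / R\<^sup>2 * (1 + 2 * \<Psi>)" by simp
      have "1 + 2 * \<Psi> \<le> 1 + (R\<^sup>2 + t)"
        using zero_le_power2[of "R - sqrt t"] t by (simp add: \<Psi>_def power2_diff)
      also have "\<dots> \<le> (2 + 2 * \<bar>?D\<bar>) * (1 + t)"       proof -
        have "0 \<le> \<bar>?D\<bar> * t" using t by simp
        moreover have "(2 + 2 * \<bar>?D\<bar>) * (1 + t) = 2 + 2 * t + 2 * \<bar>?D\<bar> + 2 * (\<bar>?D\<bar> * t)"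
          by (simp add: algebra_simps)
        ultimately show ?thesis using R(2) abs_ge_minus_self[of ?D] by linarith
      qed
      also have "\<dots> \<le> (2 + 2 * \<bar>?D\<bar>) * (1 + sqrt t)\<^sup>2"
        using t by (intro mult_left_mono) (auto simp: power2_sum)
      finally have Psi2: "1 + 2 * \<Psi> \<le> (2 + 2 * \<bar>?D\<bar>) * (1 + sqrt t)\<^sup>2" .
      have "Bx a b i j k l t c = ?P * (sig a b R c k l i j * R\<^sup>2) / sqrt t"
        using True t R by (simp add: Bx_def R_def)
      also have "\<dots> \<le> ?P * (C * (1 + 2 * \<Psi>)) / sqrt t"
      proof (intro divide_right_mono mult_left_mono)
        have "sig a b R c k l i j * R\<^sup>2 \<le> C / R\<^sup>2 * (1 + 2 * \<Psi>) * R\<^sup>2"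
          by (rule mult_right_mono[OF le2]) simp
        also have "\<dots> = C * (1 + 2 * \<Psi>)" using R(1) by simp
        finally show "sig a b R c k l i j * R\<^sup>2 \<le> C * (1 + 2 * \<Psi>)" .
      qed (use P t in auto)
      also have "\<dots> \<le> ?P * (C * ((2 + 2 * \<bar>?D\<bar>) * (1 + sqrt t)\<^sup>2)) / sqrt t"
        using P C_pos t by (intro divide_right_mono mult_left_mono Psi2) auto
      finally show ?thesis by (simp add: mult_ac)
    qed
  qed
qed

section \<open>Splitting each summand of \<open>K\<close> into three Schur operators\<close>

definition Nx :: "nat \<Rightarrow> nat \<Rightarrow> real" where
  "Nx a i = n a * \<phi> a i * m a powr (3/2) / ((2 * pi) powr (3/2) * qpart r I \<phi> a) * exp (- I a i)"

lemma Maxw_eq: "Maxw r m I \<phi> n a i x = Nx a i * exp (- m a * (norm x)\<^sup>2 / 2)"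
proof -
  have "exp (- m a * (norm x)\<^sup>2 / 2 - I a i) = exp (- I a i) * exp (- m a * (norm x)\<^sup>2 / 2)"
    by (simp add: exp_add[symmetric])
  then show ?thesis by (simp only: Maxw_def Nx_def mult.assoc)
qed

lemma Nx_pos:
  assumes "a < s" "i < r a"
  shows "Nx a i > 0"
proof -
  have "qpart r I \<phi> a > 0"
    unfolding qpart_def using assms phi_pos by (intro sum_pos) auto
  moreover have "n a > 0" "\<phi> a i > 0" "m a > 0" using assms phi_pos n_pos m_pos by auto
  ultimately show ?thesis unfolding Nx_def by (intro mult_pos_pos divide_pos_pos) auto
qed

definition Px :: "nat \<Rightarrow> nat \<Rightarrow> nat \<Rightarrow> nat \<Rightarrow> nat \<Rightarrow> nat \<Rightarrow> real" where
  "Px a b i j k l = \<phi> a i * \<phi> b j * \<phi> a k * \<phi> b l"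

definition c1 :: "nat \<Rightarrow> nat \<Rightarrow> nat \<Rightarrow> nat \<Rightarrow> nat \<Rightarrow> nat \<Rightarrow> real" where
  "c1 a b i j k l = sqrt (Nx b j * Nx b l / Px a b i j k l)"

definition c2 :: "nat \<Rightarrow> nat \<Rightarrow> nat \<Rightarrow> nat \<Rightarrow> nat \<Rightarrow> nat \<Rightarrow> real" where
  "c2 a b i j k l = sqrt (Nx b j * Nx a k / Px a b i j k l)"

definition c3 :: "nat \<Rightarrow> nat \<Rightarrow> nat \<Rightarrow> nat \<Rightarrow> nat \<Rightarrow> nat \<Rightarrow> real" where
  "c3 a b i j k l = sqrt (Nx a k * Nx b l / Px a b i j k l)"

text \<open>Invariance under the index permutations that accompany the passage to the adjoint in the
  three terms.\<close>

lemma c_symm: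
  "c1 a b k l i j = c1 a b i j k l"
  "c2 b a l k j i = c2 a b i j k l"
  "c3 b a j i l k = c3 a b i j k l"
  by (simp_all add: c1_def c2_def c3_def Px_def mult_ac)

abbreviation "e1 a b i j k l \<equiv> H1 (m a) (m b) (Dx a b i j k l)"
abbreviation "e2 a b i j k l \<equiv> H2 (m a) (m b) (Dx a b i j k l)"
abbreviation "e3 a b i j k l \<equiv> H3 (Dx a b i j k l)"
abbreviation "w1 a b i j k l \<equiv> W1 (m a) (m b) (Dx a b i j k l) (Bx a b i j k l)"
abbreviation "w2 a b i j k l \<equiv> W2 (m a) (m b) (Dx a b i j k l) (Bx a b i j k l)"
abbreviation "w3 a b i j k l \<equiv> W3 (m a) (m b) (Dx a b i j k l) (Bx a b i j k l)"

abbreviation "T1 a b i j k l \<equiv> Top Ym (e1 a b i j k l) (w1 a b i j k l)"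
abbreviation "T2 a b i j k l \<equiv> Top Ym (e2 a b i j k l) (w2 a b i j k l)"
abbreviation "T3 a b i j k l \<equiv> Top Ym (e3 a b i j k l) (w3 a b i j k l)"

lemma good:
  assumes v: "valid a b i j k l"
  shows "compact_kernel (e1 a b i j k l) (w1 a b i j k l)"
    "compact_kernel (e2 a b i j k l) (w2 a b i j k l)"
    "compact_kernel (e3 a b i j k l) (w3 a b i j k l)"
  using channel_Bx[OF v] channel.good1 channel.good2 channel.good3 by blast+

lemma adj:
  assumes v: "valid a b i j k l"
  shows "adjoint_kernels (e1 a b i j k l) (w1 a b i j k l) (e1 a b k l i j) (w1 a b k l i j)"
    "adjoint_kernels (e2 a b i j k l) (w2 a b i j k l) (e2 b a l k j i) (w2 b a l k j i)"
    "adjoint_kernels (e3 a b i j k l) (w3 a b i j k l) (e3 b a j i l k) (w3 b a j i l k)"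
proof -
  obtain C' where "channel (m a) (m b) (Dx a b i j k l) (Bx a b i j k l) C'"
    using channel_Bx[OF v] by blast
  then interpret channel "m a" "m b" "Dx a b i j k l" "Bx a b i j k l" C' .
  have v': "valid a b k l i j" using v by (auto simp: valid_def)
  have D2: "Dx b a l k j i = - Dx a b i j k l"
    using Dx_swap[of a b k l i j] Dx_reverse[of a b k l i j] by simp
  have B2: "Bx b a l k j i = BP (Dx a b i j k l) (Bx a b i j k l)"
    using Bx_swap[OF v'] Bx_reverse[OF v] by simp
  show "adjoint_kernels (e1 a b i j k l) (w1 a b i j k l) (e1 a b k l i j) (w1 a b k l i j)"
    using adj1 unfolding Bx_reverse[OF v] Dx_reverse[of a b k l i j] .
  show "adjoint_kernels (e2 a b i j k l) (w2 a b i j k l) (e2 b a l k j i) (w2 b a l k j i)"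
    using adj2 unfolding B2 D2 .
  show "adjoint_kernels (e3 a b i j k l) (w3 a b i j k l) (e3 b a j i l k) (w3 b a j i l k)"
    using adj3 unfolding Bx_swap[OF v] Dx_swap[of b a j i l k] .
qed

abbreviation "Kint h a b i j k l \<equiv> K_integrand r m I \<phi> n sig h a b i j k l"

text \<open>The common root of three Maxwellians is divided by a different root in each term, which
  leaves the three Gaussian weights. That \<open>w\<close> is a unit vector puts the cosine into
  \<open>[-1, 1]\<close>, where \<open>Bx\<close> is not cut off.\<close>

lemma Kint_eq:
  assumes v: "valid a b i j k l" and w: "norm w = 1"
  shows "Kint h a b i j k l x y w
    = c1 a b i j k l * (h a k (e1 a b i j k l (x, y, w)) * w1 a b i j k l (x, y, w))
    + c2 a b i j k l * (h b l (e2 a b i j k l (x, y, w)) * w2 a b i j k l (x, y, w))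
    - c3 a b i j k l * (h b j (e3 a b i j k l (x, y, w)) * w3 a b i j k l (x, y, w))"
proof -
  obtain C' where "channel (m a) (m b) (Dx a b i j k l) (Bx a b i j k l) C'"
    using channel_Bx[OF v] by blast
  then interpret channel "m a" "m b" "Dx a b i j k l" "Bx a b i j k l" C' .
  let ?D = "Dx a b i j k l" and ?B = "Bx a b i j k l"
  show ?thesis
  proof (cases "2 * ?D < (norm (x - y))\<^sup>2 \<and> x \<noteq> y")
    case False
    then have "kin ?B x y w = 0" by (auto simp: kin_def B_zero)
    moreover have "Kint h a b i j k l x y w = 0"
      using False unfolding K_integrand_def Dx_def by (auto simp: Let_def)
    ultimately show ?thesis by (simp add: kerM_def)
  next
    case True
    define x' where "x' = post1 (m a) (m b) ?D x y w"
    define y' where "y' = post2 (m a) (m b) ?D x y w"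
    let ?M = "Maxw r m I \<phi> n"
    let ?P = "Px a b i j k l"
    have idx: "a < s" "b < s" "i < r a" "k < r a" "j < r b" "l < r b" using v by (auto simp: valid_def)
    have N: "Nx a k > 0" "Nx b j > 0" "Nx b l > 0" using idx by (auto intro: Nx_pos)
    have P: "?P > 0" using idx phi_pos by (simp add: Px_def)
    have M: "?M a k x' > 0" "?M b l y' > 0" "?M b j y > 0" using N by (auto simp: Maxw_eq)
    have r: "norm (x - y) > 0" using True by simp
    have cs: "sgn (x - y) \<bullet> w = (x - y) \<bullet> w / norm (x - y)"
      by (simp add: sgn_div_norm divide_inverse mult.commute)
    have c_le: "\<bar>(x - y) \<bullet> w / norm (x - y)\<bar> \<le> 1"
      using Cauchy_Schwarz_ineq2[of "x - y" w] w r by (simp add: abs_divide)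
    have kin: "kin ?B x y w = \<phi> a k * \<phi> b l * sig a b (sqrt ((norm (x - y))\<^sup>2 - 2 * ?D)) ((x - y) \<bullet> w / norm (x - y)) k l i j
       * (sqrt ((norm (x - y))\<^sup>2 - 2 * ?D))\<^sup>2 / norm (x - y)"
      using True c_le by (simp add: kin_def Bx_def cs)
    define S where "S = sqrt (?M b j y * ?M a k x' * ?M b l y' / ?P)"
    have "Kint h a b i j k l x y w = (h a k x' / sqrt (?M a k x') + h b l y' / sqrt (?M b l y') - h b j y / sqrt (?M b j y)) * S * kin ?B x y w"
      unfolding kin S_def x'_def y'_def post1_def post2_def cmv_def Px_def
      using True unfolding K_integrand_def Dx_def by (simp add: Let_def)
    also have "\<dots> = (h a k x' * (S / sqrt (?M a k x')) + h b l y' * (S / sqrt (?M b l y')) - h b j y * (S / sqrt (?M b j y))) * kin ?B x y w"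
      by (simp add: algebra_simps)
    also have "S / sqrt (?M a k x') = c1 a b i j k l * E1 (m a) (m b) ?D (x, y, w)"
    proof -
      have "S / sqrt (?M a k x') = sqrt (?M b j y * ?M b l y' / ?P)"
        unfolding S_def real_sqrt_divide[symmetric] using M by (intro arg_cong[where f=sqrt]) simp
      then show ?thesis
        unfolding Maxw_eq sqrt_gauss[OF N(2) N(3) P] by (simp add: c1_def E1_def y'_def)
    qed
    also have "S / sqrt (?M b l y') = c2 a b i j k l * E2 (m a) (m b) ?D (x, y, w)"
    proof -
      have "S / sqrt (?M b l y') = sqrt (?M b j y * ?M a k x' / ?P)"
        unfolding S_def real_sqrt_divide[symmetric] using M by (intro arg_cong[where f=sqrt]) simp
      then show ?thesis
        unfolding Maxw_eq sqrt_gauss[OF N(2) N(1) P] by (simp add: c2_def E2_def x'_def)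
    qed
    also have "S / sqrt (?M b j y) = c3 a b i j k l * E3 (m a) (m b) ?D (x, y, w)"
    proof -
      have "S / sqrt (?M b j y) = sqrt (?M a k x' * ?M b l y' / ?P)"
        unfolding S_def real_sqrt_divide[symmetric] using M by (intro arg_cong[where f=sqrt]) simp
      then show ?thesis
        unfolding Maxw_eq sqrt_gauss[OF N(1) N(3) P] by (simp add: c3_def E3_def x'_def y'_def)
    qed
    finally show ?thesis
      unfolding H_eq x'_def[symmetric] y'_def[symmetric] by (simp add: kerM_def algebra_simps)
  qed
qed

lemma Kint_measurable:
  assumes v: "valid a b i j k l" and h: "inL2 s r h"
    and [measurable]: "f1 \<in> M \<rightarrow>\<^sub>M borel" "f2 \<in> M \<rightarrow>\<^sub>M borel" "f3 \<in> M \<rightarrow>\<^sub>M borel"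
  shows "(\<lambda>p. Kint h a b i j k l (f1 p) (f2 p) (f3 p)) \<in> borel_measurable M"
proof -
  note sig_measurable[OF v, measurable]
  have [measurable]: "h a k \<in> borel_measurable borel" "h b l \<in> borel_measurable borel" "h b j \<in> borel_measurable borel"
    using h v by (auto simp: inL2_def valid_def)
  show ?thesis unfolding K_integrand_def Let_def Maxw_def by measurable
qed

definition Kx :: "(nat \<Rightarrow> nat \<Rightarrow> vel \<Rightarrow> real) \<Rightarrow> nat \<Rightarrow> nat \<Rightarrow> nat \<Rightarrow> nat \<Rightarrow> nat \<Rightarrow> nat \<Rightarrow> vel \<Rightarrow> real" where
  "Kx h a b i j k l x
    = c1 a b i j k l * T1 a b i j k l (h a k) x
    + c2 a b i j k l * T2 a b i j k l (h b l) x
    - c3 a b i j k l * T3 a b i j k l (h b j) x"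

definition Kt :: "(nat \<Rightarrow> nat \<Rightarrow> vel \<Rightarrow> real) \<Rightarrow> nat \<Rightarrow> nat \<Rightarrow> vel \<Rightarrow> real" where
  "Kt h a i x = (\<Sum>b<s. \<Sum>k<r a. \<Sum>j<r b. \<Sum>l<r b. Kx h a b i j k l x)"

abbreviation "KK \<equiv> Kop s r m I \<phi> n sig"

lemma inL2_D: "inL2 s r h \<Longrightarrow> a < s \<Longrightarrow> i < r a \<Longrightarrow> sqint lborel (h a i)"
  by (simp add: inL2_iff)

lemma sqint_Kx:
  assumes v: "valid a b i j k l" and h: "inL2 s r h"
  shows "sqint lborel (Kx h a b i j k l)"
  unfolding Kx_def using v
  by (intro sqint_diff sqint_add sqint_cmult compact_kernel_sqint good v inL2_D[OF h]) (auto simp: valid_def)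

lemma sqint_Kt:
  assumes h: "inL2 s r h" and i: "a < s" "i < r a"
  shows "sqint lborel (Kt h a i)"
  unfolding Kt_def using i by (intro sqint_sum sqint_Kx h) (auto simp: valid_def)

text \<open>The integral may be split into three where each term is integrable, which Schur's bound
  grants for almost every \<open>x\<close>.\<close>

lemma inner_AE:
  assumes v: "valid a b i j k l" and h: "inL2 s r h"
  shows "AE x in lborel. (LINT y | lborel. sphere_int (Kint h a b i j k l x y)) = Kx h a b i j k l x"
proof -
  interpret U: pair_sigma_finite "lborel :: vel measure" usph by unfold_locales
  note Kint_measurable[OF v h, measurable]
  have sq: "sqint lborel (h a k)" "sqint lborel (h b l)" "sqint lborel (h b j)"
    using v inL2_D[OF h] by (auto simp: valid_def)
  let ?t1 = "\<lambda>x p. h a k (e1 a b i j k l (x, p)) * w1 a b i j k l (x, p)"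
  let ?t2 = "\<lambda>x p. h b l (e2 a b i j k l (x, p)) * w2 a b i j k l (x, p)"
  let ?t3 = "\<lambda>x p. h b j (e3 a b i j k l (x, p)) * w3 a b i j k l (x, p)"
  let ?rhs = "\<lambda>x p. c1 a b i j k l * ?t1 x p + c2 a b i j k l * ?t2 x p - c3 a b i j k l * ?t3 x p"
  have unit: "AE p in Ym. norm (snd p) = 1"
  proof -
    have "AE y in (lborel :: vel measure). AE w in usph. norm (snd (y, w)) = 1"
      using AE_usph by simp
    then show ?thesis
      by (intro U.AE_pair_measure) measurable
  qed
  show ?thesis
    using compact_kernel_integrable[OF good(1)[OF v] sq(1)] compact_kernel_integrable[OF good(2)[OF v] sq(2)]
      compact_kernel_integrable[OF good(3)[OF v] sq(3)]
  proof eventually_elim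
    case (elim x)
    have i: "integrable Ym (?rhs x)"
      by (intro Bochner_Integration.integrable_diff Bochner_Integration.integrable_add integrable_mult_right elim)
    have eq: "AE p in Ym. Kint h a b i j k l x (fst p) (snd p) = ?rhs x p"
      using unit by eventually_elim (use Kint_eq[OF v] in \<open>simp add: case_prod_unfold\<close>)
    have [measurable]: "?rhs x \<in> borel_measurable Ym" using i by (rule borel_measurable_integrable)
    have km: "(\<lambda>p. Kint h a b i j k l x (fst p) (snd p)) \<in> borel_measurable Ym" by measurable
    have i': "integrable Ym (\<lambda>p. Kint h a b i j k l x (fst p) (snd p))"
      using integrable_cong_AE[OF km _ eq] i by simp
    have "(LINT y | lborel. sphere_int (Kint h a b i j k l x y)) = (LINT y | lborel. LINT w | usph. Kint h a b i j k l x y w)"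
      by (intro Bochner_Integration.integral_cong sphere_int_eq) auto
    also have "\<dots> = (LINT p | Ym. Kint h a b i j k l x (fst p) (snd p))"
      using U.integral_fst'[OF i'] by simp
    also have "\<dots> = (LINT p | Ym. ?rhs x p)"
      by (rule integral_cong_AE[OF km _ eq]) measurable
    also have "\<dots> = Kx h a b i j k l x"
      using elim by (simp add: Kx_def Top_def)
    finally show ?case .
  qed
qed

lemma Kop_AE:
  assumes h: "inL2 s r h" and i: "a < s" "i < r a"
  shows "AE x in lborel. KK h a i x = Kt h a i x"
  unfolding Kop_def Kt_def
  by (intro AE_sum_eq inner_AE h) (use i in \<open>auto simp: valid_def\<close>)

text \<open>Shown from the definition and not from the operators of Schur type: agreeing almost
  everywhere with a Borel function does not make a function Borel, as \<open>lborel\<close> is not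
  complete.\<close>

lemma Kop_measurable:
  assumes h: "inL2 s r h" and i: "a < s" "i < r a"
  shows "KK h a i \<in> borel_measurable borel"
  unfolding Kop_def
proof (intro borel_measurable_sum)
  fix b k j l assume "b \<in> {..<s}" "k \<in> {..<r a}" "j \<in> {..<r b}" "l \<in> {..<r b}"
  then have v: "valid a b i j k l" using i by (simp add: valid_def)
  note Kint_measurable[OF v h, measurable]
  have "(\<lambda>x. LINT y | lborel. sphere_int (Kint h a b i j k l x y)) = (\<lambda>x. LINT y | lborel. LINT w | usph. Kint h a b i j k l x y w)"
    by (intro ext Bochner_Integration.integral_cong sphere_int_eq) auto
  also have "\<dots> \<in> borel_measurable borel" by measurable
  finally show "(\<lambda>x. LINT y | lborel. sphere_int (Kint h a b i j k l x y)) \<in> borel_measurable borel" .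
qed

lemma sqint_Kop:
  assumes h: "inL2 s r h" and i: "a < s" "i < r a"
  shows "sqint lborel (KK h a i)"
  using sqint_cong_AE[OF Kop_AE[OF h i] _ sqint_measurable[OF sqint_Kt[OF h i]]] Kop_measurable[OF h i] sqint_Kt[OF h i]
  by simp

lemma Kop_L2eq:
  assumes h: "inL2 s r h" and h': "inL2 s r h'" and eq: "L2eq s r h h'"
  shows "L2eq s r (KK h) (KK h')"
  unfolding L2eq_def
proof (intro allI impI)
  fix a i assume i: "a < s" "i < r a"
  have "AE x in lborel. Kx h a b i j k l x = Kx h' a b i j k l x" if v: "valid a b i j k l" for b j k l
  proof -
    have a: "AE x in lborel. h a k x = h' a k x" "AE x in lborel. h b l x = h' b l x" "AE x in lborel. h b j x = h' b j x"
      using eq v by (auto simp: L2eq_def valid_def)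
    have sq: "sqint lborel (h a k)" "sqint lborel (h b l)" "sqint lborel (h b j)"
      "sqint lborel (h' a k)" "sqint lborel (h' b l)" "sqint lborel (h' b j)"
      using v inL2_D[OF h] inL2_D[OF h'] by (auto simp: valid_def)
    show ?thesis
      using compact_kernel_cong[OF good(1)[OF v] sq(1,4) a(1)] compact_kernel_cong[OF good(2)[OF v] sq(2,5) a(2)]
        compact_kernel_cong[OF good(3)[OF v] sq(3,6) a(3)]
      by eventually_elim (simp add: Kx_def)
  qed
  then have "AE x in lborel. Kt h a i x = Kt h' a i x"
    unfolding Kt_def using i by (intro AE_sum_eq) (auto simp: valid_def)
  with Kop_AE[OF h i] Kop_AE[OF h' i] show "AE x in lborel. KK h a i x = KK h' a i x"
    by eventually_elim simp
qed

section \<open>Self-adjointness by permutation of the indices\<close>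

definition Om :: "(nat \<times> nat \<times> nat \<times> nat \<times> nat \<times> nat) set" where
  "Om = (SIGMA a:{..<s}. SIGMA i:{..<r a}. SIGMA b:{..<s}. SIGMA k:{..<r a}. SIGMA j:{..<r b}. {..<r b})"

text \<open>The ranges of the energy levels depend on the species, so the permutations of indices
  become bijections only on the flattened set \<open>Om\<close>.\<close>

lemma nested_sum:
  "(\<Sum>a<s. \<Sum>i<r a. \<Sum>b<s. \<Sum>k<r a. \<Sum>j<r b. \<Sum>l<r b. f a i b k j l)
    = (\<Sum>(a, i, b, k, j, l)\<in>Om. f a i b k j l :: real)"
  unfolding Om_def by (simp add: sum.Sigma)

definition t1 where
  "t1 h g = (\<lambda>(a, i, b, k, j, l). c1 a b i j k l * (\<integral>x. T1 a b i j k l (h a k) x * g a i x \<partial>lborel))"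

definition t2 where
  "t2 h g = (\<lambda>(a, i, b, k, j, l). c2 a b i j k l * (\<integral>x. T2 a b i j k l (h b l) x * g a i x \<partial>lborel))"

definition t3 where
  "t3 h g = (\<lambda>(a, i, b, k, j, l). c3 a b i j k l * (\<integral>x. T3 a b i j k l (h b j) x * g a i x \<partial>lborel))"

lemma inner_Kop:
  assumes h: "inL2 s r h" and g: "inL2 s r g"
  shows "L2inner s r (KK h) g = (\<Sum>p\<in>Om. t1 h g p + t2 h g p - t3 h g p)"
proof -
  have "L2inner s r (KK h) g = (\<Sum>a<s. \<Sum>i<r a. \<Sum>b<s. \<Sum>k<r a. \<Sum>j<r b. \<Sum>l<r b.
     t1 h g (a, i, b, k, j, l) + t2 h g (a, i, b, k, j, l) - t3 h g (a, i, b, k, j, l))"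
    unfolding L2inner_def
  proof (intro sum.cong refl)
    fix a i assume "a \<in> {..<s}" "i \<in> {..<r a}"
    then have i: "a < s" "i < r a" by auto
    have gi: "sqint lborel (g a i)" by (rule inL2_D[OF g i])
    have "(LINT x | lborel. KK h a i x * g a i x) = (LINT x | lborel. Kt h a i x * g a i x)"
    proof (rule integral_cong_AE)
      show "AE x in lborel. KK h a i x * g a i x = Kt h a i x * g a i x"
        using Kop_AE[OF h i] by eventually_elim simp
    qed (use sqint_measurable[OF sqint_Kop[OF h i]] sqint_measurable[OF sqint_Kt[OF h i]] sqint_measurable[OF gi] in auto)
    also have "\<dots> = (LINT x | lborel. (\<Sum>b<s. \<Sum>k<r a. \<Sum>j<r b. \<Sum>l<r b. Kx h a b i j k l x * g a i x))"
      by (simp add: Kt_def sum_distrib_right)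
    also have "\<dots> = (\<Sum>b<s. \<Sum>k<r a. \<Sum>j<r b. \<Sum>l<r b. LINT x | lborel. Kx h a b i j k l x * g a i x)"
    proof -
      have int: "integrable lborel (\<lambda>x. Kx h a b i j k l x * g a i x)"
        if "b < s" "k < r a" "j < r b" "l < r b" for b k j l
        using that i by (intro integrable_sqint_mult sqint_Kx h gi) (simp add: valid_def)
      show ?thesis
        using int by (subst Bochner_Integration.integral_sum, (auto intro!: Bochner_Integration.integrable_sum)[1],
          intro sum.cong refl)+
    qed
    also have "\<dots> = (\<Sum>b<s. \<Sum>k<r a. \<Sum>j<r b. \<Sum>l<r b.
       t1 h g (a, i, b, k, j, l) + t2 h g (a, i, b, k, j, l) - t3 h g (a, i, b, k, j, l))"
    proof (intro sum.cong refl)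
      fix b k j l assume "b \<in> {..<s}" "k \<in> {..<r a}" "j \<in> {..<r b}" "l \<in> {..<r b}"
      then have v: "valid a b i j k l" using i by (simp add: valid_def)
      have sq: "sqint lborel (h a k)" "sqint lborel (h b l)" "sqint lborel (h b j)"
        using v inL2_D[OF h] by (auto simp: valid_def)
      note I = integrable_sqint_mult[OF compact_kernel_sqint[OF good(1)[OF v] sq(1)] gi]
        integrable_sqint_mult[OF compact_kernel_sqint[OF good(2)[OF v] sq(2)] gi]
        integrable_sqint_mult[OF compact_kernel_sqint[OF good(3)[OF v] sq(3)] gi]
      have "(LINT x | lborel. Kx h a b i j k l x * g a i x)
        = (LINT x | lborel. c1 a b i j k l * (T1 a b i j k l (h a k) x * g a i x)
          + c2 a b i j k l * (T2 a b i j k l (h b l) x * g a i x)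
          - c3 a b i j k l * (T3 a b i j k l (h b j) x * g a i x))"
        by (intro Bochner_Integration.integral_cong refl) (simp add: Kx_def algebra_simps)
      also have "\<dots> = t1 h g (a, i, b, k, j, l) + t2 h g (a, i, b, k, j, l) - t3 h g (a, i, b, k, j, l)"
        using I by (simp add: t1_def t2_def t3_def)
      finally show "(LINT x | lborel. Kx h a b i j k l x * g a i x) = \<dots>" .
    qed
    finally show "(LINT x | lborel. KK h a i x * g a i x) = \<dots>" .
  qed
  then show ?thesis unfolding nested_sum by (simp add: case_prod_unfold)
qed

text \<open>Each identity is the adjoint relation summed along an involution of the indices:
  \<open>(i, j)\<close> with \<open>(k, l)\<close> for \<open>t1\<close>; \<open>(a, i)\<close> with
  \<open>(b, l)\<close> and \<open>(a, k)\<close> with \<open>(b, j)\<close> for \<open>t2\<close>;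
  \<open>(a, i)\<close> with \<open>(b, j)\<close> and \<open>(a, k)\<close> with
  \<open>(b, l)\<close> for \<open>t3\<close>.\<close>

lemma t_symm:
  assumes h: "inL2 s r h" and g: "inL2 s r g"
  shows "(\<Sum>p\<in>Om. t1 h g p) = (\<Sum>p\<in>Om. t1 g h p)"
    "(\<Sum>p\<in>Om. t2 h g p) = (\<Sum>p\<in>Om. t2 g h p)"
    "(\<Sum>p\<in>Om. t3 h g p) = (\<Sum>p\<in>Om. t3 g h p)"
proof -
  have v: "valid a b i j k l \<and> valid a b k l i j \<and> valid b a l k j i \<and> valid b a j i l k"
    if "(a, i, b, k, j, l) \<in> Om" for a i b k j l
    using that by (auto simp: Om_def valid_def)
  have e1: "t1 g h (a, k, b, i, l, j) = t1 h g (a, i, b, k, j, l)" if p: "(a, i, b, k, j, l) \<in> Om" for a i b k j l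
  proof -
    have V: "valid a b i j k l" "valid a b k l i j" using v[OF p] by auto
    have "sqint lborel (h a k)" "sqint lborel (g a i)"
      using V inL2_D[OF h] inL2_D[OF g] by (auto simp: valid_def)
    from compact_kernel_adjoint[OF good(1)[OF V(1)] good(1)[OF V(2)] adj(1)[OF V(1)] this]
    show ?thesis by (simp add: t1_def c_symm(1)[of a b k l i j] mult.commute)
  qed
  show "(\<Sum>p\<in>Om. t1 h g p) = (\<Sum>p\<in>Om. t1 g h p)"
    by (rule sum.reindex_bij_witness[where i="\<lambda>(a, i, b, k, j, l). (a, k, b, i, l, j)" and j="\<lambda>(a, i, b, k, j, l). (a, k, b, i, l, j)"])
       (auto simp: e1, auto simp: Om_def)
  have e2: "t2 g h (b, l, a, j, k, i) = t2 h g (a, i, b, k, j, l)" if p: "(a, i, b, k, j, l) \<in> Om" for a i b k j l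
  proof -
    have V: "valid a b i j k l" "valid b a l k j i" using v[OF p] by auto
    have "sqint lborel (h b l)" "sqint lborel (g a i)"
      using V inL2_D[OF h] inL2_D[OF g] by (auto simp: valid_def)
    from compact_kernel_adjoint[OF good(2)[OF V(1)] good(2)[OF V(2)] adj(2)[OF V(1)] this]
    show ?thesis by (simp add: t2_def c_symm(2)[of b a l k j i] mult.commute)
  qed
  show "(\<Sum>p\<in>Om. t2 h g p) = (\<Sum>p\<in>Om. t2 g h p)"
    by (rule sum.reindex_bij_witness[where i="\<lambda>(a, i, b, k, j, l). (b, l, a, j, k, i)" and j="\<lambda>(a, i, b, k, j, l). (b, l, a, j, k, i)"])
       (auto simp: e2, auto simp: Om_def)
  have e3: "t3 g h (b, j, a, l, i, k) = t3 h g (a, i, b, k, j, l)" if p: "(a, i, b, k, j, l) \<in> Om" for a i b k j l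
  proof -
    have V: "valid a b i j k l" "valid b a j i l k" using v[OF p] by auto
    have "sqint lborel (h b j)" "sqint lborel (g a i)"
      using V inL2_D[OF h] inL2_D[OF g] by (auto simp: valid_def)
    from compact_kernel_adjoint[OF good(3)[OF V(1)] good(3)[OF V(2)] adj(3)[OF V(1)] this]
    show ?thesis by (simp add: t3_def c_symm(3)[of b a j i l k] mult.commute)
  qed
  show "(\<Sum>p\<in>Om. t3 h g p) = (\<Sum>p\<in>Om. t3 g h p)"
    by (rule sum.reindex_bij_witness[where i="\<lambda>(a, i, b, k, j, l). (b, j, a, l, i, k)" and j="\<lambda>(a, i, b, k, j, l). (b, j, a, l, i, k)"])
       (auto simp: e3, auto simp: Om_def)
qed

lemma Kop_selfadjoint:
  assumes h: "inL2 s r h" and g: "inL2 s r g"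
  shows "L2inner s r (KK h) g = L2inner s r h (KK g)"
proof -
  have "L2inner s r h (KK g) = L2inner s r (KK g) h" by (simp add: L2inner_def mult.commute)
  then show ?thesis
    unfolding inner_Kop[OF h g] inner_Kop[OF g h] sum.distrib sum_subtractf
    using t_symm[OF h g] inner_Kop[OF g h] by (simp add: sum.distrib sum_subtractf)
qed

text \<open>Weak compactness extracts one subsequence for all components, each of the finitely many
  summands of \<open>K\<close> turns it into a Cauchy sequence, and completeness supplies the limit
  component by component.\<close>

lemma Kop_compact:
  fixes u :: "nat \<Rightarrow> nat \<Rightarrow> nat \<Rightarrow> vel \<Rightarrow> real"
  assumes u: "\<And>p. inL2 s r (u p)" and B: "\<And>p. L2norm s r (u p) \<le> B"
  shows "\<exists>sub v. strict_mono sub \<and> inL2 s r v \<and>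
            (\<lambda>p. L2norm s r (\<lambda>a i \<xi>. KK (u (sub p)) a i \<xi> - v a i \<xi>)) \<longlonglongrightarrow> 0"
proof -
  \<comment> \<open>Extension by 0 to all pairs of naturals, because the diagonal extraction runs
    over a whole countable type of indices.\<close>
  define U where "U c p = (if fst c < s \<and> snd c < r (fst c) then u p (fst c) (snd c) else (\<lambda>_. 0))" for c :: "nat \<times> nat" and p
  have Us: "sqint lborel (U c p)" for c p
    using inL2_D[OF u] by (auto simp: U_def sqint_zero)
  have UB: "(sqn lborel (U c p)) \<le> B\<^sup>2" for c p
  proof (cases "fst c < s \<and> snd c < r (fst c)")
    case True
    have "(sqn lborel (U c p)) \<le> L2inner s r (u p) (u p)"
    proof -
      have "(sqn lborel (U c p)) = (\<integral>x. u p (fst c) (snd c) x * u p (fst c) (snd c) x \<partial>lborel)"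
        using True by (simp add: U_def power2_eq_square)
      also have "\<dots> \<le> (\<Sum>i<r (fst c). \<integral>x. u p (fst c) i x * u p (fst c) i x \<partial>lborel)"
        using True by (intro member_le_sum[where f="\<lambda>i. \<integral>x. u p (fst c) i x * u p (fst c) i x \<partial>lborel"]) auto
      also have "\<dots> \<le> L2inner s r (u p) (u p)"
        unfolding L2inner_def using True
        by (intro member_le_sum[where f="\<lambda>a. \<Sum>i<r a. \<integral>x. u p a i x * u p a i x \<partial>lborel"] sum_nonneg) auto
      finally show ?thesis .
    qed
    also have "\<dots> \<le> B\<^sup>2"
      using B[of p] unfolding L2norm_def by (rule sqrt_le_D)
    finally show ?thesis .
  qed (auto simp: U_def)
  obtain \<rho> where \<rho>: "strict_mono \<rho>" and wc: "\<And>c. wcauchy (\<lambda>p. U c (\<rho> p))"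
    using weak_compactness[of U "B\<^sup>2", OF Us UB] by blast
  have wc': "wcauchy (\<lambda>p. u (\<rho> p) a i)" if "a < s" "i < r a" for a i
    using wc[of "(a, i)"] that by (simp add: U_def)
  have Kc: "l2cauchy lborel (\<lambda>p. KK (u (\<rho> p)) a i)" if i: "a < s" "i < r a" for a i
  proof -
    have "l2cauchy lborel (\<lambda>p. Kx (u (\<rho> p)) a b i j k l)" if v: "valid a b i j k l" for b j k l
    proof -
      have w: "wcauchy (\<lambda>p. u (\<rho> p) a k)" "wcauchy (\<lambda>p. u (\<rho> p) b l)" "wcauchy (\<lambda>p. u (\<rho> p) b j)"
        using v wc' by (auto simp: valid_def)
      have sq: "sqint lborel (u p a k)" "sqint lborel (u p b l)" "sqint lborel (u p b j)" for p
        using v inL2_D[OF u] by (auto simp: valid_def)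
      have T: "l2cauchy lborel (\<lambda>p. T1 a b i j k l (u (\<rho> p) a k))"
        "l2cauchy lborel (\<lambda>p. T2 a b i j k l (u (\<rho> p) b l))"
        "l2cauchy lborel (\<lambda>p. T3 a b i j k l (u (\<rho> p) b j))"
        using good[OF v] w unfolding compact_kernel_def by blast+
      have "l2cauchy lborel (\<lambda>p x. (c1 a b i j k l * T1 a b i j k l (u (\<rho> p) a k) x
        + c2 a b i j k l * T2 a b i j k l (u (\<rho> p) b l) x)
        + (- c3 a b i j k l) * T3 a b i j k l (u (\<rho> p) b j) x)"
        by (intro l2cauchy_add l2cauchy_cmult T sqint_add sqint_cmult compact_kernel_sqint good v sq)
      then show ?thesis by (simp add: Kx_def[abs_def])
    qed
    then have "l2cauchy lborel (\<lambda>p x. \<Sum>b<s. \<Sum>k<r a. \<Sum>j<r b. \<Sum>l<r b. Kx (u (\<rho> p)) a b i j k l x)"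
      using i by (intro l2cauchy_sum sqint_sum sqint_Kx u) (auto simp: valid_def)
    then have "l2cauchy lborel (\<lambda>p. Kt (u (\<rho> p)) a i)" by (simp add: Kt_def[abs_def])
    then show ?thesis
      using l2cauchy_cong_AE[where M=lborel and u="\<lambda>p. KK (u (\<rho> p)) a i" and v="\<lambda>p. Kt (u (\<rho> p)) a i"]
        Kop_AE[OF u i] sqint_measurable[OF sqint_Kop[OF u i]] sqint_measurable[OF sqint_Kt[OF u i]]
      by blast
  qed
  have "\<exists>v. sqint lborel v \<and> (\<lambda>p. \<integral>x. (KK (u (\<rho> p)) a i x - v x)\<^sup>2 \<partial>lborel) \<longlonglongrightarrow> 0" if i: "a < s" "i < r a" for a i
    using l2_complete[OF sqint_Kop[OF u i] Kc[OF i]] by blast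
  note ex = this
  \<comment> \<open>Limits are known to exist for admissible indices only; \<open>SOME\<close> makes
    \<open>v\<close> total without a claim about the others.\<close>
  define v where "v a i = (SOME v. sqint lborel v \<and> (\<lambda>p. \<integral>x. (KK (u (\<rho> p)) a i x - v x)\<^sup>2 \<partial>lborel) \<longlonglongrightarrow> 0)" for a i
  have v: "sqint lborel (v a i)"
    and lim: "(\<lambda>p. \<integral>x. (KK (u (\<rho> p)) a i x - v a i x)\<^sup>2 \<partial>lborel) \<longlonglongrightarrow> 0" if "a < s" "i < r a" for a i
    using someI_ex[OF ex[OF that]] unfolding v_def by auto
  have "(\<lambda>p. sqrt (\<Sum>a<s. \<Sum>i<r a. \<integral>x. (KK (u (\<rho> p)) a i x - v a i x)\<^sup>2 \<partial>lborel)) \<longlonglongrightarrow> sqrt (\<Sum>a<s. \<Sum>i<r a. 0)"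
    by (intro tendsto_real_sqrt tendsto_sum lim) auto
  then have "(\<lambda>p. L2norm s r (\<lambda>a i \<xi>. KK (u (\<rho> p)) a i \<xi> - v a i \<xi>)) \<longlonglongrightarrow> 0"
    by (simp add: L2norm_def L2inner_def power2_eq_square)
  then show ?thesis using \<rho> v by (intro exI[of _ \<rho>] exI[of _ v]) (simp add: inL2_iff)
qed

theorem selfadjoint_compact: "selfadjoint_compact_L2 s r KK"
  unfolding selfadjoint_compact_L2_def
proof (intro conjI allI impI)
  show "inL2 s r (KK h)" if "inL2 s r h" for h
    using sqint_Kop[OF that] by (simp add: inL2_iff)
  show "\<exists>sub v. strict_mono sub \<and> inL2 s r v \<and>
            (\<lambda>p. L2norm s r (\<lambda>a i \<xi>. KK (u (sub p)) a i \<xi> - v a i \<xi>)) \<longlonglongrightarrow> 0"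
    if "\<forall>p. inL2 s r (u p) \<and> L2norm s r (u p) \<le> B"
    for u :: "nat \<Rightarrow> nat \<Rightarrow> nat \<Rightarrow> vel \<Rightarrow> real" and B
    using Kop_compact[of u B] that by blast
qed (use Kop_L2eq Kop_selfadjoint in auto)

end

theorem theorem1:
  fixes s :: nat and r :: "nat \<Rightarrow> nat" and m :: "nat \<Rightarrow> real"
    and I :: "nat \<Rightarrow> nat \<Rightarrow> real" and \<phi> :: "nat \<Rightarrow> nat \<Rightarrow> real" and n :: "nat \<Rightarrow> real"
    and sig :: "nat \<Rightarrow> nat \<Rightarrow> real \<Rightarrow> real \<Rightarrow> nat \<Rightarrow> nat \<Rightarrow> nat \<Rightarrow> nat \<Rightarrow> real"
    and C \<gamma> :: real
  assumes s_pos: "s \<ge> 1"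
    and r_pos: "\<forall>\<alpha><s. r \<alpha> \<ge> 1"
    and m_pos: "\<forall>\<alpha><s. m \<alpha> > 0"
    and n_pos: "\<forall>\<alpha><s. n \<alpha> > 0"
    and I_nonneg: "\<forall>\<alpha><s. \<forall>i<r \<alpha>. I \<alpha> i \<ge> 0"
    and phi_pos: "\<forall>\<alpha><s. \<forall>i<r \<alpha>. \<phi> \<alpha> i > 0"
    and sig_meas: "\<forall>\<alpha><s. \<forall>\<beta><s. \<forall>i<r \<alpha>. \<forall>k<r \<alpha>. \<forall>j<r \<beta>. \<forall>l<r \<beta>.
         (\<lambda>p::real \<times> real. sig \<alpha> \<beta> (fst p) (snd p) i j k l) \<in> borel_measurable borel"
    and sig_nonneg: "\<forall>\<alpha><s. \<forall>\<beta><s. \<forall>i<r \<alpha>. \<forall>k<r \<alpha>. \<forall>j<r \<beta>. \<forall>l<r \<beta>.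
         \<forall>x c. x \<ge> 0 \<longrightarrow> -1 \<le> c \<longrightarrow> c \<le> 1 \<longrightarrow> sig \<alpha> \<beta> x c i j k l \<ge> 0"
    and sig_pos_ae: "\<forall>\<alpha><s. \<forall>\<beta><s. \<forall>i<r \<alpha>. \<forall>k<r \<alpha>. \<forall>j<r \<beta>. \<forall>l<r \<beta>.
         AE p in (lborel :: (real \<times> real) measure).
           fst p \<ge> 0 \<longrightarrow> -1 \<le> snd p \<longrightarrow> snd p \<le> 1 \<longrightarrow> sig \<alpha> \<beta> (fst p) (snd p) i j k l > 0"
    and microrev: "\<forall>\<alpha><s. \<forall>\<beta><s. \<forall>i<r \<alpha>. \<forall>k<r \<alpha>. \<forall>j<r \<beta>. \<forall>l<r \<beta>.
         \<forall>x y c. x > 0 \<longrightarrow> y > 0 \<longrightarrow> -1 \<le> c \<longrightarrow> c \<le> 1 \<longrightarrow>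
           y\<^sup>2 = x\<^sup>2 - 2 * DeltaIt m I \<alpha> \<beta> k l i j \<longrightarrow>
           \<phi> \<alpha> i * \<phi> \<beta> j * x\<^sup>2 * sig \<alpha> \<beta> x c i j k l
             = \<phi> \<alpha> k * \<phi> \<beta> l * y\<^sup>2 * sig \<alpha> \<beta> y c k l i j"
    and sym_species: "\<forall>\<alpha><s. \<forall>\<beta><s. \<forall>i<r \<alpha>. \<forall>k<r \<alpha>. \<forall>j<r \<beta>. \<forall>l<r \<beta>.
         \<forall>x c. x \<ge> 0 \<longrightarrow> -1 \<le> c \<longrightarrow> c \<le> 1 \<longrightarrow>
           sig \<alpha> \<beta> x c k l i j = sig \<beta> \<alpha> x c l k j i"
    and sym_angle: "\<forall>\<alpha><s. \<forall>i<r \<alpha>. \<forall>j<r \<alpha>. \<forall>k<r \<alpha>. \<forall>l<r \<alpha>.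
         \<forall>x c. x \<ge> 0 \<longrightarrow> -1 \<le> c \<longrightarrow> c \<le> 1 \<longrightarrow>
           sig \<alpha> \<alpha> x (- c) i j k l = sig \<alpha> \<alpha> x c i j k l"
    and sym_same: "\<forall>\<alpha><s. \<forall>i<r \<alpha>. \<forall>j<r \<alpha>. \<forall>k<r \<alpha>. \<forall>l<r \<alpha>.
         \<forall>x c. x \<ge> 0 \<longrightarrow> -1 \<le> c \<longrightarrow> c \<le> 1 \<longrightarrow>
           sig \<alpha> \<alpha> x c i j k l = sig \<alpha> \<alpha> x c j i k l \<and>
           sig \<alpha> \<alpha> x c j i k l = sig \<alpha> \<alpha> x c j i l k"
    and C_pos: "C > 0"
    and gamma: "0 < \<gamma>" "\<gamma> < 1"
    and bound: "\<forall>\<alpha><s. \<forall>\<beta><s. \<forall>i<r \<alpha>. \<forall>k<r \<alpha>. \<forall>j<r \<beta>. \<forall>l<r \<beta>.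
         \<forall>x c. x > 0 \<longrightarrow> -1 \<le> c \<longrightarrow> c \<le> 1 \<longrightarrow> x\<^sup>2 > 2 * DeltaIt m I \<alpha> \<beta> k l i j \<longrightarrow>
           (let \<Psi> = x * sqrt (x\<^sup>2 - 2 * DeltaIt m I \<alpha> \<beta> k l i j)
            in 0 \<le> sig \<alpha> \<beta> x c i j k l \<and>
               sig \<alpha> \<beta> x c i j k l \<le> C / x\<^sup>2 * (\<Psi> + \<Psi> powr (\<gamma> / 2)))"
  shows "selfadjoint_compact_L2 s r (Kop s r m I \<phi> n sig)"
proof -
  interpret collision_model s r m I \<phi> n sig C \<gamma>
    by (rule collision_model.intro) fact+
  show ?thesis by (rule selfadjoint_compact)
qed

end
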